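(* Let $\mathcal{E}$ be a category with a strict initial object $\mathbf{0}$, provided with a pretorsion theory and a coherent system of (distinguished) subobjects which are compatible. The functor $\sigma\colon\mathcal{E}\to\mathsf{Stab}(\mathcal{E})$ to the stable category is universal among all functors $F\colon\mathcal{E}\to\mathcal{X}$ such that: 1. $\mathcal{X}$ is a category provided with a torsion theory; 2. $F$ is a torsion functor; 3. for any two distinguished subobjects $S,T$ of an object $A$ of $\mathcal{E}$, $F$ transforms the square of inclusions $S\cap T\to S$, $S\cap T\to T$, $S\to S\cup T$, $T\to S\cup T$ into a zero-pushout in $\mathcal{X}$. That is, $\sigma$ itself has these properties (with $\mathsf{Stab}(\mathcal{E})$ given the torsion theory whose torsion and torsion free objects are the same as in $\mathcal{E}$), and for every functor $F\colon\mathcal{E}\to\mathcal{X}$ satisfying 1, 2, 3 there exists a unique torsion functor $G\colon\mathsf{Stab}(\mathcal{E})\to\mathcal{X}$ with $G\circ\sigma=F$.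
   Context: Subobjects and monomorphisms representing them are not distinguished; unions are suprema of subobjects. **Zero-pushout.** In a category with a zero object, a commutative square $ca=db$ (with $a,b$ having common domain and $c,d$ common codomain) is a zero-pushout when, for all arrows $f,g$ with $fa=gb$ such that at least one of $f$, $g$ is zero, there is a unique $h$ with $hc=f$ and $hd=g$. **Coherent system of subobjects** on a category with strict initial object $\mathbf{0}$: for each object a class of "distinguished" subobjects (represented by "distinguished monomorphisms") such that: (CS1) $\mathbf{0}$ and $A$ are distinguished in $A$; (CS2) the union of two distinguished subobjects exists and is distinguished; (CS3) the pullback of a distinguished subobject along any morphism exists and is distinguished; (CS4) pulling back distinguished subobjects preserves their unions; (CS5) if $A$ is distinguished in $B$ and $B$ is distinguished in $C$, then $A$ is distinguished in $C$. A **distinguished epimorphism** $A\to B$ is an epimorphism not factoring through any proper distinguished subobject of $B$. **Pretorsion theory** on a category: a pair $(\mathcal{T},\mathcal{F})$ of isomorphism-closed classes of objects (torsion, torsion free objects). Objects in $\mathcal{T}\cap\mathcal{F}$ are trivial; $\mathcal{Z}$ is the ideal of trivial morphisms, i.e. those factoring through a trivial object. A $\mathcal{Z}$-kernel of $f$ is an arrow $k$ with $fk\in\mathcal{Z}$ such that every $m$ with $fm\in\mathcal{Z}$ factors uniquely through $k$; $\mathcal{Z}$-cokernels are dual. $K\xrightarrow{k}A\xrightarrow{q}Q$ is short $\mathcal{Z}$-exact when $k$ is a $\mathcal{Z}$-kernel of $q$ and $q$ is a $\mathcal{Z}$-cokernel of $k$. Axioms: (PT1) every arrow from a torsion object to a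 torsion free object is trivial; (PT2) each object $A$ has a (canonical) short $\mathcal{Z}$-exact sequence $\tau(A)\xrightarrow{\varepsilon_A}A\xrightarrow{\eta_A}\phi(A)$ with $\tau(A)\in\mathcal{T}$, $\phi(A)\in\mathcal{F}$. These sequences are unique up to isomorphism and make $\tau,\phi$ functors. It is a **torsion theory** when all trivial objects are zero objects. A **torsion functor** is a functor between categories with pretorsion theories that preserves torsion objects, torsion free objects and the canonical $\mathcal{Z}$-exact sequences of (PT2). **Compatibility**: (CC1) trivial objects are closed under distinguished subobjects; (CC2) if $S,T$ are distinguished subobjects of $A$, a morphism $f\colon S\cup T\to B$ is trivial as soon as its restrictions to $S$ and $T$ are trivial; (CC3) $\phi$ preserves distinguished subobjects; (CC4) the pullback $v\colon P\to S$ of $\eta_A\colon A\to\phi(A)$ along a distinguished monomorphism $s\colon S\to\phi(A)$ is a distinguished epimorphism; (CC5) a distinguished monomorphism $s$ with $\phi(s)$ an isomorphism is an isomorphism. **Stable category.** $\mathsf{DisPar}(\mathcal{E})$ has the objects of $\mathcal{E}$; a morphism $A\to B$ is a triple $(S_0,S_1,f)$ with $S_0,S_1$ distinguished subobjects of $A$, $S_0\cup S_1=A$, $f\colon S_1\to B$ in $\mathcal{E}$, and $f$ restricted to $S_0\cap S_1$ trivial. Composition: $(T_0,T_1,g)\circ(S_0,S_1,f)=(S_0\cup f^{-1}(T_0),\,f^{-1}(T_1),\,gf')$ where $f'\colon f^{-1}(T_1)\to T_1$ is the restriction of $f$. Two parallel morphisms $(S_0,S_1,f),(T_0,T_1,g)\colon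 A\to B$ are equivalent when there are distinguished subobjects $U_0,U_1$ of $A$ with $U_0\cup U_1=A$, $U_1\subseteq S_1$, $U_1\subseteq T_1$, $f$ and $g$ equal on $U_1$, $f$ trivial on $U_0\cap S_1$ and $g$ trivial on $U_0\cap T_1$. This is a congruence, and $\mathsf{Stab}(\mathcal{E})$ is the quotient of $\mathsf{DisPar}(\mathcal{E})$ by it. The functor $\sigma\colon\mathcal{E}\to\mathsf{Stab}(\mathcal{E})$ is the identity on objects and sends $f\colon A\to B$ to the class of $(\mathbf{0},A,f)$. *)

theory Defs
  imports Main "HOL-Library.FuncSet"
begin

section \<open>Categories and functors\<close>

record ('o, 'm) cat =
  Obj :: "'o set"
  Arr :: "'m set"
  Dom :: "'m \<Rightarrow> 'o"
  Cod :: "'m \<Rightarrow> 'o"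
  Ident :: "'o \<Rightarrow> 'm"
  Comp :: "'m \<Rightarrow> 'm \<Rightarrow> 'm"  (infixl "\<cdot>\<index>" 70)

definition hom :: "('o, 'm) cat \<Rightarrow> 'o \<Rightarrow> 'o \<Rightarrow> 'm set" where
  "hom C A B = {f \<in> Arr C. Dom C f = A \<and> Cod C f = B}"

locale category =
  fixes C :: "('o, 'm) cat" (structure)
  assumes dom_closed: "f \<in> Arr C \<Longrightarrow> Dom C f \<in> Obj C"
    and cod_closed: "f \<in> Arr C \<Longrightarrow> Cod C f \<in> Obj C"
    and ident_in_hom: "A \<in> Obj C \<Longrightarrow> Ident C A \<in> hom C A A"
    and comp_in_hom: "f \<in> hom C A B \<Longrightarrow> g \<in> hom C B B' \<Longrightarrow> g \<cdot> f \<in> hom C A B'"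
    and comp_ident: "f \<in> hom C A B \<Longrightarrow> f \<cdot> Ident C A = f"
    and ident_comp: "f \<in> hom C A B \<Longrightarrow> Ident C B \<cdot> f = f"
    and comp_assoc: "f \<in> hom C A B \<Longrightarrow> g \<in> hom C B B' \<Longrightarrow> h \<in> hom C B' B'' \<Longrightarrow>
          h \<cdot> (g \<cdot> f) = (h \<cdot> g) \<cdot> f"

text \<open>The two maps of a functor are undefined outside the objects and arrows of its source, so
  that equality of functors is equality in HOL.\<close>

record ('o, 'm, 'p, 'q) fctr =
  FObj :: "'o \<Rightarrow> 'p"
  FArr :: "'m \<Rightarrow> 'q"

definition is_functor ::
    "('o, 'm) cat \<Rightarrow> ('p, 'q) cat \<Rightarrow> ('o, 'm, 'p, 'q) fctr \<Rightarrow> bool" where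
  "is_functor C D H \<longleftrightarrow>
     category C \<and> category D \<and>
     FObj H \<in> Obj C \<rightarrow>\<^sub>E Obj D \<and> FArr H \<in> Arr C \<rightarrow>\<^sub>E Arr D \<and>
     (\<forall>f\<in>Arr C. FArr H f \<in> hom D (FObj H (Dom C f)) (FObj H (Cod C f))) \<and>
     (\<forall>A\<in>Obj C. FArr H (Ident C A) = Ident D (FObj H A)) \<and>
     (\<forall>f\<in>Arr C. \<forall>g\<in>Arr C. Dom C g = Cod C f \<longrightarrow>
        FArr H (g \<cdot>\<^bsub>C\<^esub> f) = FArr H g \<cdot>\<^bsub>D\<^esub> FArr H f)"

definition compose_functors :: "('o, 'm) cat \<Rightarrow> ('p, 'q, 'r, 's) fctr \<Rightarrow> ('o, 'm, 'p, 'q) fctr \<Rightarrow>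
    ('o, 'm, 'r, 's) fctr" where
  "compose_functors C G H = \<lparr>FObj = compose (Obj C) (FObj G) (FObj H),
                  FArr = compose (Arr C) (FArr G) (FArr H)\<rparr>"


section \<open>Special arrows and objects\<close>

definition is_iso :: "('o, 'm) cat \<Rightarrow> 'm \<Rightarrow> bool" where
  "is_iso C f \<longleftrightarrow> f \<in> Arr C \<and>
     (\<exists>g \<in> hom C (Cod C f) (Dom C f).
        g \<cdot>\<^bsub>C\<^esub> f = Ident C (Dom C f) \<and> f \<cdot>\<^bsub>C\<^esub> g = Ident C (Cod C f))"

definition is_mono :: "('o, 'm) cat \<Rightarrow> 'm \<Rightarrow> bool" where
  "is_mono C s \<longleftrightarrow> s \<in> Arr C \<and>
     (\<forall>A. \<forall>x\<in>hom C A (Dom C s). \<forall>y\<in>hom C A (Dom C s). s \<cdot>\<^bsub>C\<^esub> x = s \<cdot>\<^bsub>C\<^esub> y \<longrightarrow> x = y)"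

definition is_epi :: "('o, 'm) cat \<Rightarrow> 'm \<Rightarrow> bool" where
  "is_epi C e \<longleftrightarrow> e \<in> Arr C \<and>
     (\<forall>B. \<forall>x\<in>hom C (Cod C e) B. \<forall>y\<in>hom C (Cod C e) B. x \<cdot>\<^bsub>C\<^esub> e = y \<cdot>\<^bsub>C\<^esub> e \<longrightarrow> x = y)"

definition initial_obj :: "('o, 'm) cat \<Rightarrow> 'o \<Rightarrow> bool" where
  "initial_obj C z \<longleftrightarrow> z \<in> Obj C \<and> (\<forall>A\<in>Obj C. \<exists>!f. f \<in> hom C z A)"

definition terminal_obj :: "('o, 'm) cat \<Rightarrow> 'o \<Rightarrow> bool" where
  "terminal_obj C z \<longleftrightarrow> z \<in> Obj C \<and> (\<forall>A\<in>Obj C. \<exists>!f. f \<in> hom C A z)"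

definition zero_obj :: "('o, 'm) cat \<Rightarrow> 'o \<Rightarrow> bool" where
  "zero_obj C z \<longleftrightarrow> initial_obj C z \<and> terminal_obj C z"

definition strict_initial_obj :: "('o, 'm) cat \<Rightarrow> 'o \<Rightarrow> bool" where
  "strict_initial_obj C z \<longleftrightarrow> initial_obj C z \<and> (\<forall>A. \<forall>f\<in>hom C A z. is_iso C f)"

definition from_initial :: "('o, 'm) cat \<Rightarrow> 'o \<Rightarrow> 'o \<Rightarrow> 'm" where
  "from_initial C z A = (THE f. f \<in> hom C z A)"

text \<open>The arrows of \<open>C\<close> that factor through some object of \<open>N\<close>.\<close>

definition factoring :: "('o, 'm) cat \<Rightarrow> 'o set \<Rightarrow> 'm set" where
  "factoring C N =
     {h \<cdot>\<^bsub>C\<^esub> g | g h. g \<in> Arr C \<and> h \<in> Arr C \<and> Cod C g = Dom C h \<and> Cod C g \<in> N}"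

abbreviation zero_arr :: "('o, 'm) cat \<Rightarrow> 'm \<Rightarrow> bool" where
  "zero_arr C f \<equiv> f \<in> factoring C {z. zero_obj C z}"


section \<open>Pullbacks, subobjects, unions and zero-pushouts\<close>

text \<open>\<open>is_pullback C f g p q\<close>: \<open>p\<close> is the projection to the domain of \<open>f\<close>, \<open>q\<close> the one to the
  domain of \<open>g\<close>. For monomorphisms \<open>f\<close> and \<open>g\<close> the vertex is their intersection.\<close>

definition is_pullback :: "('o, 'm) cat \<Rightarrow> 'm \<Rightarrow> 'm \<Rightarrow> 'm \<Rightarrow> 'm \<Rightarrow> bool" where
  "is_pullback C f g p q \<longleftrightarrow>
     f \<in> Arr C \<and> g \<in> Arr C \<and> Cod C f = Cod C g \<and>
     p \<in> hom C (Dom C p) (Dom C f) \<and> q \<in> hom C (Dom C p) (Dom C g) \<and>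
     f \<cdot>\<^bsub>C\<^esub> p = g \<cdot>\<^bsub>C\<^esub> q \<and>
     (\<forall>A. \<forall>x\<in>hom C A (Dom C f). \<forall>y\<in>hom C A (Dom C g). f \<cdot>\<^bsub>C\<^esub> x = g \<cdot>\<^bsub>C\<^esub> y \<longrightarrow>
        (\<exists>!h. h \<in> hom C A (Dom C p) \<and> p \<cdot>\<^bsub>C\<^esub> h = x \<and> q \<cdot>\<^bsub>C\<^esub> h = y))"

text \<open>Subobjects are given by representing monomorphisms.\<close>

definition sub_le :: "('o, 'm) cat \<Rightarrow> 'm \<Rightarrow> 'm \<Rightarrow> bool" where
  "sub_le C s t \<longleftrightarrow> is_mono C s \<and> is_mono C t \<and> Cod C s = Cod C t \<and>
     (\<exists>i \<in> hom C (Dom C s) (Dom C t). t \<cdot>\<^bsub>C\<^esub> i = s)"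

definition same_sub :: "('o, 'm) cat \<Rightarrow> 'm \<Rightarrow> 'm \<Rightarrow> bool" where
  "same_sub C s t \<longleftrightarrow> sub_le C s t \<and> sub_le C t s"

definition is_union :: "('o, 'm) cat \<Rightarrow> 'm \<Rightarrow> 'm \<Rightarrow> 'm \<Rightarrow> bool" where
  "is_union C s t u \<longleftrightarrow> sub_le C s u \<and> sub_le C t u \<and>
     (\<forall>v. sub_le C s v \<and> sub_le C t v \<longrightarrow> sub_le C u v)"

text \<open>In \<open>zero_pushout C a b c d\<close> the commutative square is \<open>c \<cdot> a = d \<cdot> b\<close>.\<close>

definition zero_pushout :: "('o, 'm) cat \<Rightarrow> 'm \<Rightarrow> 'm \<Rightarrow> 'm \<Rightarrow> 'm \<Rightarrow> bool" where
  "zero_pushout C a b c d \<longleftrightarrow>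
     a \<in> Arr C \<and> b \<in> Arr C \<and> Dom C a = Dom C b \<and>
     c \<in> hom C (Cod C a) (Cod C c) \<and> d \<in> hom C (Cod C b) (Cod C c) \<and>
     c \<cdot>\<^bsub>C\<^esub> a = d \<cdot>\<^bsub>C\<^esub> b \<and>
     (\<forall>B. \<forall>f\<in>hom C (Cod C a) B. \<forall>g\<in>hom C (Cod C b) B.
        f \<cdot>\<^bsub>C\<^esub> a = g \<cdot>\<^bsub>C\<^esub> b \<and> (zero_arr C f \<or> zero_arr C g) \<longrightarrow>
        (\<exists>!h. h \<in> hom C (Cod C c) B \<and> h \<cdot>\<^bsub>C\<^esub> c = f \<and> h \<cdot>\<^bsub>C\<^esub> d = g))"


section \<open>Coherent systems of subobjects\<close>

text \<open>\<open>D\<close> is the class of distinguished monomorphisms. It consists of all the representatives of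
  the distinguished subobjects, whence \<open>D_same_sub\<close>.\<close>

locale coherent_system = category E for E :: "('o, 'm) cat" (structure) +
  fixes zero :: 'o and D :: "'m set"
  assumes strict_initial: "strict_initial_obj E zero"
    and D_mono: "s \<in> D \<Longrightarrow> is_mono E s"
    and D_same_sub: "s \<in> D \<Longrightarrow> same_sub E s t \<Longrightarrow> t \<in> D"
    and CS1_zero: "A \<in> Obj E \<Longrightarrow> from_initial E zero A \<in> D"
    and CS1_ident: "A \<in> Obj E \<Longrightarrow> Ident E A \<in> D"
    and CS2: "s \<in> D \<Longrightarrow> t \<in> D \<Longrightarrow> Cod E s = Cod E t \<Longrightarrow> \<exists>u\<in>D. is_union E s t u"
    and CS3: "s \<in> D \<Longrightarrow> f \<in> Arr E \<Longrightarrow> Cod E f = Cod E s \<Longrightarrow> \<exists>p\<in>D. \<exists>q. is_pullback E f s p q"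
    and CS4: "s \<in> D \<Longrightarrow> t \<in> D \<Longrightarrow> is_union E s t u \<Longrightarrow>
          is_pullback E f s s' p \<Longrightarrow> is_pullback E f t t' q \<Longrightarrow> is_pullback E f u u' r \<Longrightarrow>
          is_union E s' t' u'"
    and CS5: "s \<in> D \<Longrightarrow> t \<in> D \<Longrightarrow> Cod E s = Dom E t \<Longrightarrow> t \<cdot> s \<in> D"

definition distinguished_epi :: "('o, 'm) cat \<Rightarrow> 'm set \<Rightarrow> 'm \<Rightarrow> bool" where
  "distinguished_epi C D e \<longleftrightarrow> is_epi C e \<and>
     (\<forall>s\<in>D. \<forall>g\<in>hom C (Dom C e) (Dom C s). Cod C s = Cod C e \<and> s \<cdot>\<^bsub>C\<^esub> g = e \<longrightarrow> is_iso C s)"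


section \<open>Pretorsion theories\<close>

abbreviation trivials :: "('o, 'm) cat \<Rightarrow> 'o set \<Rightarrow> 'o set \<Rightarrow> 'm set" where
  "trivials C T F \<equiv> factoring C (T \<inter> F)"

definition is_kernel :: "('o, 'm) cat \<Rightarrow> 'm set \<Rightarrow> 'm \<Rightarrow> 'm \<Rightarrow> bool" where
  "is_kernel C Z k f \<longleftrightarrow> k \<in> Arr C \<and> f \<in> Arr C \<and> Cod C k = Dom C f \<and> f \<cdot>\<^bsub>C\<^esub> k \<in> Z \<and>
     (\<forall>m\<in>Arr C. Cod C m = Dom C f \<and> f \<cdot>\<^bsub>C\<^esub> m \<in> Z \<longrightarrow>
        (\<exists>!n. n \<in> hom C (Dom C m) (Dom C k) \<and> k \<cdot>\<^bsub>C\<^esub> n = m))"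

definition is_cokernel :: "('o, 'm) cat \<Rightarrow> 'm set \<Rightarrow> 'm \<Rightarrow> 'm \<Rightarrow> bool" where
  "is_cokernel C Z q f \<longleftrightarrow> q \<in> Arr C \<and> f \<in> Arr C \<and> Cod C f = Dom C q \<and> q \<cdot>\<^bsub>C\<^esub> f \<in> Z \<and>
     (\<forall>m\<in>Arr C. Dom C m = Cod C f \<and> m \<cdot>\<^bsub>C\<^esub> f \<in> Z \<longrightarrow>
        (\<exists>!n. n \<in> hom C (Cod C q) (Cod C m) \<and> n \<cdot>\<^bsub>C\<^esub> q = m))"

definition short_exact :: "('o, 'm) cat \<Rightarrow> 'm set \<Rightarrow> 'm \<Rightarrow> 'm \<Rightarrow> bool" where
  "short_exact C Z k q \<longleftrightarrow> is_kernel C Z k q \<and> is_cokernel C Z q k"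

definition canonical_seq ::
    "('o, 'm) cat \<Rightarrow> 'o set \<Rightarrow> 'o set \<Rightarrow> 'o \<Rightarrow> 'm \<Rightarrow> 'm \<Rightarrow> bool" where
  "canonical_seq C T F A k q \<longleftrightarrow>
     Cod C k = A \<and> short_exact C (trivials C T F) k q \<and> Dom C k \<in> T \<and> Cod C q \<in> F"

locale pretorsion_theory = category C for C :: "('o, 'm) cat" (structure) +
  fixes T F :: "'o set"
  assumes T_obj: "T \<subseteq> Obj C"
    and F_obj: "F \<subseteq> Obj C"
    and T_iso: "is_iso C f \<Longrightarrow> Dom C f \<in> T \<Longrightarrow> Cod C f \<in> T"
    and F_iso: "is_iso C f \<Longrightarrow> Dom C f \<in> F \<Longrightarrow> Cod C f \<in> F"
    and PT1: "A \<in> T \<Longrightarrow> B \<in> F \<Longrightarrow> f \<in> hom C A B \<Longrightarrow> f \<in> trivials C T F"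
    and PT2: "A \<in> Obj C \<Longrightarrow> \<exists>k q. canonical_seq C T F A k q"

locale torsion_theory = pretorsion_theory +
  assumes trivial_zero: "A \<in> T \<inter> F \<Longrightarrow> zero_obj C A"

text \<open>The unit of the torsion free reflection \<open>\<phi>\<close>, for some choice of the canonical sequences
  (they are unique up to isomorphism), and \<open>\<phi>\<close> on arrows.\<close>

definition eta :: "('o, 'm) cat \<Rightarrow> 'o set \<Rightarrow> 'o set \<Rightarrow> 'o \<Rightarrow> 'm" where
  "eta C T F A = (SOME q. \<exists>k. canonical_seq C T F A k q)"

definition phi :: "('o, 'm) cat \<Rightarrow> 'o set \<Rightarrow> 'o set \<Rightarrow> 'm \<Rightarrow> 'm" where
  "phi C T F f =
     (THE u. u \<in> hom C (Cod C (eta C T F (Dom C f))) (Cod C (eta C T F (Cod C f))) \<and>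
             u \<cdot>\<^bsub>C\<^esub> eta C T F (Dom C f) = eta C T F (Cod C f) \<cdot>\<^bsub>C\<^esub> f)"

definition torsion_functor ::
    "('o, 'm) cat \<Rightarrow> 'o set \<Rightarrow> 'o set \<Rightarrow> ('p, 'q) cat \<Rightarrow> 'p set \<Rightarrow> 'p set \<Rightarrow>
     ('o, 'm, 'p, 'q) fctr \<Rightarrow> bool" where
  "torsion_functor C T F C' T' F' H \<longleftrightarrow>
     pretorsion_theory C T F \<and> pretorsion_theory C' T' F' \<and> is_functor C C' H \<and>
     FObj H ` T \<subseteq> T' \<and> FObj H ` F \<subseteq> F' \<and>
     (\<forall>A k q. canonical_seq C T F A k q \<longrightarrow>
        canonical_seq C' T' F' (FObj H A) (FArr H k) (FArr H q))"


section \<open>Compatibility\<close>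

locale compatible =
  coherent_system E zero D + pretorsion_theory E T F
  for E :: "('o, 'm) cat" (structure) and zero :: 'o and D :: "'m set" and T F :: "'o set" +
  assumes CC1: "s \<in> D \<Longrightarrow> Cod E s \<in> T \<inter> F \<Longrightarrow> Dom E s \<in> T \<inter> F"
    and CC2: "s \<in> D \<Longrightarrow> t \<in> D \<Longrightarrow> is_union E s t u \<Longrightarrow>
          i \<in> hom E (Dom E s) (Dom E u) \<Longrightarrow> u \<cdot> i = s \<Longrightarrow>
          j \<in> hom E (Dom E t) (Dom E u) \<Longrightarrow> u \<cdot> j = t \<Longrightarrow>
          f \<in> hom E (Dom E u) B \<Longrightarrow> f \<cdot> i \<in> trivials E T F \<Longrightarrow> f \<cdot> j \<in> trivials E T F \<Longrightarrow>
          f \<in> trivials E T F"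
    and CC3: "s \<in> D \<Longrightarrow> phi E T F s \<in> D"
    and CC4: "A \<in> Obj E \<Longrightarrow> s \<in> D \<Longrightarrow> is_pullback E (eta E T F A) s w v \<Longrightarrow>
          distinguished_epi E D v"
    and CC5: "s \<in> D \<Longrightarrow> is_iso E (phi E T F s) \<Longrightarrow> is_iso E s"


section \<open>The category of distinguished partial morphisms\<close>

type_synonym 'm triple = "'m \<times> 'm \<times> 'm"

text \<open>For a monomorphism \<open>s\<close> and an arrow \<open>f\<close> on its domain: the restriction of \<open>f\<close> to the
  intersection of \<open>s\<close> with the subobject \<open>u\<close> lies in \<open>Z\<close>.\<close>

definition trivial_on_meet :: "('o, 'm) cat \<Rightarrow> 'm set \<Rightarrow> 'm \<Rightarrow> 'm \<Rightarrow> 'm \<Rightarrow> bool" where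
  "trivial_on_meet E Z u s f \<longleftrightarrow> (\<forall>p q. is_pullback E u s p q \<longrightarrow> f \<cdot>\<^bsub>E\<^esub> q \<in> Z)"

definition triples :: "('o, 'm) cat \<Rightarrow> 'm set \<Rightarrow> 'm set \<Rightarrow> 'm triple set" where
  "triples E D Z =
     {(s0, s1, f). s0 \<in> D \<and> s1 \<in> D \<and> Cod E s0 = Cod E s1 \<and>
        is_union E s0 s1 (Ident E (Cod E s1)) \<and>
        f \<in> Arr E \<and> Dom E f = Dom E s1 \<and> trivial_on_meet E Z s0 s1 f}"

text \<open>Two triples of representing monomorphisms describe the same morphism of \<open>DisPar\<close>.\<close>

definition same_triple :: "('o, 'm) cat \<Rightarrow> 'm triple \<Rightarrow> 'm triple \<Rightarrow> bool" where
  "same_triple E = (\<lambda>(s0, s1, f) (t0, t1, g).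
     same_sub E s0 t0 \<and>
     (\<exists>i \<in> hom E (Dom E s1) (Dom E t1). is_iso E i \<and> t1 \<cdot>\<^bsub>E\<^esub> i = s1 \<and> g \<cdot>\<^bsub>E\<^esub> i = f))"

definition same_rel :: "('o, 'm) cat \<Rightarrow> 'm set \<Rightarrow> 'm set \<Rightarrow> 'm triple rel" where
  "same_rel E D Z = {(x, y). x \<in> triples E D Z \<and> y \<in> triples E D Z \<and> same_triple E x y}"

text \<open>\<open>is_composite E y x (w0, w1, h)\<close>: the triple \<open>(w0, w1, h)\<close> represents the composite of \<open>y\<close>
  after \<open>x\<close>. The inverse images of \<open>t0\<close> and \<open>t1\<close> along \<open>f\<close> are subobjects of the domain of \<open>s1\<close>;
  they become subobjects of its codomain by composition with \<open>s1\<close>.\<close>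

definition is_composite :: "('o, 'm) cat \<Rightarrow> 'm triple \<Rightarrow> 'm triple \<Rightarrow> 'm triple \<Rightarrow> bool" where
  "is_composite E = (\<lambda>(t0, t1, g) (s0, s1, f) (w0, w1, h).
     Cod E f = Cod E t1 \<and>
     (\<exists>p0 f0. is_pullback E f t0 p0 f0 \<and> is_union E s0 (s1 \<cdot>\<^bsub>E\<^esub> p0) w0) \<and>
     (\<exists>p1 f1. is_pullback E f t1 p1 f1 \<and> w1 = s1 \<cdot>\<^bsub>E\<^esub> p1 \<and> h = g \<cdot>\<^bsub>E\<^esub> f1))"

text \<open>An arrow of \<open>DisPar\<close> is a triple of two subobjects and an arrow, that is, a class of triples
  under change of representatives. Composites of triples are determined up to such a change, so
  that the set given for \<open>Comp\<close> is again a single class.\<close>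

definition DisPar ::
    "('o, 'm) cat \<Rightarrow> 'o \<Rightarrow> 'm set \<Rightarrow> 'm set \<Rightarrow> ('o, 'm triple set) cat" where
  "DisPar E zero D Z = \<lparr>
     Obj = Obj E,
     Arr = triples E D Z // same_rel E D Z,
     Dom = (\<lambda>\<alpha>. the_elem ((\<lambda>(s0, s1, f). Cod E s1) ` \<alpha>)),
     Cod = (\<lambda>\<alpha>. the_elem ((\<lambda>(s0, s1, f). Cod E f) ` \<alpha>)),
     Ident = (\<lambda>A. same_rel E D Z `` {(from_initial E zero A, Ident E A, Ident E A)}),
     Comp = (\<lambda>\<beta> \<alpha>. {w. \<exists>y\<in>\<beta>. \<exists>x\<in>\<alpha>. is_composite E y x w})\<rparr>"


section \<open>The stable category\<close>

definition quotient_cat :: "('o, 'm) cat \<Rightarrow> 'm rel \<Rightarrow> ('o, 'm set) cat" where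
  "quotient_cat C R = \<lparr>
     Obj = Obj C,
     Arr = Arr C // R,
     Dom = (\<lambda>a. the_elem (Dom C ` a)),
     Cod = (\<lambda>a. the_elem (Cod C ` a)),
     Ident = (\<lambda>A. R `` {Ident C A}),
     Comp = (\<lambda>b a. R `` {\<beta> \<cdot>\<^bsub>C\<^esub> \<alpha> | \<alpha> \<beta>. \<alpha> \<in> a \<and> \<beta> \<in> b})\<rparr>"

text \<open>The congruence on \<open>DisPar\<close>; on representatives, \<open>u0\<close>, \<open>u1\<close> are the covering subobjects and
  \<open>a\<close>, \<open>b\<close> the inclusions of \<open>u1\<close> in \<open>s1\<close> and in \<open>t1\<close>.\<close>

definition equivalent_triples ::
    "('o, 'm) cat \<Rightarrow> 'm set \<Rightarrow> 'm set \<Rightarrow> 'm triple \<Rightarrow> 'm triple \<Rightarrow> bool" where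
  "equivalent_triples E D Z = (\<lambda>(s0, s1, f) (t0, t1, g).
     Cod E s1 = Cod E t1 \<and> Cod E f = Cod E g \<and>
     (\<exists>u0\<in>D. \<exists>u1\<in>D. Cod E u0 = Cod E s1 \<and> Cod E u1 = Cod E s1 \<and>
        is_union E u0 u1 (Ident E (Cod E s1)) \<and>
        (\<exists>a\<in>hom E (Dom E u1) (Dom E s1). \<exists>b\<in>hom E (Dom E u1) (Dom E t1).
           s1 \<cdot>\<^bsub>E\<^esub> a = u1 \<and> t1 \<cdot>\<^bsub>E\<^esub> b = u1 \<and> f \<cdot>\<^bsub>E\<^esub> a = g \<cdot>\<^bsub>E\<^esub> b) \<and>
        trivial_on_meet E Z u0 s1 f \<and> trivial_on_meet E Z u0 t1 g))"

definition stab_rel ::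
    "('o, 'm) cat \<Rightarrow> 'o \<Rightarrow> 'm set \<Rightarrow> 'm set \<Rightarrow> 'm triple set rel" where
  "stab_rel E zero D Z =
     {(\<alpha>, \<beta>). \<alpha> \<in> Arr (DisPar E zero D Z) \<and> \<beta> \<in> Arr (DisPar E zero D Z) \<and>
        (\<exists>x\<in>\<alpha>. \<exists>y\<in>\<beta>. equivalent_triples E D Z x y)}"

definition Stab ::
    "('o, 'm) cat \<Rightarrow> 'o \<Rightarrow> 'm set \<Rightarrow> 'o set \<Rightarrow> 'o set \<Rightarrow> ('o, 'm triple set set) cat" where
  "Stab E zero D T F =
     quotient_cat (DisPar E zero D (trivials E T F)) (stab_rel E zero D (trivials E T F))"

definition stab_functor ::
    "('o, 'm) cat \<Rightarrow> 'o \<Rightarrow> 'm set \<Rightarrow> 'o set \<Rightarrow> 'o set \<Rightarrow> ('o, 'm, 'o, 'm triple set set) fctr" where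
  "stab_functor E zero D T F = \<lparr>
     FObj = (\<lambda>A\<in>Obj E. A),
     FArr = (\<lambda>f\<in>Arr E. stab_rel E zero D (trivials E T F) ``
       {same_rel E D (trivials E T F) `` {(from_initial E zero (Dom E f), Ident E (Dom E f), f)}})\<rparr>"


section \<open>The properties characterizing the stable category\<close>

definition zero_pushouts_of_unions ::
    "('o, 'm) cat \<Rightarrow> 'm set \<Rightarrow> ('p, 'q) cat \<Rightarrow> ('o, 'm, 'p, 'q) fctr \<Rightarrow> bool" where
  "zero_pushouts_of_unions E D X H \<longleftrightarrow>
     (\<forall>s\<in>D. \<forall>t\<in>D. \<forall>p q u i j.
        is_pullback E s t p q \<and> is_union E s t u \<and>
        i \<in> hom E (Dom E s) (Dom E u) \<and> u \<cdot>\<^bsub>E\<^esub> i = s \<and>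
        j \<in> hom E (Dom E t) (Dom E u) \<and> u \<cdot>\<^bsub>E\<^esub> j = t \<longrightarrow>
        zero_pushout X (FArr H p) (FArr H q) (FArr H i) (FArr H j))"

definition stable_functor_into ::
    "('o, 'm) cat \<Rightarrow> 'm set \<Rightarrow> 'o set \<Rightarrow> 'o set \<Rightarrow> ('p, 'q) cat \<Rightarrow> 'p set \<Rightarrow> 'p set \<Rightarrow>
     ('o, 'm, 'p, 'q) fctr \<Rightarrow> bool" where
  "stable_functor_into E D T F X TX FX H \<longleftrightarrow>
     torsion_theory X TX FX \<and> torsion_functor E T F X TX FX H \<and>
     zero_pushouts_of_unions E D X H"

end

theory Submission
  imports Defs
begin

text \<open>Distinguished subobjects are treated as sets of generalized elements: membership in a
  distinguished subobject, and triviality (by CC2), can be tested on the two members of a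
  distinguished union. Equality of arrows cannot, which is why squares of unions are only
  zero-pushouts. The torsion free quotient of \<open>A\<close> in \<open>E\<close> remains one in the stable category because
  a distinguished subobject of \<open>A\<close> is the inverse image of its own torsion free quotient (CC5), and
  because arrows on a distinguished subobject of \<open>\<phi> A\<close> are trivial as soon as they are so after
  restriction along \<open>\<eta> A\<close> (CC4). A triple \<open>(s0, s1, f)\<close> is sent by the universal functor to the
  arrow that is \<open>H f\<close> on \<open>s1\<close> and zero on \<open>s0\<close>; a zero-pushout determines it, and
  equivalent triples yield the same arrow since they can be compared on a common cover.\<close>

text \<open>Pullbacks and unions in \<open>E\<close> exist only up to isomorphism, and arrows of the
  stable category are classes of classes of triples; computing with chosen representatives would
  carry comparison isomorphisms through every argument. A triple is therefore read as a partial map,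
  through the sets \<open>pts\<close> and the values \<open>ap\<close>. Its class is determined by
  the partial map \<open>(s1, f)\<close> (\<open>cls_eqI\<close>), while \<open>s0\<close> witnesses
  that this map can be completed by zero. Identities between composites thus reduce to identities
  between composites of partial maps.

  The congruence asks for equality on one member of a cover and for triviality on the other. This
  gives the stable category the locality of equality that \<open>E\<close> lacks, in the case where
  one part is trivial. Each comparison of arrows then amounts to producing a cover: refined for
  transitivity, pulled back along a partial map for composition, pushed along \<open>\<phi>\<close>
  for cokernels, extended from one member of a cover for zero-pushouts.

  The kernel half of exactness only cancels counits; CC4 and CC5 enter for the cokernel
  half.\<close>

context category
begin

section \<open>Arrows, monomorphisms and isomorphisms\<close>

lemma in_hom_iff [simp]: "f \<in> hom C A B \<longleftrightarrow> f \<in> Arr C \<and> Dom C f = A \<and> Cod C f = B"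
  by (simp add: hom_def)

lemma obj_simps [simp]:
  "f \<in> Arr C \<Longrightarrow> Dom C f \<in> Obj C"
  "f \<in> Arr C \<Longrightarrow> Cod C f \<in> Obj C"
  by (auto intro: dom_closed cod_closed)

lemma ident_simps [simp]:
  assumes "A \<in> Obj C"
  shows "Ident C A \<in> Arr C" "Dom C (Ident C A) = A" "Cod C (Ident C A) = A"
  using ident_in_hom[OF assms] by auto

lemma comp_simps [simp]:
  assumes "f \<in> Arr C" "g \<in> Arr C" "Cod C f = Dom C g"
  shows "g \<cdot> f \<in> Arr C" "Dom C (g \<cdot> f) = Dom C f" "Cod C (g \<cdot> f) = Cod C g"
  using comp_in_hom[of f "Dom C f" "Cod C f" g "Cod C g"] assms by auto

lemma comp_ident' [simp]: "f \<in> Arr C \<Longrightarrow> A = Dom C f \<Longrightarrow> f \<cdot> Ident C A = f"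
  using comp_ident[of f] by simp

lemma ident_comp' [simp]: "f \<in> Arr C \<Longrightarrow> A = Cod C f \<Longrightarrow> Ident C A \<cdot> f = f"
  using ident_comp[of f] by simp

lemma assoc:
  "f \<in> Arr C \<Longrightarrow> g \<in> Arr C \<Longrightarrow> h \<in> Arr C \<Longrightarrow> Cod C f = Dom C g \<Longrightarrow> Cod C g = Dom C h \<Longrightarrow>
     (h \<cdot> g) \<cdot> f = h \<cdot> (g \<cdot> f)"
  using comp_assoc[of f _ _ g _ h] by simp

lemma monoD:
  "is_mono C s \<Longrightarrow> s \<cdot> x = s \<cdot> y \<Longrightarrow> x \<in> Arr C \<Longrightarrow> y \<in> Arr C \<Longrightarrow> Dom C x = Dom C y \<Longrightarrow>
     Cod C x = Dom C s \<Longrightarrow> Cod C y = Dom C s \<Longrightarrow> x = y"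
  unfolding is_mono_def by auto

lemma monoI:
  assumes "s \<in> Arr C"
    and "\<And>x y. x \<in> Arr C \<Longrightarrow> y \<in> Arr C \<Longrightarrow> Dom C x = Dom C y \<Longrightarrow> Cod C x = Dom C s \<Longrightarrow>
       Cod C y = Dom C s \<Longrightarrow> s \<cdot> x = s \<cdot> y \<Longrightarrow> x = y"
  shows "is_mono C s"
  using assms unfolding is_mono_def by simp

lemma mono_arr [simp]: "is_mono C s \<Longrightarrow> s \<in> Arr C"
  unfolding is_mono_def by auto

lemma epiD:
  "is_epi C e \<Longrightarrow> x \<cdot> e = y \<cdot> e \<Longrightarrow> x \<in> Arr C \<Longrightarrow> y \<in> Arr C \<Longrightarrow> Cod C x = Cod C y \<Longrightarrow>
     Dom C x = Cod C e \<Longrightarrow> Dom C y = Cod C e \<Longrightarrow> x = y"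
  unfolding is_epi_def by auto

lemma isoE:
  assumes "is_iso C f"
  obtains g where "f \<in> Arr C" "g \<in> Arr C" "Dom C g = Cod C f" "Cod C g = Dom C f"
    "g \<cdot> f = Ident C (Dom C f)" "f \<cdot> g = Ident C (Cod C f)" "is_iso C g"
proof -
  obtain g where "f \<in> Arr C" "g \<in> Arr C" "Dom C g = Cod C f" "Cod C g = Dom C f"
    "g \<cdot> f = Ident C (Dom C f)" "f \<cdot> g = Ident C (Cod C f)"
    using assms unfolding is_iso_def by auto
  moreover from this have "is_iso C g"
    unfolding is_iso_def by auto
  ultimately show thesis
    using that by blast
qed

lemma isoI:
  "f \<in> Arr C \<Longrightarrow> g \<in> Arr C \<Longrightarrow> Dom C g = Cod C f \<Longrightarrow> Cod C g = Dom C f \<Longrightarrow>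
    g \<cdot> f = Ident C (Dom C f) \<Longrightarrow> f \<cdot> g = Ident C (Cod C f) \<Longrightarrow> is_iso C f"
  unfolding is_iso_def by auto

lemma iso_ident: "A \<in> Obj C \<Longrightarrow> is_iso C (Ident C A)"
  by (rule isoI[of _ "Ident C A"]) auto

lemma mono_split_epi_iso:
  assumes "is_mono C s" "r \<in> Arr C" "Dom C r = Cod C s" "Cod C r = Dom C s"
    "s \<cdot> r = Ident C (Cod C s)"
  shows "is_iso C s"
proof (rule isoI[of s r])
  have "s \<cdot> (r \<cdot> s) = s \<cdot> Ident C (Dom C s)"
    using assms assoc[of s r s] by simp
  then show "r \<cdot> s = Ident C (Dom C s)"
    by (rule monoD[OF assms(1)]) (use assms in auto)
qed (use assms in auto)

lemma mono_ident: "A \<in> Obj C \<Longrightarrow> is_mono C (Ident C A)"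
  unfolding is_mono_def by simp

lemma mono_comp:
  assumes "is_mono C s" "is_mono C t" "Cod C s = Dom C t"
  shows "is_mono C (t \<cdot> s)"
proof (rule monoI)
  fix x y
  assume that: "x \<in> Arr C" "y \<in> Arr C" "Dom C x = Dom C y" "Cod C x = Dom C (t \<cdot> s)"
    "Cod C y = Dom C (t \<cdot> s)" "(t \<cdot> s) \<cdot> x = (t \<cdot> s) \<cdot> y"
  have "t \<cdot> (s \<cdot> x) = t \<cdot> (s \<cdot> y)"
    using that assms by (simp add: assoc)
  then have "s \<cdot> x = s \<cdot> y"
    by (rule monoD[OF assms(2)]) (use that assms in auto)
  then show "x = y"
    by (rule monoD[OF assms(1)]) (use that assms in auto)
qed (use assms in auto)

end

section \<open>Generalized elements of subobjects\<close>

text \<open>A subobject of \<open>A\<close> is identified with the set of arrows to \<open>A\<close> (of any domain)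
  that factor through it; \<open>ap C s f z\<close> is the value of the partial map \<open>(s, f)\<close> at \<open>z\<close>.\<close>

definition pts :: "('o, 'm) cat \<Rightarrow> 'm \<Rightarrow> 'm set" where
  "pts C s = {z \<in> Arr C. Cod C z = Cod C s \<and>
     (\<exists>x\<in>Arr C. Dom C x = Dom C z \<and> Cod C x = Dom C s \<and> s \<cdot>\<^bsub>C\<^esub> x = z)}"

definition fac :: "('o, 'm) cat \<Rightarrow> 'm \<Rightarrow> 'm \<Rightarrow> 'm" where
  "fac C s z = (THE x. x \<in> hom C (Dom C z) (Dom C s) \<and> s \<cdot>\<^bsub>C\<^esub> x = z)"

definition ap :: "('o, 'm) cat \<Rightarrow> 'm \<Rightarrow> 'm \<Rightarrow> 'm \<Rightarrow> 'm" where
  "ap C s f z = f \<cdot>\<^bsub>C\<^esub> fac C s z"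

context category
begin

lemma pts_arr: "z \<in> pts C s \<Longrightarrow> z \<in> Arr C"
  and pts_cod: "z \<in> pts C s \<Longrightarrow> Cod C z = Cod C s"
  by (auto simp: pts_def)

lemma pts_I: "s \<in> Arr C \<Longrightarrow> x \<in> Arr C \<Longrightarrow> Cod C x = Dom C s \<Longrightarrow> s \<cdot> x \<in> pts C s"
  by (auto simp: pts_def)

lemma pts_self [simp]: "s \<in> Arr C \<Longrightarrow> s \<in> pts C s"
  using pts_I[of s "Ident C (Dom C s)"] by simp

lemma pts_ident [simp]: "A \<in> Obj C \<Longrightarrow> pts C (Ident C A) = {z \<in> Arr C. Cod C z = A}"
  by (auto simp: pts_def)

lemma pts_comp:
  assumes "s \<in> Arr C" "z \<in> pts C s" "a \<in> Arr C" "Cod C a = Dom C z"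
  shows "z \<cdot> a \<in> pts C s"
proof -
  obtain x where x: "x \<in> Arr C" "Dom C x = Dom C z" "Cod C x = Dom C s" "s \<cdot> x = z" "z \<in> Arr C"
    using assms(2) by (auto simp: pts_def)
  have "z \<cdot> a = s \<cdot> (x \<cdot> a)"
    using x assms by (simp add: assoc[symmetric])
  then show ?thesis
    using pts_I[of s "x \<cdot> a"] x assms by simp
qed

lemma fac_unique:
  assumes "is_mono C s" "x \<in> Arr C" "Cod C x = Dom C s" "s \<cdot> x = z"
  shows "fac C s z = x"
  unfolding fac_def
proof (rule the_equality)
  show "x \<in> hom C (Dom C z) (Dom C s) \<and> s \<cdot> x = z"
    using assms by auto
  show "y = x" if "y \<in> hom C (Dom C z) (Dom C s) \<and> s \<cdot> y = z" for y
    by (rule monoD[OF assms(1)]) (use that assms in auto)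
qed

lemma fac_simps [simp]:
  assumes "is_mono C s" "z \<in> pts C s"
  shows "fac C s z \<in> Arr C" "Dom C (fac C s z) = Dom C z" "Cod C (fac C s z) = Dom C s"
    "s \<cdot> fac C s z = z"
proof -
  obtain x where x: "x \<in> Arr C" "Dom C x = Dom C z" "Cod C x = Dom C s" "s \<cdot> x = z"
    using assms(2) by (auto simp: pts_def)
  then have "fac C s z = x"
    using assms fac_unique by blast
  then show "fac C s z \<in> Arr C" "Dom C (fac C s z) = Dom C z" "Cod C (fac C s z) = Dom C s"
    "s \<cdot> fac C s z = z"
    using x by auto
qed

lemma fac_self [simp]: "is_mono C s \<Longrightarrow> fac C s s = Ident C (Dom C s)"
  by (rule fac_unique) auto

lemma fac_ident [simp]: "z \<in> Arr C \<Longrightarrow> A = Cod C z \<Longrightarrow> fac C (Ident C A) z = z"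
  by (rule fac_unique) (auto intro: mono_ident)

lemma fac_comp:
  assumes "is_mono C s" "z \<in> pts C s" "a \<in> Arr C" "Cod C a = Dom C z"
  shows "fac C s (z \<cdot> a) = fac C s z \<cdot> a"
  by (rule fac_unique) (use assms in \<open>auto simp: assoc[symmetric]\<close>)

lemma ap_simps [simp]:
  assumes "is_mono C s" "z \<in> pts C s" "f \<in> Arr C" "Dom C f = Dom C s"
  shows "ap C s f z \<in> Arr C" "Dom C (ap C s f z) = Dom C z" "Cod C (ap C s f z) = Cod C f"
  using assms by (auto simp: ap_def)

text \<open>Naturality in the generalized element: restricting an element restricts the value of the
  partial map. Every local argument on values rests on this.\<close>

lemma ap_comp:
  assumes "is_mono C s" "z \<in> pts C s" "f \<in> Arr C" "Dom C f = Dom C s" "a \<in> Arr C"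
    "Cod C a = Dom C z"
  shows "ap C s f (z \<cdot> a) = ap C s f z \<cdot> a"
  using assms by (simp add: ap_def fac_comp assoc)

lemma ap_self [simp]: "is_mono C s \<Longrightarrow> f \<in> Arr C \<Longrightarrow> Dom C f = Dom C s \<Longrightarrow> ap C s f s = f"
  by (simp add: ap_def)

lemma ap_ident [simp]: "z \<in> Arr C \<Longrightarrow> A = Cod C z \<Longrightarrow> ap C (Ident C A) f z = f \<cdot> z"
  by (simp add: ap_def)

section \<open>Order and suprema of subobjects in terms of elements\<close>

lemma sub_le_iff:
  "sub_le C s t \<longleftrightarrow> is_mono C s \<and> is_mono C t \<and> s \<in> pts C t"
  unfolding sub_le_def pts_def mem_Collect_eq in_hom_iff Bex_def by (blast intro: mono_arr)

text \<open>The Yoneda argument: \<open>s\<close> is the generic element of itself, all its other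
  elements being restrictions of it.\<close>

lemma pts_le_iff:
  assumes "is_mono C s" "is_mono C t"
  shows "s \<in> pts C t \<longleftrightarrow> pts C s \<subseteq> pts C t"
proof
  assume *: "s \<in> pts C t"
  show "pts C s \<subseteq> pts C t"
  proof
    fix z assume z: "z \<in> pts C s"
    then have "s \<cdot> fac C s z \<in> pts C t"
      using assms * by (intro pts_comp) auto
    then show "z \<in> pts C t"
      using assms z by simp
  qed
qed (use assms in auto)

lemma sub_le_pts: "sub_le C s t \<longleftrightarrow> is_mono C s \<and> is_mono C t \<and> pts C s \<subseteq> pts C t"
  using pts_le_iff sub_le_iff by auto

lemma same_sub_pts: "same_sub C s t \<longleftrightarrow> is_mono C s \<and> is_mono C t \<and> pts C s = pts C t"
  by (auto simp: same_sub_def sub_le_pts)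

lemma pts_eq_cod: "is_mono C s \<Longrightarrow> pts C s = pts C t \<Longrightarrow> Cod C s = Cod C t"
  by (metis mono_arr pts_self pts_cod)

text \<open>The union is a supremum among sets of the form \<open>pts\<close>, not the set-theoretic
  union: an element of \<open>u\<close> falls into \<open>s\<close> or \<open>t\<close> only after
  restriction to the members of a cover of its domain (\<open>union_local\<close>).\<close>

lemma is_union_pts:
  "is_union C s t u \<longleftrightarrow> is_mono C s \<and> is_mono C t \<and> is_mono C u \<and> pts C s \<subseteq> pts C u \<and>
     pts C t \<subseteq> pts C u \<and>
     (\<forall>v. is_mono C v \<longrightarrow> pts C s \<subseteq> pts C v \<longrightarrow> pts C t \<subseteq> pts C v \<longrightarrow> pts C u \<subseteq> pts C v)"
  unfolding is_union_def sub_le_pts by blast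

lemma is_union_sym: "is_union C s t u \<Longrightarrow> is_union C t s u"
  unfolding is_union_pts by blast

lemma is_union_same:
  "is_union C s t u \<Longrightarrow> is_mono C s' \<Longrightarrow> is_mono C t' \<Longrightarrow> is_mono C u' \<Longrightarrow>
    pts C s' = pts C s \<Longrightarrow> pts C t' = pts C t \<Longrightarrow> pts C u' = pts C u \<Longrightarrow> is_union C s' t' u'"
  unfolding is_union_pts by simp

lemma is_union_unique: "is_union C s t u \<Longrightarrow> is_union C s t u' \<Longrightarrow> pts C u = pts C u'"
  unfolding is_union_pts by blast

section \<open>Pullbacks of monomorphisms as inverse images\<close>

lemma pullbackD:
  assumes "is_pullback C f s p q"
  shows "f \<in> Arr C" "s \<in> Arr C" "p \<in> Arr C" "q \<in> Arr C" "Cod C p = Dom C f" "Cod C q = Dom C s"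
    "Dom C q = Dom C p" "Cod C f = Cod C s" "f \<cdot> p = s \<cdot> q"
  using assms unfolding is_pullback_def in_hom_iff by (elim conjE; simp)+

lemma pullback_lift:
  assumes "is_pullback C f s p q" "x \<in> Arr C" "y \<in> Arr C" "Dom C x = Dom C y"
    "Cod C x = Dom C f" "Cod C y = Dom C s" "f \<cdot> x = s \<cdot> y"
  obtains h where "h \<in> Arr C" "Dom C h = Dom C x" "Cod C h = Dom C p" "p \<cdot> h = x" "q \<cdot> h = y"
proof -
  have "x \<in> hom C (Dom C x) (Dom C f)" "y \<in> hom C (Dom C x) (Dom C s)"
    using assms by auto
  then have "\<exists>!h. h \<in> hom C (Dom C x) (Dom C p) \<and> p \<cdot> h = x \<and> q \<cdot> h = y"
    using assms(1)[unfolded is_pullback_def] assms(7) by blast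
  then show thesis
    using that by auto
qed

lemma pullback_unique:
  assumes "is_pullback C f s p q" "h \<in> Arr C" "h' \<in> Arr C" "Cod C h = Dom C p" "Cod C h' = Dom C p"
    "Dom C h = Dom C h'" "p \<cdot> h = p \<cdot> h'" "q \<cdot> h = q \<cdot> h'"
  shows "h = h'"
proof -
  note P = pullbackD[OF assms(1)]
  have eq: "f \<cdot> (p \<cdot> h) = s \<cdot> (q \<cdot> h)"
    using P assms by (simp add: assoc[symmetric])
  have hom: "p \<cdot> h \<in> hom C (Dom C h) (Dom C f)" "q \<cdot> h \<in> hom C (Dom C h) (Dom C s)"
    using P assms by auto
  have "\<exists>!k. k \<in> hom C (Dom C h) (Dom C p) \<and> p \<cdot> k = p \<cdot> h \<and> q \<cdot> k = q \<cdot> h"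
    using assms(1)[unfolded is_pullback_def] hom eq by blast
  moreover have "h \<in> hom C (Dom C h) (Dom C p)" "h' \<in> hom C (Dom C h) (Dom C p)"
    using assms by auto
  ultimately show ?thesis
    using assms(7,8) by metis
qed

text \<open>Besides identifying \<open>p\<close> with the inverse image of \<open>s\<close>, this
  recovers the other projection from \<open>f\<close>: on elements it is \<open>f\<close> followed
  by factorization through \<open>s\<close>.\<close>

lemma pullback_pts:
  assumes "is_pullback C f s p q" "is_mono C s"
  shows "is_mono C p" "pts C p = {z \<in> Arr C. Cod C z = Dom C f \<and> f \<cdot> z \<in> pts C s}"
    "z \<in> pts C p \<Longrightarrow> q \<cdot> fac C p z = fac C s (f \<cdot> z)"
proof -
  note P [simp] = pullbackD[OF assms(1)]
  show m: "is_mono C p"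
  proof (rule monoI)
    fix x y
    assume that: "x \<in> Arr C" "y \<in> Arr C" "Dom C x = Dom C y" "Cod C x = Dom C p"
      "Cod C y = Dom C p" "p \<cdot> x = p \<cdot> y"
    have "s \<cdot> (q \<cdot> x) = (f \<cdot> p) \<cdot> x"
      using that by (simp add: assoc)
    also have "\<dots> = (f \<cdot> p) \<cdot> y"
      using that by (simp add: assoc del: P(9))
    also have "\<dots> = s \<cdot> (q \<cdot> y)"
      using that by (simp add: assoc)
    finally have "q \<cdot> x = q \<cdot> y"
      by (rule monoD[OF assms(2)]) (use that in auto)
    with that show "x = y"
      by (intro pullback_unique[OF assms(1), of x y]) simp_all
  qed simp
  have key: "s \<cdot> (q \<cdot> fac C p z) = f \<cdot> z" "z \<in> Arr C" "Cod C z = Dom C f" if z: "z \<in> pts C p" for z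
  proof -
    have "s \<cdot> (q \<cdot> fac C p z) = (s \<cdot> q) \<cdot> fac C p z"
      using z m by (simp add: assoc del: P(9))
    also have "\<dots> = (f \<cdot> p) \<cdot> fac C p z"
      by simp
    also have "\<dots> = f \<cdot> z"
      using z m by (simp add: assoc del: P(9))
    finally show "s \<cdot> (q \<cdot> fac C p z) = f \<cdot> z" .
    show "z \<in> Arr C" "Cod C z = Dom C f"
      using z pts_arr pts_cod[OF z] by simp_all
  qed
  show "pts C p = {z \<in> Arr C. Cod C z = Dom C f \<and> f \<cdot> z \<in> pts C s}"
  proof (intro equalityI subsetI)
    fix z assume z: "z \<in> pts C p"
    have "f \<cdot> z \<in> pts C s"
      using pts_I[of s "q \<cdot> fac C p z"] key[OF z] z m by simp
    then show "z \<in> {z \<in> Arr C. Cod C z = Dom C f \<and> f \<cdot> z \<in> pts C s}"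
      using key[OF z] by simp
  next
    fix z assume "z \<in> {z \<in> Arr C. Cod C z = Dom C f \<and> f \<cdot> z \<in> pts C s}"
    then have z: "z \<in> Arr C" "Cod C z = Dom C f" "f \<cdot> z \<in> pts C s"
      by simp_all
    obtain h where "h \<in> Arr C" "Dom C h = Dom C z" "Cod C h = Dom C p" "p \<cdot> h = z"
      by (rule pullback_lift[OF assms(1), of z "fac C s (f \<cdot> z)"]) (use z assms(2) in simp_all)
    then show "z \<in> pts C p"
      using pts_I[of p h] by simp
  qed
  show "q \<cdot> fac C p z = fac C s (f \<cdot> z)" if z: "z \<in> pts C p"
    by (rule fac_unique[symmetric, OF assms(2)]) (use key[OF z] m z in simp_all)
qed

text \<open>Converse of \<open>pullback_pts\<close>: pullbacks along monomorphisms are recognized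
  from elements, which is how the squares required by CS4 and CC4 are produced.\<close>

lemma pullbackI:
  assumes "is_mono C s" "is_mono C p" "f \<in> Arr C" "Cod C f = Cod C s" "Cod C p = Dom C f"
    and pts: "pts C p = {z \<in> Arr C. Cod C z = Dom C f \<and> f \<cdot> z \<in> pts C s}"
    and q: "q = fac C s (f \<cdot> p)"
  shows "is_pullback C f s p q"
proof -
  have fp: "f \<cdot> p \<in> pts C s"
    using pts_self[of p] assms by auto
  have key: "\<exists>!h. h \<in> hom C A (Dom C p) \<and> p \<cdot> h = x \<and> q \<cdot> h = y"
    if "x \<in> hom C A (Dom C f)" "y \<in> hom C A (Dom C s)" "f \<cdot> x = s \<cdot> y" for A x y
  proof (rule ex1I[of _ "fac C p x"])
    have x: "x \<in> pts C p"
      using that assms pts_I[of s y] by auto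
    have "s \<cdot> (q \<cdot> fac C p x) = (s \<cdot> q) \<cdot> fac C p x"
      using x fp q assms by (simp add: assoc del: fac_simps(4))
    also have "\<dots> = f \<cdot> x"
      using x fp q assms by (simp add: assoc)
    finally have "s \<cdot> (q \<cdot> fac C p x) = s \<cdot> y"
      using that by simp
    then have "q \<cdot> fac C p x = y"
      by (rule monoD[OF assms(1)]) (use that x fp q assms in auto)
    then show "fac C p x \<in> hom C A (Dom C p) \<and> p \<cdot> fac C p x = x \<and> q \<cdot> fac C p x = y"
      using x assms that by auto
    show "h = fac C p x" if "h \<in> hom C A (Dom C p) \<and> p \<cdot> h = x \<and> q \<cdot> h = y" for h
      using that assms fac_unique by force
  qed
  show ?thesis
    unfolding is_pullback_def
    by (intro conjI allI ballI impI key) (use assms fp in simp_all)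
qed

lemma pts_comp_iff:
  assumes "is_mono C s" "is_mono C p" "Cod C p = Dom C s"
  shows "pts C (s \<cdot> p) = {z \<in> pts C s. fac C s z \<in> pts C p}"
    and "z \<in> pts C (s \<cdot> p) \<Longrightarrow> fac C (s \<cdot> p) z = fac C p (fac C s z)"
proof -
  show eq: "pts C (s \<cdot> p) = {z \<in> pts C s. fac C s z \<in> pts C p}"
  proof (intro equalityI subsetI)
    fix z assume "z \<in> pts C (s \<cdot> p)"
    then obtain x where x: "x \<in> Arr C" "Cod C x = Dom C p" "(s \<cdot> p) \<cdot> x = z" "z \<in> Arr C"
      using assms by (auto simp: pts_def)
    have z: "z = s \<cdot> (p \<cdot> x)"
      using x assms by (simp add: assoc)
    then have "fac C s z = p \<cdot> x"
      using x assms by (intro fac_unique) auto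
    then show "z \<in> {z \<in> pts C s. fac C s z \<in> pts C p}"
      using x z assms pts_I[of s "p \<cdot> x"] pts_I[of p x] by auto
  next
    fix z assume "z \<in> {z \<in> pts C s. fac C s z \<in> pts C p}"
    then have z: "z \<in> pts C s" "fac C s z \<in> pts C p"
      by auto
    have "z = (s \<cdot> p) \<cdot> fac C p (fac C s z)"
      using z assms by (simp add: assoc)
    then show "z \<in> pts C (s \<cdot> p)"
      using pts_I[of "s \<cdot> p" "fac C p (fac C s z)"] z assms by simp
  qed
  show "fac C (s \<cdot> p) z = fac C p (fac C s z)" if "z \<in> pts C (s \<cdot> p)"
    using that assms unfolding eq by (intro fac_unique mono_comp) (auto simp: assoc)
qed

lemma mono_rightcancel:
  assumes "is_mono C (t \<cdot> s)" "s \<in> Arr C" "t \<in> Arr C" "Cod C s = Dom C t"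
  shows "is_mono C s"
proof (rule monoI)
  fix x y
  assume that: "x \<in> Arr C" "y \<in> Arr C" "Dom C x = Dom C y" "Cod C x = Dom C s"
    "Cod C y = Dom C s" "s \<cdot> x = s \<cdot> y"
  show "x = y"
  proof (rule monoD[OF assms(1)])
    show "(t \<cdot> s) \<cdot> x = (t \<cdot> s) \<cdot> y"
      using that assms by (simp add: assoc)
  qed (use that assms in auto)
qed (use assms in auto)

text \<open>Along a monomorphism \<open>u\<close>, the inverse image of the composite
  \<open>u \<cdot> i\<close> is \<open>i\<close> again.\<close>

lemma pts_cancel:
  assumes "is_mono C u" "i \<in> Arr C" "Cod C i = Dom C u"
  shows "pts C i = {x \<in> Arr C. Cod C x = Dom C u \<and> u \<cdot> x \<in> pts C (u \<cdot> i)}"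
proof (intro equalityI subsetI)
  fix x assume x: "x \<in> pts C i"
  then obtain y where y: "y \<in> Arr C" "Dom C y = Dom C x" "Cod C y = Dom C i" "i \<cdot> y = x"
    by (auto simp: pts_def)
  have "u \<cdot> x = (u \<cdot> i) \<cdot> y"
    using y assms by (simp add: assoc)
  then have "u \<cdot> x \<in> pts C (u \<cdot> i)"
    using pts_I[of "u \<cdot> i" y] y assms by simp
  then show "x \<in> {x \<in> Arr C. Cod C x = Dom C u \<and> u \<cdot> x \<in> pts C (u \<cdot> i)}"
    using pts_arr[OF x] pts_cod[OF x] assms by simp
next
  fix x assume "x \<in> {x \<in> Arr C. Cod C x = Dom C u \<and> u \<cdot> x \<in> pts C (u \<cdot> i)}"
  then have x: "x \<in> Arr C" "Cod C x = Dom C u" "u \<cdot> x \<in> pts C (u \<cdot> i)"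
    by auto
  then obtain y where y: "y \<in> Arr C" "Dom C y = Dom C (u \<cdot> x)" "Cod C y = Dom C (u \<cdot> i)"
    "(u \<cdot> i) \<cdot> y = u \<cdot> x"
    by (auto simp: pts_def)
  have d: "Dom C y = Dom C x" "Cod C y = Dom C i"
    using y(2,3) x(1,2) assms by simp_all
  have "u \<cdot> (i \<cdot> y) = u \<cdot> x"
    using y(1,4) d assms by (simp add: assoc)
  then have "i \<cdot> y = x"
    by (rule monoD[OF assms(1)]) (use y(1) d x assms in simp_all)
  then show "x \<in> pts C i"
    using pts_I[of i y] y(1) d assms by simp
qed

end

section \<open>Kernels and cokernels relative to the trivial arrows\<close>

context category
begin

lemma epiI:
  assumes "e \<in> Arr C"
    and "\<And>x y. x \<in> Arr C \<Longrightarrow> y \<in> Arr C \<Longrightarrow> Cod C x = Cod C y \<Longrightarrow> Dom C x = Cod C e \<Longrightarrow>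
       Dom C y = Cod C e \<Longrightarrow> x \<cdot> e = y \<cdot> e \<Longrightarrow> x = y"
  shows "is_epi C e"
  using assms unfolding is_epi_def by simp

lemma iso_mono:
  assumes "is_iso C i" shows "is_mono C i"
proof -
  from assms obtain j where j: "i \<in> Arr C" "j \<in> Arr C" "Dom C j = Cod C i" "Cod C j = Dom C i"
    "j \<cdot> i = Ident C (Dom C i)"
    by (rule isoE)
  then have "is_mono C (j \<cdot> i)"
    by (simp add: mono_ident)
  then show ?thesis
    by (rule mono_rightcancel) (use j in simp_all)
qed

lemma iso_epi:
  assumes "is_iso C i" shows "is_epi C i"
proof -
  from assms obtain j where j: "i \<in> Arr C" "j \<in> Arr C" "Dom C j = Cod C i" "Cod C j = Dom C i"
    "i \<cdot> j = Ident C (Cod C i)"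
    by (rule isoE)
  show ?thesis
  proof (rule epiI)
    fix x y
    assume *: "x \<in> Arr C" "y \<in> Arr C" "Cod C x = Cod C y" "Dom C x = Cod C i"
       "Dom C y = Cod C i" "x \<cdot> i = y \<cdot> i"
    have "x \<cdot> (i \<cdot> j) = y \<cdot> (i \<cdot> j)"
      using j(1-4) * by (simp add: assoc[symmetric])
    then show "x = y"
      using j *(1-5) by simp
  qed (use j in simp)
qed

lemma epi_split_mono_iso:
  assumes "is_epi C e" "r \<in> Arr C" "Dom C r = Cod C e" "Cod C r = Dom C e"
    "r \<cdot> e = Ident C (Dom C e)"
  shows "is_iso C e"
proof (rule isoI[of e r])
  have e: "e \<in> Arr C"
    using assms(1) by (simp add: is_epi_def)
  have "(e \<cdot> r) \<cdot> e = Ident C (Cod C e) \<cdot> e"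
    using assms e by (simp add: assoc)
  then show "e \<cdot> r = Ident C (Cod C e)"
    by (rule epiD[OF assms(1)]) (use assms e in simp_all)
  show "e \<in> Arr C" by (rule e)
qed (use assms in simp_all)

lemma epi_arr: "is_epi C e \<Longrightarrow> e \<in> Arr C"
  by (simp add: is_epi_def)

section \<open>The ideal of arrows through a class of objects, and kernels relative to it\<close>

lemma factoring_I:
  "g \<in> Arr C \<Longrightarrow> h \<in> Arr C \<Longrightarrow> Cod C g = Dom C h \<Longrightarrow> Cod C g \<in> N \<Longrightarrow> h \<cdot> g \<in> factoring C N"
  unfolding factoring_def by blast

lemma factoring_E:
  assumes "f \<in> factoring C N"
  obtains g h where "g \<in> Arr C" "h \<in> Arr C" "Cod C g = Dom C h" "Cod C g \<in> N" "f = h \<cdot> g"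
    "Dom C g = Dom C f" "Cod C h = Cod C f"
proof -
  from assms obtain g h where *: "g \<in> Arr C" "h \<in> Arr C" "Cod C g = Dom C h" "Cod C g \<in> N"
    "f = h \<cdot> g"
    unfolding factoring_def by blast
  moreover have "Dom C g = Dom C f" "Cod C h = Cod C f"
    using * by simp_all
  ultimately show thesis
    using that by blast
qed

lemma factoring_dom: "f \<in> Arr C \<Longrightarrow> Dom C f \<in> N \<Longrightarrow> f \<in> factoring C N"
  using factoring_I[of "Ident C (Dom C f)" f N] by simp

lemma factoring_cod: "f \<in> Arr C \<Longrightarrow> Cod C f \<in> N \<Longrightarrow> f \<in> factoring C N"
  using factoring_I[of f "Ident C (Cod C f)" N] by simp

lemma factoring_comp_left:
  assumes "f \<in> factoring C N" "g \<in> Arr C" "Dom C g = Cod C f"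
  shows "g \<cdot> f \<in> factoring C N"
proof -
  from assms(1) obtain a b where *: "a \<in> Arr C" "b \<in> Arr C" "Cod C a = Dom C b" "Cod C a \<in> N"
      "f = b \<cdot> a" "Cod C b = Cod C f"
    by (rule factoring_E)
  then have "g \<cdot> f = (g \<cdot> b) \<cdot> a"
    using assms by (simp add: assoc)
  moreover have "(g \<cdot> b) \<cdot> a \<in> factoring C N"
    by (rule factoring_I) (use *(1-4,6) assms(2,3) in simp_all)
  ultimately show ?thesis
    by simp
qed

lemma factoring_comp_right:
  assumes "f \<in> factoring C N" "g \<in> Arr C" "Cod C g = Dom C f"
  shows "f \<cdot> g \<in> factoring C N"
proof -
  from assms(1) obtain a b where *: "a \<in> Arr C" "b \<in> Arr C" "Cod C a = Dom C b" "Cod C a \<in> N"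
      "f = b \<cdot> a" "Dom C a = Dom C f"
    by (rule factoring_E)
  then have "f \<cdot> g = b \<cdot> (a \<cdot> g)"
    using assms by (simp add: assoc)
  moreover have "b \<cdot> (a \<cdot> g) \<in> factoring C N"
    by (rule factoring_I) (use *(1-4,6) assms(2,3) in simp_all)
  ultimately show ?thesis
    by simp
qed

lemma kernelI:
  assumes "is_mono C k" "f \<in> Arr C" "Cod C k = Dom C f" "f \<cdot> k \<in> Z"
    and "\<And>m. m \<in> Arr C \<Longrightarrow> Cod C m = Dom C f \<Longrightarrow> f \<cdot> m \<in> Z \<Longrightarrow>
      \<exists>n\<in>Arr C. Cod C n = Dom C k \<and> k \<cdot> n = m"
  shows "is_kernel C Z k f"
proof -
  have "\<exists>!n. n \<in> hom C (Dom C m) (Dom C k) \<and> k \<cdot> n = m"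
    if m: "m \<in> Arr C" "Cod C m = Dom C f \<and> f \<cdot> m \<in> Z" for m
  proof -
    obtain n where n: "n \<in> Arr C" "Cod C n = Dom C k" "k \<cdot> n = m"
      using assms(5)[of m] m by blast
    show ?thesis
    proof (rule ex1I[of _ n])
      show "n \<in> hom C (Dom C m) (Dom C k) \<and> k \<cdot> n = m"
        using n assms(1) by auto
      show "y = n" if y: "y \<in> hom C (Dom C m) (Dom C k) \<and> k \<cdot> y = m" for y
        by (rule monoD[OF assms(1)]) (use y n assms(1) in auto)
    qed
  qed
  then show ?thesis
    unfolding is_kernel_def using assms(1-4) by (intro conjI ballI impI) simp_all
qed

lemma kernelD:
  assumes "is_kernel C Z k f"
  shows "k \<in> Arr C" "f \<in> Arr C" "Cod C k = Dom C f" "f \<cdot> k \<in> Z"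
  using assms unfolding is_kernel_def by auto

lemma kernel_lift:
  assumes "is_kernel C Z k f" "m \<in> Arr C" "Cod C m = Dom C f" "f \<cdot> m \<in> Z"
  obtains n where "n \<in> Arr C" "Dom C n = Dom C m" "Cod C n = Dom C k" "k \<cdot> n = m"
proof -
  have "\<exists>!n. n \<in> hom C (Dom C m) (Dom C k) \<and> k \<cdot> n = m"
    using assms unfolding is_kernel_def by blast
  then show thesis
    using that by auto
qed

lemma cokernelI:
  assumes "is_epi C q" "f \<in> Arr C" "Dom C q = Cod C f" "q \<cdot> f \<in> Z"
    and "\<And>m. m \<in> Arr C \<Longrightarrow> Dom C m = Cod C f \<Longrightarrow> m \<cdot> f \<in> Z \<Longrightarrow>
      \<exists>n\<in>Arr C. Dom C n = Cod C q \<and> n \<cdot> q = m"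
  shows "is_cokernel C Z q f"
proof -
  note q = epi_arr[OF assms(1)]
  have "\<exists>!n. n \<in> hom C (Cod C q) (Cod C m) \<and> n \<cdot> q = m"
    if m: "m \<in> Arr C" "Dom C m = Cod C f \<and> m \<cdot> f \<in> Z" for m
  proof -
    obtain n where n: "n \<in> Arr C" "Dom C n = Cod C q" "n \<cdot> q = m"
      using assms(5)[of m] m by blast
    show ?thesis
    proof (rule ex1I[of _ n])
      show "n \<in> hom C (Cod C q) (Cod C m) \<and> n \<cdot> q = m"
        using n q by auto
      show "y = n" if y: "y \<in> hom C (Cod C q) (Cod C m) \<and> y \<cdot> q = m" for y
        by (rule epiD[OF assms(1)]) (use y n q in auto)
    qed
  qed
  then show ?thesis
    unfolding is_cokernel_def using assms(2-4) q by (intro conjI ballI impI) simp_all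
qed

lemma cokernelD:
  assumes "is_cokernel C Z q f"
  shows "q \<in> Arr C" "f \<in> Arr C" "Cod C f = Dom C q" "q \<cdot> f \<in> Z"
  using assms unfolding is_cokernel_def by auto

lemma cokernel_lift:
  assumes "is_cokernel C Z q f" "m \<in> Arr C" "Dom C m = Cod C f" "m \<cdot> f \<in> Z"
  obtains n where "n \<in> Arr C" "Dom C n = Cod C q" "Cod C n = Cod C m" "n \<cdot> q = m"
proof -
  have "\<exists>!n. n \<in> hom C (Cod C q) (Cod C m) \<and> n \<cdot> q = m"
    using assms unfolding is_cokernel_def by blast
  then show thesis
    using that by auto
qed

text \<open>The definition of a kernel grants uniqueness only for arrows that \<open>f\<close> sends
  into the ideal. Every \<open>k \<cdot> x\<close> is such an arrow, since the ideal is closed under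
  composition.\<close>

lemma kernel_mono:
  assumes "is_kernel C (factoring C N) k f" shows "is_mono C k"
proof (rule monoI)
  note k = kernelD[OF assms]
  show "k \<in> Arr C" by (rule k)
  fix x y
  assume *: "x \<in> Arr C" "y \<in> Arr C" "Dom C x = Dom C y" "Cod C x = Dom C k" "Cod C y = Dom C k"
    "k \<cdot> x = k \<cdot> y"
  have "f \<cdot> (k \<cdot> x) \<in> factoring C N"
    using factoring_comp_right[OF k(4), of x] k(1-3) *(1-5) by (simp add: assoc)
  moreover have "k \<cdot> x \<in> Arr C" "Cod C (k \<cdot> x) = Dom C f"
    using k(1-3) *(1-5) by simp_all
  ultimately have "\<exists>!n. n \<in> hom C (Dom C (k \<cdot> x)) (Dom C k) \<and> k \<cdot> n = k \<cdot> x"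
    using assms unfolding is_kernel_def by blast
  moreover have "x \<in> hom C (Dom C (k \<cdot> x)) (Dom C k)" "y \<in> hom C (Dom C (k \<cdot> x)) (Dom C k)"
    using k(1-3) *(1-5) by simp_all
  ultimately show "x = y"
    using *(6) by metis
qed

lemma cokernel_epi:
  assumes "is_cokernel C (factoring C N) q f" shows "is_epi C q"
proof (rule epiI)
  note q = cokernelD[OF assms]
  show "q \<in> Arr C" by (rule q)
  fix x y
  assume *: "x \<in> Arr C" "y \<in> Arr C" "Cod C x = Cod C y" "Dom C x = Cod C q" "Dom C y = Cod C q"
    "x \<cdot> q = y \<cdot> q"
  have "(x \<cdot> q) \<cdot> f \<in> factoring C N"
    using factoring_comp_left[OF q(4), of x] q(1-3) *(1-5) by (simp add: assoc)
  moreover have "x \<cdot> q \<in> Arr C" "Dom C (x \<cdot> q) = Cod C f"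
    using q(1-3) *(1-5) by simp_all
  ultimately have "\<exists>!n. n \<in> hom C (Cod C q) (Cod C (x \<cdot> q)) \<and> n \<cdot> q = x \<cdot> q"
    using assms unfolding is_cokernel_def by blast
  moreover have "x \<in> hom C (Cod C q) (Cod C (x \<cdot> q))" "y \<in> hom C (Cod C q) (Cod C (x \<cdot> q))"
    using q(1-3) *(1-5) by simp_all
  ultimately show "x = y"
    using *(6) by metis
qed

lemma kernel_iso:
  assumes "is_kernel C (factoring C N) k f" "is_iso C j" "Cod C j = Dom C k" "is_iso C i"
    "Dom C i = Cod C f"
  shows "is_kernel C (factoring C N) (k \<cdot> j) (i \<cdot> f)"
proof (rule kernelI)
  note k = kernelD[OF assms(1)]
  from assms(2) obtain j' where j: "j \<in> Arr C" "j' \<in> Arr C" "Dom C j' = Cod C j"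
    "Cod C j' = Dom C j"
    "j \<cdot> j' = Ident C (Cod C j)" by (rule isoE)
  from assms(4) obtain i' where i: "i \<in> Arr C" "i' \<in> Arr C" "Dom C i' = Cod C i"
    "Cod C i' = Dom C i"
    "i' \<cdot> i = Ident C (Dom C i)" by (rule isoE)
  show "is_mono C (k \<cdot> j)"
    by (rule mono_comp) (use assms iso_mono kernel_mono in blast)+
  have "(i \<cdot> f) \<cdot> (k \<cdot> j) = i \<cdot> ((f \<cdot> k) \<cdot> j)"
    using k(1-3) j(1-4) i(1-4) assms(3,5) by (simp add: assoc)
  moreover have "(f \<cdot> k) \<cdot> j \<in> factoring C N"
    by (rule factoring_comp_right) (use k j(1-4) assms(3) in simp_all)
  then have "i \<cdot> ((f \<cdot> k) \<cdot> j) \<in> factoring C N"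
    by (rule factoring_comp_left) (use k(1-3) j(1-4) i(1-4) assms(3,5) in simp_all)
  ultimately show "(i \<cdot> f) \<cdot> (k \<cdot> j) \<in> factoring C N"
    by simp
  show "\<exists>n\<in>Arr C. Cod C n = Dom C (k \<cdot> j) \<and> (k \<cdot> j) \<cdot> n = m"
    if m: "m \<in> Arr C" "Cod C m = Dom C (i \<cdot> f)" "(i \<cdot> f) \<cdot> m \<in> factoring C N" for m
  proof -
    have "i' \<cdot> ((i \<cdot> f) \<cdot> m) \<in> factoring C N"
      using m(3) by (rule factoring_comp_left) (use m(1,2) k(1-3) i(1-4) assms(5) in simp_all)
    moreover have "i' \<cdot> ((i \<cdot> f) \<cdot> m) = (i' \<cdot> i) \<cdot> (f \<cdot> m)"
      using m(1,2) k(1-3) i(1-4) assms(5) by (simp add: assoc)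
    moreover have "(i' \<cdot> i) \<cdot> (f \<cdot> m) = f \<cdot> m"
      using m(1,2) k(1-3) i assms(5) by simp
    ultimately have "f \<cdot> m \<in> factoring C N" by simp
    moreover have "Cod C m = Dom C f"
      using m k(1-3) i assms(5) by simp
    ultimately obtain n where n: "n \<in> Arr C" "Cod C n = Dom C k" "k \<cdot> n = m"
      using kernel_lift[OF assms(1) m(1)] by metis
    have "(k \<cdot> j) \<cdot> (j' \<cdot> n) = k \<cdot> ((j \<cdot> j') \<cdot> n)"
      using n(1,2) k(1-3) j(1-4) assms(3) by (simp add: assoc)
    also have "\<dots> = m"
      using n k(1-3) j assms(3) by simp
    finally show ?thesis
      using n k(1-3) j assms(3) by (intro bexI[of _ "j' \<cdot> n"]) simp_all
  qed
  show "i \<cdot> f \<in> Arr C" "Cod C (k \<cdot> j) = Dom C (i \<cdot> f)"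
    using k(1-3) j i assms by simp_all
qed

lemma cokernel_iso:
  assumes "is_cokernel C (factoring C N) q f" "is_iso C j" "Cod C j = Dom C f" "is_iso C i"
    "Dom C i = Cod C q"
  shows "is_cokernel C (factoring C N) (i \<cdot> q) (f \<cdot> j)"
proof (rule cokernelI)
  note q = cokernelD[OF assms(1)]
  from assms(2) obtain j' where j: "j \<in> Arr C" "j' \<in> Arr C" "Dom C j' = Cod C j"
    "Cod C j' = Dom C j"
    "j \<cdot> j' = Ident C (Cod C j)" by (rule isoE)
  from assms(4) obtain i' where i: "i \<in> Arr C" "i' \<in> Arr C" "Dom C i' = Cod C i"
    "Cod C i' = Dom C i"
    "i' \<cdot> i = Ident C (Dom C i)" by (rule isoE)
  show "is_epi C (i \<cdot> q)"
  proof (rule epiI)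
    fix x y
    assume *: "x \<in> Arr C" "y \<in> Arr C" "Cod C x = Cod C y" "Dom C x = Cod C (i \<cdot> q)"
       "Dom C y = Cod C (i \<cdot> q)" "x \<cdot> (i \<cdot> q) = y \<cdot> (i \<cdot> q)"
    have "(x \<cdot> i) \<cdot> q = (y \<cdot> i) \<cdot> q"
      using * q(1-3) i assms(5) by (simp add: assoc)
    then have "x \<cdot> i = y \<cdot> i"
      by (rule epiD[OF cokernel_epi[OF assms(1)]]) (use * q(1-3) i assms(5) in simp_all)
    then show "x = y"
      by (rule epiD[OF iso_epi[OF assms(4)]]) (use *(1-5) q(1-3) i assms(5) in simp_all)
  qed (use q(1-3) i assms(5) in simp)
  have "(i \<cdot> q) \<cdot> (f \<cdot> j) = i \<cdot> ((q \<cdot> f) \<cdot> j)"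
    using q(1-3) j(1-4) i(1-4) assms(3,5) by (simp add: assoc)
  moreover have "(q \<cdot> f) \<cdot> j \<in> factoring C N"
    by (rule factoring_comp_right) (use q j(1-4) assms(3) in simp_all)
  then have "i \<cdot> ((q \<cdot> f) \<cdot> j) \<in> factoring C N"
    by (rule factoring_comp_left) (use q(1-3) j(1-4) i(1-4) assms(3,5) in simp_all)
  ultimately show "(i \<cdot> q) \<cdot> (f \<cdot> j) \<in> factoring C N"
    by simp
  show "\<exists>n\<in>Arr C. Dom C n = Cod C (i \<cdot> q) \<and> n \<cdot> (i \<cdot> q) = m"
    if m: "m \<in> Arr C" "Dom C m = Cod C (f \<cdot> j)" "m \<cdot> (f \<cdot> j) \<in> factoring C N" for m
  proof -
    have "(m \<cdot> (f \<cdot> j)) \<cdot> j' \<in> factoring C N"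
      using m(3) by (rule factoring_comp_right) (use m(1,2) q(1-3) j(1-4) assms(3) in simp_all)
    moreover have "(m \<cdot> (f \<cdot> j)) \<cdot> j' = (m \<cdot> f) \<cdot> (j \<cdot> j')"
      using m(1,2) q(1-3) j(1-4) assms(3) by (simp add: assoc)
    moreover have "(m \<cdot> f) \<cdot> (j \<cdot> j') = m \<cdot> f"
      using m(1,2) q(1-3) j assms(3) by simp
    ultimately have "m \<cdot> f \<in> factoring C N" by simp
    moreover have "Dom C m = Cod C f"
      using m q(1-3) j assms(3) by simp
    ultimately obtain n where n: "n \<in> Arr C" "Dom C n = Cod C q" "n \<cdot> q = m"
      using cokernel_lift[OF assms(1) m(1)] by metis
    have "(n \<cdot> i') \<cdot> (i \<cdot> q) = n \<cdot> ((i' \<cdot> i) \<cdot> q)"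
      using n(1,2) q(1-3) i(1-4) assms(5) by (simp add: assoc)
    also have "\<dots> = m"
      using n q(1-3) i assms(5) by simp
    finally show ?thesis
      using n q(1-3) i assms(5) by (intro bexI[of _ "n \<cdot> i'"]) simp_all
  qed
  show "f \<cdot> j \<in> Arr C" "Dom C (i \<cdot> q) = Cod C (f \<cdot> j)"
    using q(1-3) j i assms by simp_all
qed

end

section \<open>Pretorsion theories\<close>

context pretorsion_theory
begin

abbreviation Z where "Z \<equiv> trivials C T F"

lemmas Z_comp_left = factoring_comp_left[of _ "T \<inter> F"]
  and Z_comp_right = factoring_comp_right[of _ "T \<inter> F"]

lemma canonicalD:
  assumes "canonical_seq C T F A k q"
  shows "A \<in> Obj C" "k \<in> Arr C" "q \<in> Arr C" "Cod C k = A" "Dom C q = A" "Dom C k \<in> T" "Cod C q \<in> F"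
    "q \<cdot> k \<in> Z" "is_mono C k" "is_epi C q" "is_kernel C Z k q" "is_cokernel C Z q k"
proof -
  show K: "is_kernel C Z k q" "is_cokernel C Z q k"
    and A: "Dom C k \<in> T" "Cod C q \<in> F" "Cod C k = A"
    using assms unfolding canonical_seq_def short_exact_def by auto
  show "k \<in> Arr C" "q \<in> Arr C" "q \<cdot> k \<in> Z" "Dom C q = A" "A \<in> Obj C"
    using kernelD[OF K(1)] A by auto
  show "is_mono C k" "is_epi C q"
    using kernel_mono[OF K(1)] cokernel_epi[OF K(2)] by auto
qed

lemma canonical_iso:
  assumes "canonical_seq C T F A k q" "is_iso C j" "Cod C j = Dom C k" "is_iso C i"
    "Dom C i = Cod C q"
  shows "canonical_seq C T F A (k \<cdot> j) (i \<cdot> q)"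
proof -
  note K = canonicalD[OF assms(1)]
  from assms(2) obtain j' where j: "j \<in> Arr C" "Dom C j' = Cod C j" "Cod C j' = Dom C j"
    "is_iso C j'"
    by (rule isoE)
  from assms(4) have i: "i \<in> Arr C" by (simp add: is_iso_def)
  have "Dom C j \<in> T"
    using T_iso[OF j(4)] j K assms by simp
  moreover have "Cod C i \<in> F"
    using F_iso[OF assms(4)] K assms by simp
  ultimately show ?thesis
    unfolding canonical_seq_def short_exact_def
    using kernel_iso[OF K(11) assms(2-5)] cokernel_iso[OF K(12) assms(2-5)] K i j assms by simp
qed

text \<open>By PT1 both \<open>q' \<cdot> k\<close> and \<open>q \<cdot> k'\<close> are trivial, so
  each sequence factors through the other. The comparison arrows are mutually inverse because units
  are epimorphisms and counits monomorphisms.\<close>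

lemma canonical_unique:
  assumes "canonical_seq C T F A k q" "canonical_seq C T F A k' q'"
  obtains i j where "is_iso C i" "is_iso C j" "Dom C i = Cod C q" "Cod C i = Cod C q'"
    "Cod C j = Dom C k" "Dom C j = Dom C k'" "q' = i \<cdot> q" "k' = k \<cdot> j"
proof -
  have *: "\<exists>i j. i \<in> Arr C \<and> j \<in> Arr C \<and> Dom C i = Cod C q \<and> Cod C i = Cod C q' \<and>
    Cod C j = Dom C k \<and> Dom C j = Dom C k' \<and> q' = i \<cdot> q \<and> k' = k \<cdot> j"
    if "canonical_seq C T F A k q" "canonical_seq C T F A k' q'" for k q k' q'
  proof -
    note K = canonicalD[OF that(1)] and K' = canonicalD[OF that(2)]
    have "q' \<cdot> k \<in> Z" "q \<cdot> k' \<in> Z"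
      using K K' PT1[of "Dom C k" "Cod C q'" "q' \<cdot> k"] PT1[of "Dom C k'" "Cod C q" "q \<cdot> k'"]
      by simp_all
    then show ?thesis
      using kernel_lift[OF K(11), of k'] cokernel_lift[OF K(12), of q'] K K' by metis
  qed
  obtain i j where ij: "i \<in> Arr C" "j \<in> Arr C" "Dom C i = Cod C q" "Cod C i = Cod C q'"
    "Cod C j = Dom C k" "Dom C j = Dom C k'" "q' = i \<cdot> q" "k' = k \<cdot> j"
    using *[OF assms] by blast
  obtain i' j' where ij': "i' \<in> Arr C" "j' \<in> Arr C" "Dom C i' = Cod C q'" "Cod C i' = Cod C q"
    "Cod C j' = Dom C k'" "Dom C j' = Dom C k" "q = i' \<cdot> q'" "k = k' \<cdot> j'"
    using *[OF assms(2,1)] by blast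
  note K = canonicalD[OF assms(1)] and K' = canonicalD[OF assms(2)]
  have "(i' \<cdot> i) \<cdot> q = Ident C (Dom C i) \<cdot> q"
    using ij(1-6) ij'(1-6) K(1-3) ij(7)[symmetric] ij'(7)[symmetric] by (simp add: assoc)
  then have 1: "i' \<cdot> i = Ident C (Dom C i)"
    by (rule epiD[OF K(10)]) (use ij(1-6) ij'(1-6) K in simp_all)
  have "(i \<cdot> i') \<cdot> q' = Ident C (Cod C i) \<cdot> q'"
    using ij(1-6) ij'(1-6) K'(1-3) ij(7)[symmetric] ij'(7)[symmetric] by (simp add: assoc)
  then have 2: "i \<cdot> i' = Ident C (Cod C i)"
    by (rule epiD[OF K'(10)]) (use ij(1-6) ij'(1-6) K' in simp_all)
  have "k' \<cdot> (j' \<cdot> j) = k' \<cdot> Ident C (Dom C j)"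
    using ij(1-6) ij'(1-6) K'(1-3) ij(8)[symmetric] ij'(8)[symmetric]
      by (simp add: assoc[symmetric])
  then have 3: "j' \<cdot> j = Ident C (Dom C j)"
    by (rule monoD[OF K'(9)]) (use ij(1-6) ij'(1-6) K' in simp_all)
  have "k \<cdot> (j \<cdot> j') = k \<cdot> Ident C (Cod C j)"
    using ij(1-6) ij'(1-6) K(1-3) ij(8)[symmetric] ij'(8)[symmetric] by (simp add: assoc[symmetric])
  then have 4: "j \<cdot> j' = Ident C (Cod C j)"
    by (rule monoD[OF K(9)]) (use ij(1-6) ij'(1-6) K in simp_all)
  have "is_iso C i" "is_iso C j"
    using isoI[of i i'] isoI[of j j'] 1 2 3 4 ij(1-6) ij'(1-6) by simp_all
  then show thesis
    using that ij by blast
qed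

text \<open>Allows a given counit to be paired with the chosen unit \<open>\<eta> A\<close>: two
  units differ by an isomorphism, and composing with it changes neither the kernel nor the cokernel
  property.\<close>

lemma canonical_mix:
  assumes "canonical_seq C T F A k q" "canonical_seq C T F A k' q'"
  shows "canonical_seq C T F A k q'"
proof -
  obtain i j where "is_iso C i" "Dom C i = Cod C q" "q' = i \<cdot> q"
    using canonical_unique[OF assms] by metis
  then show ?thesis
    using canonical_iso[OF assms(1) iso_ident[of "Dom C k"], of i] canonicalD[OF assms(1)] by simp
qed

text \<open>When \<open>q\<close> is trivial, the identity of \<open>A\<close> lifts through its
  kernel, so the monomorphism \<open>k\<close> is split epi.\<close>

lemma torsion_if_unit_trivial:
  assumes "canonical_seq C T F A k q" "q \<in> Z"
  shows "A \<in> T"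
proof -
  note K = canonicalD[OF assms(1)]
  obtain n where n: "n \<in> Arr C" "Dom C n = A" "Cod C n = Dom C k" "k \<cdot> n = Ident C A"
    using kernel_lift[OF K(11), of "Ident C A"] K assms(2) by auto
  have "is_iso C k"
    using mono_split_epi_iso[OF K(9), of n] n K by simp
  then show ?thesis
    using T_iso[of k] K by simp
qed

lemma torsion_free_if_counit_trivial:
  assumes "canonical_seq C T F A k q" "k \<in> Z"
  shows "A \<in> F" "is_iso C q"
proof -
  note K = canonicalD[OF assms(1)]
  obtain n where n: "n \<in> Arr C" "Dom C n = Cod C q" "Cod C n = A" "n \<cdot> q = Ident C A"
    using cokernel_lift[OF K(12), of "Ident C A"] K assms(2) by auto
  show q: "is_iso C q"
    using epi_split_mono_iso[OF K(10), of n] n K by simp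
  then obtain q' where "is_iso C q'" "Dom C q' = Cod C q" "Cod C q' = Dom C q"
    by (rule isoE)
  then show "A \<in> F"
    using F_iso[of q'] K by simp
qed

lemma unit_trivial: "canonical_seq C T F A k q \<Longrightarrow> A \<in> T \<Longrightarrow> q \<in> Z"
  using PT1[of A "Cod C q" q] canonicalD[of A k q] by simp

text \<open>In other words, retracts of trivial objects are trivial. A trivial identity makes both
  the unit and the counit trivial, hence \<open>A\<close> both torsion and torsion free.\<close>

lemma trivial_if_ident_trivial:
  assumes "Ident C A \<in> Z" "A \<in> Obj C"
  shows "A \<in> T \<inter> F"
proof -
  obtain k q where c: "canonical_seq C T F A k q"
    using PT2 assms by blast
  note K = canonicalD[OF c]
  have "k \<in> Z" "q \<in> Z"
    using Z_comp_left[OF assms(1), of q] Z_comp_right[OF assms(1), of k] K assms(2) by simp_all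
  then show ?thesis
    using torsion_if_unit_trivial[OF c] torsion_free_if_counit_trivial[OF c] by simp
qed

text \<open>Suppose \<open>k \<cdot> f\<close> passes through a trivial object. The half
  \<open>h\<close> that leaves this object is killed by \<open>q\<close>, hence lifts through the
  kernel \<open>k\<close>; cancelling \<open>k\<close> yields a factorization of \<open>f\<close>
  through the same object.\<close>

lemma Z_cancel_counit:
  assumes c: "canonical_seq C T F A k q" and f: "f \<in> Arr C" "Cod C f = Dom C k" and Z: "k \<cdot> f \<in> Z"
  shows "f \<in> Z"
proof -
  note K = canonicalD[OF c]
  from Z obtain g h where gh: "g \<in> Arr C" "h \<in> Arr C" "Cod C g = Dom C h" "Cod C g \<in> T \<inter> F"
    "k \<cdot> f = h \<cdot> g"
    and gh2: "Dom C g = Dom C (k \<cdot> f)" "Cod C h = Cod C (k \<cdot> f)"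
    by (rule factoring_E)
  from gh2 have dc: "Dom C g = Dom C f" "Cod C h = Cod C k"
    using K(2) f by simp_all
  have "q \<cdot> h \<in> Z"
    using gh(1-4) dc K f by (intro Z_comp_left factoring_dom) simp_all
  note qh = this
  obtain h' where h': "h' \<in> Arr C" "Dom C h' = Dom C h" "Cod C h' = Dom C k" "k \<cdot> h' = h"
    by (rule kernel_lift[OF K(11), of h]) (use qh gh(1-4) dc K f in simp_all)
  have "k \<cdot> f = k \<cdot> (h' \<cdot> g)"
    using gh h' K by (simp add: assoc[symmetric])
  then have "f = h' \<cdot> g"
    by (rule monoD[OF K(9)]) (use f gh(1-4) dc h' K in simp_all)
  then show ?thesis
    using factoring_I[of g h' "T \<inter> F"] gh h' by simp
qed

text \<open>Dual to \<open>Z_cancel_counit\<close>: now the half that enters the trivial object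
  descends along the cokernel \<open>q\<close>.\<close>

lemma Z_cancel_unit:
  assumes c: "canonical_seq C T F A k q" and f: "f \<in> Arr C" "Dom C f = Cod C q" and Z: "f \<cdot> q \<in> Z"
  shows "f \<in> Z"
proof -
  note K = canonicalD[OF c]
  from Z obtain g h where gh: "g \<in> Arr C" "h \<in> Arr C" "Cod C g = Dom C h" "Cod C g \<in> T \<inter> F"
    "f \<cdot> q = h \<cdot> g"
    and gh2: "Dom C g = Dom C (f \<cdot> q)" "Cod C h = Cod C (f \<cdot> q)"
    by (rule factoring_E)
  from gh2 have dc: "Dom C g = Dom C q" "Cod C h = Cod C f"
    using K(3) f by simp_all
  have "g \<cdot> k \<in> Z"
    using gh(1-4) dc K f by (intro Z_comp_right factoring_cod) simp_all
  note gk = this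
  obtain g' where g': "g' \<in> Arr C" "Dom C g' = Cod C q" "Cod C g' = Cod C g" "g' \<cdot> q = g"
    by (rule cokernel_lift[OF K(12), of g]) (use gk gh(1-4) dc K f in simp_all)
  have "f \<cdot> q = (h \<cdot> g') \<cdot> q"
    using gh g' K by (simp add: assoc)
  then have "f = h \<cdot> g'"
    by (rule epiD[OF K(10)]) (use f gh(1-4) dc g' K in simp_all)
  then show ?thesis
    using factoring_I[of g' h "T \<inter> F"] gh g' by simp
qed

lemma unit_factor:
  assumes "canonical_seq C T F A k q" "m \<in> Arr C" "Dom C m = A" "Cod C m \<in> F"
  obtains n where "n \<in> Arr C" "Dom C n = Cod C q" "Cod C n = Cod C m" "n \<cdot> q = m"
proof -
  note K = canonicalD[OF assms(1)]
  have "m \<cdot> k \<in> Z"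
    using PT1[of "Dom C k" "Cod C m"] K assms by simp
  then show thesis
    using cokernel_lift[OF K(12), of m] K assms that by auto
qed

lemma counit_factor:
  assumes "canonical_seq C T F A k q" "m \<in> Arr C" "Cod C m = A" "Dom C m \<in> T"
  obtains n where "n \<in> Arr C" "Cod C n = Dom C k" "Dom C n = Dom C m" "k \<cdot> n = m"
proof -
  note K = canonicalD[OF assms(1)]
  have "q \<cdot> m \<in> Z"
    using PT1[of "Dom C m" "Cod C q"] K assms by simp
  then show thesis
    using kernel_lift[OF K(11), of m] K assms that by auto
qed

section \<open>The torsion free reflection\<close>

abbreviation \<eta> where "\<eta> \<equiv> eta C T F"

lemma eta_canonical:
  assumes "A \<in> Obj C" obtains k where "canonical_seq C T F A k (\<eta> A)"
proof -
  have "\<exists>q k. canonical_seq C T F A k q"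
    using PT2[OF assms] by blast
  then have "\<exists>k. canonical_seq C T F A k (\<eta> A)"
    unfolding eta_def by (rule someI_ex)
  then show thesis using that by blast
qed

lemma eta_simps [simp]:
  assumes "A \<in> Obj C"
  shows "\<eta> A \<in> Arr C" "Dom C (\<eta> A) = A" "Cod C (\<eta> A) \<in> F" "Cod C (\<eta> A) \<in> Obj C" "is_epi C (\<eta> A)"
proof -
  obtain k where "canonical_seq C T F A k (\<eta> A)"
    using eta_canonical assms by blast
  then show "\<eta> A \<in> Arr C" "Dom C (\<eta> A) = A" "Cod C (\<eta> A) \<in> F" "Cod C (\<eta> A) \<in> Obj C"
    "is_epi C (\<eta> A)"
    using canonicalD[of A k "\<eta> A"] by auto
qed

abbreviation \<phi> where "\<phi> \<equiv> phi C T F"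

lemma phi_props:
  assumes f: "f \<in> Arr C"
  shows "\<phi> f \<in> Arr C" "Dom C (\<phi> f) = Cod C (\<eta> (Dom C f))" "Cod C (\<phi> f) = Cod C (\<eta> (Cod C f))"
    "\<phi> f \<cdot> \<eta> (Dom C f) = \<eta> (Cod C f) \<cdot> f"
proof -
  obtain k where k: "canonical_seq C T F (Dom C f) k (\<eta> (Dom C f))"
    using eta_canonical f by (meson obj_simps)
  obtain u where u: "u \<in> Arr C" "Dom C u = Cod C (\<eta> (Dom C f))" "Cod C u = Cod C (\<eta> (Cod C f))"
    "u \<cdot> \<eta> (Dom C f) = \<eta> (Cod C f) \<cdot> f"
    by (rule unit_factor[OF k, of "\<eta> (Cod C f) \<cdot> f"]) (use f in simp_all)
  have "\<phi> f = u"
    unfolding phi_def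
  proof (rule the_equality)
    show "u \<in> hom C (Cod C (\<eta> (Dom C f))) (Cod C (\<eta> (Cod C f))) \<and> u \<cdot> \<eta> (Dom C f) = \<eta> (Cod C f) \<cdot> f"
      using u by simp
    show "v = u" if "v \<in> hom C (Cod C (\<eta> (Dom C f))) (Cod C (\<eta> (Cod C f))) \<and>
      v \<cdot> \<eta> (Dom C f) = \<eta> (Cod C f) \<cdot> f" for v
      by (rule epiD[OF canonicalD(10)[OF k]]) (use that u in simp_all)
  qed
  with u show "\<phi> f \<in> Arr C" "Dom C (\<phi> f) = Cod C (\<eta> (Dom C f))" "Cod C (\<phi> f) = Cod C (\<eta> (Cod C f))"
    "\<phi> f \<cdot> \<eta> (Dom C f) = \<eta> (Cod C f) \<cdot> f"
    by simp_all
qed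

end

section \<open>Locality of distinguished subobjects\<close>

context coherent_system
begin

lemma D_simps [simp]: "s \<in> D \<Longrightarrow> is_mono E s" "s \<in> D \<Longrightarrow> s \<in> Arr E"
  using D_mono by auto

lemma D_pts_eq: "s \<in> D \<Longrightarrow> is_mono E t \<Longrightarrow> pts E s = pts E t \<Longrightarrow> t \<in> D"
  by (rule D_same_sub[of s t]) (simp_all add: same_sub_pts)

lemma inverse_image:
  assumes "s \<in> D" "f \<in> Arr E" "Cod E f = Cod E s"
  obtains p where "p \<in> D" "Cod E p = Dom E f"
    "pts E p = {z \<in> Arr E. Cod E z = Dom E f \<and> f \<cdot> z \<in> pts E s}"
proof -
  obtain p q where pq: "p \<in> D" "is_pullback E f s p q"
    using CS3[OF assms] by blast
  show thesis
    using that[of p] pq pullback_pts[OF pq(2)] pullbackD(5)[OF pq(2)] assms(1) by simp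
qed

text \<open>By \<open>pts_cancel\<close>, \<open>i\<close> has the same elements as the inverse
  image of \<open>u \<cdot> i\<close> along \<open>u\<close>, which CS3 makes distinguished; this
  asks of \<open>u\<close> only that it be a monomorphism.\<close>

lemma D_cancel:
  assumes "is_mono E u" "i \<in> Arr E" "Cod E i = Dom E u" "u \<cdot> i \<in> D"
  shows "i \<in> D"
proof -
  obtain p where p: "p \<in> D" "pts E p = {z \<in> Arr E. Cod E z = Dom E u \<and> u \<cdot> z \<in> pts E (u \<cdot> i)}"
    by (rule inverse_image[OF assms(4), of u]) (use assms(1-3) in simp_all)
  show ?thesis
    by (rule D_pts_eq[OF p(1)])
      (use assms mono_rightcancel[of u i] pts_cancel[of u i] p(2) in simp_all)
qed

text \<open>The inverse image of \<open>t\<close> under the partial map \<open>(s, f)\<close>, as a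
  subobject of the whole object: CS3 pulls \<open>t\<close> back along \<open>f\<close>, and CS5
  allows composition with \<open>s\<close>.\<close>

lemma preimage:
  assumes "s \<in> D" "f \<in> Arr E" "Dom E f = Dom E s" "t \<in> D" "Cod E f = Cod E t"
  obtains w where "w \<in> D" "Cod E w = Cod E s" "pts E w = {z \<in> pts E s. ap E s f z \<in> pts E t}"
proof -
  obtain p where p: "p \<in> D" "Cod E p = Dom E f"
    "pts E p = {z \<in> Arr E. Cod E z = Dom E f \<and> f \<cdot> z \<in> pts E t}"
    by (rule inverse_image[of t f]) (use assms in simp_all)
  have "s \<cdot> p \<in> D"
    using CS5[of p s] p assms by simp
  moreover have "pts E (s \<cdot> p) = {z \<in> pts E s. ap E s f z \<in> pts E t}"
  proof -
    have ps: "is_mono E s" "is_mono E p" "Cod E p = Dom E s"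
      using p(1,2) assms by simp_all
    have "fac E s z \<in> pts E p \<longleftrightarrow> ap E s f z \<in> pts E t" if "z \<in> pts E s" for z
      using that p(3) ps assms by (simp add: ap_def)
    then show ?thesis
      unfolding pts_comp_iff(1)[OF ps] by blast
  qed
  ultimately show thesis
    using that[of "s \<cdot> p"] p assms by simp
qed

lemma intersection:
  assumes "s \<in> D" "t \<in> D" "Cod E s = Cod E t"
  obtains w where "w \<in> D" "Cod E w = Cod E s" "pts E w = pts E s \<inter> pts E t"
proof -
  \<comment> \<open>The partial map \<open>(s, s)\<close> sends each element of \<open>s\<close> to
    itself, so its inverse image of \<open>t\<close> is the intersection.\<close>
  obtain w where w: "w \<in> D" "Cod E w = Cod E s" "pts E w = {z \<in> pts E s. ap E s s z \<in> pts E t}"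
    by (rule preimage[of s s t]) (use assms in simp_all)
  moreover have "ap E s s z = z" if "z \<in> pts E s" for z
    using that assms by (simp add: ap_def)
  ultimately have "pts E w = pts E s \<inter> pts E t"
    by auto
  with w show thesis
    using that[of w] by simp
qed

text \<open>CS4 enters here. As \<open>z\<close> factors through \<open>u\<close>, the pullback of
  \<open>u\<close> along \<open>z\<close> is the whole of \<open>Dom E z\<close>; the inverse images
  of \<open>s\<close> and \<open>t\<close> therefore cover the domain of \<open>z\<close>.\<close>

lemma union_local:
  assumes "s \<in> D" "t \<in> D" "is_union E s t u" "z \<in> pts E u"
  obtains a b where "a \<in> D" "b \<in> D" "Cod E a = Dom E z" "Cod E b = Dom E z"
    "is_union E a b (Ident E (Dom E z))"
    "pts E a = {x \<in> Arr E. Cod E x = Dom E z \<and> z \<cdot> x \<in> pts E s}"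
    "pts E b = {x \<in> Arr E. Cod E x = Dom E z \<and> z \<cdot> x \<in> pts E t}"
proof -
  have u: "is_mono E u" "s \<in> pts E u" "t \<in> pts E u"
    using assms(3) by (auto simp: is_union_def sub_le_iff)
  have cod: "Cod E z = Cod E s" "Cod E z = Cod E t"
    using pts_cod[OF u(2)] pts_cod[OF u(3)] pts_cod[OF assms(4)] by simp_all
  have z: "z \<in> Arr E" "Cod E z = Cod E u"
    using assms(4) pts_arr pts_cod by auto
  obtain a p where a: "a \<in> D" "is_pullback E z s a p"
    using CS3[of s z] assms cod z by blast
  obtain b q where b: "b \<in> D" "is_pullback E z t b q"
    using CS3[of t z] assms cod z by blast
  have "is_pullback E z u (Ident E (Dom E z)) (fac E u z)"
  proof (rule pullbackI)
    show "pts E (Ident E (Dom E z)) = {x \<in> Arr E. Cod E x = Dom E z \<and> z \<cdot> x \<in> pts E u}"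
      using pts_comp[of u z] u z assms(4) by auto
  qed (use u z mono_ident in simp_all)
  then have "is_union E a b (Ident E (Dom E z))"
    using CS4[OF assms(1-3) a(2) b(2)] by blast
  then show thesis
    using that[of a b] a b pullback_pts[OF a(2)] pullback_pts[OF b(2)] pullbackD(5)[OF a(2)]
      pullbackD(5)[OF b(2)] assms(1,2) by simp
qed

text \<open>The arrows \<open>x\<close> with \<open>y \<cdot> x\<close> in \<open>v\<close> form a
  distinguished subobject of the domain. It contains both members of the cover given by
  \<open>union_local\<close>, hence the identity.\<close>

lemma union_local_pts:
  assumes "s \<in> D" "t \<in> D" "is_union E s t u" "z \<in> pts E u"
    and y: "y \<in> Arr E" "Dom E y = Dom E z" and v: "v \<in> D" "Cod E y = Cod E v"
    and s: "\<And>x. x \<in> Arr E \<Longrightarrow> Cod E x = Dom E z \<Longrightarrow> z \<cdot> x \<in> pts E s \<Longrightarrow> y \<cdot> x \<in> pts E v"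
    and t: "\<And>x. x \<in> Arr E \<Longrightarrow> Cod E x = Dom E z \<Longrightarrow> z \<cdot> x \<in> pts E t \<Longrightarrow> y \<cdot> x \<in> pts E v"
  shows "y \<in> pts E v"
proof -
  obtain a b where ab: "a \<in> D" "b \<in> D" "is_union E a b (Ident E (Dom E z))"
    "pts E a = {x \<in> Arr E. Cod E x = Dom E z \<and> z \<cdot> x \<in> pts E s}"
    "pts E b = {x \<in> Arr E. Cod E x = Dom E z \<and> z \<cdot> x \<in> pts E t}"
    by (rule union_local[OF assms(1-4)])
  obtain p where p: "p \<in> D" "pts E p = {x \<in> Arr E. Cod E x = Dom E y \<and>
    y \<cdot> x \<in> pts E v}" and "Cod E p = Dom E y"
    by (rule inverse_image[OF v(1) y(1) v(2)])
  have "pts E a \<subseteq> pts E p" "pts E b \<subseteq> pts E p"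
    unfolding ab(4,5) p(2) using s t y by auto
  then have "pts E (Ident E (Dom E z)) \<subseteq> pts E p"
    using ab(3) p(1) D_simps(1) unfolding is_union_pts by blast
  moreover have "Dom E z \<in> Obj E"
    using y by (metis obj_simps(1))
  ultimately have "Ident E (Dom E z) \<in> pts E p"
    using pts_self[of "Ident E (Dom E z)"] by (metis ident_simps(1) subsetD)
  then show ?thesis
    using p y by simp
qed

section \<open>Covers of an object by two distinguished subobjects\<close>

definition covers :: "'o \<Rightarrow> 'm \<Rightarrow> 'm \<Rightarrow> bool" where
  "covers A s t \<longleftrightarrow> A \<in> Obj E \<and> s \<in> D \<and> t \<in> D \<and> Cod E s = A \<and> Cod E t = A \<and>
    is_union E s t (Ident E A)"

lemma coversD:
  assumes "covers A s t"
  shows "A \<in> Obj E" "s \<in> D" "t \<in> D" "Cod E s = A" "Cod E t = A" "is_union E s t (Ident E A)"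
  using assms by (auto simp: covers_def)

lemma covers_sym: "covers A s t \<Longrightarrow> covers A t s"
  by (auto simp: covers_def is_union_sym)

lemma covers_pts:
  assumes "covers A s t" "z \<in> Arr E" "Cod E z = A" "is_mono E v" "pts E s \<subseteq> pts E v"
    "pts E t \<subseteq> pts E v"
  shows "z \<in> pts E v"
  using coversD(6)[OF assms(1), unfolded is_union_pts] coversD(1)[OF assms(1)] assms(2-) by auto

lemma covers_local:
  assumes "covers A s t" "z \<in> Arr E" "Cod E z = A"
    and y: "y \<in> Arr E" "Dom E y = Dom E z" and v: "v \<in> D" "Cod E y = Cod E v"
    and s: "\<And>x. x \<in> Arr E \<Longrightarrow> Cod E x = Dom E z \<Longrightarrow> z \<cdot> x \<in> pts E s \<Longrightarrow> y \<cdot> x \<in> pts E v"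
    and t: "\<And>x. x \<in> Arr E \<Longrightarrow> Cod E x = Dom E z \<Longrightarrow> z \<cdot> x \<in> pts E t \<Longrightarrow> y \<cdot> x \<in> pts E v"
  shows "y \<in> pts E v"
  by (rule union_local_pts[OF _ _ _ _ y v s t, of s t "Ident E A"])
    (use coversD[OF assms(1)] assms(2,3) in simp_all)

text \<open>Testing distinguished upper bounds suffices because, by CS2, the union of
  \<open>s\<close> and \<open>t\<close> is itself one of them.\<close>

lemma coversI:
  assumes "A \<in> Obj E" "s \<in> D" "t \<in> D" "Cod E s = A" "Cod E t = A"
    and *: "\<And>u. u \<in> D \<Longrightarrow> Cod E u = A \<Longrightarrow> pts E s \<subseteq> pts E u \<Longrightarrow> pts E t \<subseteq> pts E u \<Longrightarrow>
        Ident E A \<in> pts E u"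
  shows "covers A s t"
proof -
  obtain u where u: "u \<in> D" "is_union E s t u"
    using CS2[of s t] assms by auto
  then have le: "pts E s \<subseteq> pts E u" "pts E t \<subseteq> pts E u"
    by (auto simp: is_union_pts)
  then have cod: "Cod E u = A"
    using pts_self[of s] pts_cod[of s u] assms(2,4) by (simp add: subset_iff)
  have "pts E (Ident E A) \<subseteq> pts E u"
    using *[OF u(1) cod le] pts_le_iff[of "Ident E A" u] u(1) assms(1) mono_ident by simp
  then have "pts E (Ident E A) = pts E u"
    using pts_cod[of _ u] pts_arr[of _ u] cod assms(1) by auto
  then have "is_union E s t (Ident E A)"
    using is_union_same[OF u(2)] assms mono_ident by simp
  then show ?thesis
    using assms by (simp add: covers_def)
qed

lemma zero_hom:
  assumes "A \<in> Obj E"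
  shows "from_initial E zero A \<in> D" "Dom E (from_initial E zero A) = zero"
    "Cod E (from_initial E zero A) = A"
    "\<And>f. f \<in> Arr E \<Longrightarrow> Dom E f = zero \<Longrightarrow> Cod E f = A \<Longrightarrow> f = from_initial E zero A"
proof -
  have ex: "\<exists>!f. f \<in> hom E zero A"
    using strict_initial assms unfolding strict_initial_obj_def initial_obj_def by blast
  have "from_initial E zero A \<in> hom E zero A"
    unfolding from_initial_def by (rule theI'[OF ex])
  moreover show "f = from_initial E zero A" if "f \<in> Arr E" "Dom E f = zero" "Cod E f = A" for f
    using ex calculation that by auto
  ultimately show "Dom E (from_initial E zero A) = zero" "Cod E (from_initial E zero A) = A"
    by auto
  show "from_initial E zero A \<in> D"
    using CS1_zero assms by blast
qed

lemma zero_obj': "zero \<in> Obj E"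
  using strict_initial unfolding strict_initial_obj_def initial_obj_def by blast

lemma to_zero_iso: "f \<in> Arr E \<Longrightarrow> Cod E f = zero \<Longrightarrow> is_iso E f"
  using strict_initial unfolding strict_initial_obj_def by simp

lemma covers_zero:
  assumes "A \<in> Obj E" shows "covers A (from_initial E zero A) (Ident E A)"
  by (rule coversI) (use assms zero_hom CS1_ident in auto)

end

context compatible
begin

text \<open>Strictness makes the counit into \<open>zero\<close> invertible, so \<open>zero\<close>
  is torsion and its unit is trivial. The trivial object through which that unit passes has
  \<open>zero\<close> as a distinguished subobject, and CC1 applies.\<close>

lemma zero_trivial: "zero \<in> T \<inter> F"
proof -
  obtain k q where c: "canonical_seq E T F zero k q"
    using PT2[OF zero_obj'] by blast
  note K = canonicalD[OF c]
  have "is_iso E k"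
    using to_zero_iso K by simp
  then have "zero \<in> T"
    using T_iso[of k] K by simp
  then have "q \<in> Z"
    using unit_trivial[OF c] by simp
  then obtain g where g: "g \<in> Arr E" "Cod E g \<in> T \<inter> F" "Dom E g = zero"
    using K(5) by (metis factoring_E)
  then have "g \<in> D"
    using zero_hom[of "Cod E g"] by simp
  then show ?thesis
    using CC1[of g] g by simp
qed

lemma pts_zero_trivial: "A \<in> Obj E \<Longrightarrow> z \<in> pts E (from_initial E zero A) \<Longrightarrow> z \<in> Z"
proof -
  assume *: "A \<in> Obj E" "z \<in> pts E (from_initial E zero A)"
  then have "from_initial E zero A \<cdot> fac E (from_initial E zero A) z \<in> Z"
    by (intro factoring_I) (use zero_hom(1-3)[of A] zero_trivial in simp_all)
  then show "z \<in> Z"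
    using * zero_hom(1)[of A] by simp
qed

text \<open>The same localization as for membership, with CC2 applied to the cover of the domain of
  \<open>z\<close>.\<close>

lemma union_local_Z:
  assumes "s \<in> D" "t \<in> D" "is_union E s t u" "z \<in> pts E u"
    and y: "y \<in> Arr E" "Dom E y = Dom E z"
    and s: "\<And>x. x \<in> Arr E \<Longrightarrow> Cod E x = Dom E z \<Longrightarrow> z \<cdot> x \<in> pts E s \<Longrightarrow> y \<cdot> x \<in> Z"
    and t: "\<And>x. x \<in> Arr E \<Longrightarrow> Cod E x = Dom E z \<Longrightarrow> z \<cdot> x \<in> pts E t \<Longrightarrow> y \<cdot> x \<in> Z"
  shows "y \<in> Z"
proof -
  obtain a b where ab: "a \<in> D" "b \<in> D" "Cod E a = Dom E z" "Cod E b = Dom E z"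
    "is_union E a b (Ident E (Dom E z))"
    "pts E a = {x \<in> Arr E. Cod E x = Dom E z \<and> z \<cdot> x \<in> pts E s}"
    "pts E b = {x \<in> Arr E. Cod E x = Dom E z \<and> z \<cdot> x \<in> pts E t}"
    by (rule union_local[OF assms(1-4)])
  have "y \<cdot> a \<in> Z" "y \<cdot> b \<in> Z"
    using s[of a] t[of b] ab pts_self[of a] pts_self[of b] by auto
  moreover have "Dom E z \<in> Obj E"
    using y by (metis obj_simps(1))
  ultimately show ?thesis
    using CC2[OF ab(1,2,5), of a b y "Cod E y"] ab y by simp
qed

lemma covers_local_Z:
  assumes "covers A s t" "z \<in> Arr E" "Cod E z = A"
    and y: "y \<in> Arr E" "Dom E y = Dom E z"
    and s: "\<And>x. x \<in> Arr E \<Longrightarrow> Cod E x = Dom E z \<Longrightarrow> z \<cdot> x \<in> pts E s \<Longrightarrow> y \<cdot> x \<in> Z"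
    and t: "\<And>x. x \<in> Arr E \<Longrightarrow> Cod E x = Dom E z \<Longrightarrow> z \<cdot> x \<in> pts E t \<Longrightarrow> y \<cdot> x \<in> Z"
  shows "y \<in> Z"
  by (rule union_local_Z[OF _ _ _ _ y s t, of s t "Ident E A"])
    (use coversD[OF assms(1)] assms(2,3) in simp_all)

text \<open>The definition ranges over all pullback squares, but one is enough: every common element
  of \<open>u\<close> and \<open>s\<close> factors through it, and triviality passes to
  restrictions.\<close>

lemma trivial_on_meet_iff:
  assumes "u \<in> D" "s \<in> D" "Cod E u = Cod E s" "f \<in> Arr E" "Dom E f = Dom E s"
  shows "trivial_on_meet E Z u s f \<longleftrightarrow> (\<forall>z\<in>pts E u \<inter> pts E s. ap E s f z \<in> Z)"
proof
  assume *: "trivial_on_meet E Z u s f"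
  obtain p q where pq: "p \<in> D" "is_pullback E u s p q"
    using CS3[of s u] assms by auto
  note P = pullbackD[OF pq(2)] pullback_pts[OF pq(2)]
  have fq: "f \<cdot> q \<in> Z"
    using * pq(2) unfolding trivial_on_meet_def by blast
  show "\<forall>z\<in>pts E u \<inter> pts E s. ap E s f z \<in> Z"
  proof
    fix z assume "z \<in> pts E u \<inter> pts E s"
    then have z: "z \<in> pts E u" "z \<in> pts E s"
      by auto
    have zp: "fac E u z \<in> pts E p"
      using P(11) z assms by simp
    have "fac E s z = q \<cdot> fac E p (fac E u z)"
      using P(12)[OF _ zp] z assms by simp
    then have "ap E s f z = (f \<cdot> q) \<cdot> fac E p (fac E u z)"
      using P(1-8) zp pq(1) assms z by (simp add: ap_def assoc)
    also have "\<dots> \<in> Z"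
      using fq by (rule Z_comp_right) (use P(1-8) zp pq(1) assms in simp_all)
    finally show "ap E s f z \<in> Z" .
  qed
next
  assume *: "\<forall>z\<in>pts E u \<inter> pts E s. ap E s f z \<in> Z"
  show "trivial_on_meet E Z u s f"
    unfolding trivial_on_meet_def
  proof (intro allI impI)
    fix p q assume "is_pullback E u s p q"
    note P = pullbackD[OF this]
    have "s \<cdot> q \<in> pts E s" "u \<cdot> p \<in> pts E u"
      using P(1-8) by (simp_all add: pts_I)
    then have "ap E s f (s \<cdot> q) \<in> Z"
      using * P(9) by simp
    moreover have "fac E s (s \<cdot> q) = q"
      by (rule fac_unique) (use P(1-8) assms in simp_all)
    ultimately show "f \<cdot> q \<in> Z"
      by (simp add: ap_def)
  qed
qed

end

section \<open>Distinguished partial morphisms in terms of elements\<close>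

context compatible
begin

lemma triples_iff:
  "(s0, s1, f) \<in> triples E D Z \<longleftrightarrow> covers (Cod E s1) s0 s1 \<and> f \<in> Arr E \<and> Dom E f = Dom E s1 \<and>
     (\<forall>z\<in>pts E s0 \<inter> pts E s1. ap E s1 f z \<in> Z)"
proof -
  have "covers (Cod E s1) s0 s1 \<longleftrightarrow> s0 \<in> D \<and> s1 \<in> D \<and> Cod E s0 = Cod E s1 \<and>
      is_union E s0 s1 (Ident E (Cod E s1))"
    by (auto simp: covers_def)
  then show ?thesis
    unfolding triples_def using trivial_on_meet_iff[of s0 s1 f] by auto
qed

lemma tripleD:
  assumes "(s0, s1, f) \<in> triples E D Z"
  shows "covers (Cod E s1) s0 s1" "s0 \<in> D" "s1 \<in> D" "Cod E s0 = Cod E s1" "f \<in> Arr E"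
    "Dom E f = Dom E s1" "\<And>z. z \<in> pts E s0 \<Longrightarrow> z \<in> pts E s1 \<Longrightarrow> ap E s1 f z \<in> Z"
    "Cod E s1 \<in> Obj E" "Cod E f \<in> Obj E"
  using assms unfolding triples_iff by (auto dest: coversD)

section \<open>The congruence on triples, elementwise\<close>

definition eqv_on :: "'m \<Rightarrow> 'm \<Rightarrow> 'm triple \<Rightarrow> 'm triple \<Rightarrow> bool" where
  "eqv_on u0 u1 = (\<lambda>(s0, s1, f) (t0, t1, g). Cod E s1 = Cod E t1 \<and> Cod E f = Cod E g \<and>
     covers (Cod E s1) u0 u1 \<and> pts E u1 \<subseteq> pts E s1 \<and> pts E u1 \<subseteq> pts E t1 \<and>
     (\<forall>z\<in>pts E u1. ap E s1 f z = ap E t1 g z) \<and>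
     (\<forall>z\<in>pts E u0 \<inter> pts E s1. ap E s1 f z \<in> Z) \<and> (\<forall>z\<in>pts E u0 \<inter> pts E t1. ap E t1 g z \<in> Z))"

definition eqv :: "'m triple \<Rightarrow> 'm triple \<Rightarrow> bool" where
  "eqv x y \<longleftrightarrow> (\<exists>u0 u1. eqv_on u0 u1 x y)"

lemma eqvE: "eqv x y \<Longrightarrow> (\<And>u0 u1. eqv_on u0 u1 x y \<Longrightarrow> thesis) \<Longrightarrow> thesis"
  unfolding eqv_def by blast

lemma eqvI:
  assumes "Cod E s1 = Cod E t1" "Cod E f = Cod E g" "covers (Cod E s1) u0 u1"
    "pts E u1 \<subseteq> pts E s1" "pts E u1 \<subseteq> pts E t1" "\<And>z. z \<in> pts E u1 \<Longrightarrow> ap E s1 f z = ap E t1 g z"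
    "\<And>z. z \<in> pts E u0 \<Longrightarrow> z \<in> pts E s1 \<Longrightarrow> ap E s1 f z \<in> Z"
    "\<And>z. z \<in> pts E u0 \<Longrightarrow> z \<in> pts E t1 \<Longrightarrow> ap E t1 g z \<in> Z"
  shows "eqv (s0, s1, f) (t0, t1, g)"
  unfolding eqv_def eqv_on_def using assms by blast

lemma eqv_onD:
  assumes "eqv_on u0 u1 (s0, s1, f) (t0, t1, g)"
  shows "Cod E s1 = Cod E t1" "Cod E f = Cod E g" "covers (Cod E s1) u0 u1"
    "pts E u1 \<subseteq> pts E s1" "pts E u1 \<subseteq> pts E t1" "z \<in> pts E u1 \<Longrightarrow> ap E s1 f z = ap E t1 g z"
    "z \<in> pts E u0 \<Longrightarrow> z \<in> pts E s1 \<Longrightarrow> ap E s1 f z \<in> Z"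
    "z \<in> pts E u0 \<Longrightarrow> z \<in> pts E t1 \<Longrightarrow> ap E t1 g z \<in> Z"
  using assms unfolding eqv_on_def by auto

text \<open>\<open>ap E s f u\<close>, the value at the generic element of \<open>u\<close>, is the
  restriction of \<open>f\<close> to \<open>u\<close>.\<close>

lemma ap_restrict:
  assumes "is_mono E u" "is_mono E s" "u \<in> pts E s" "z \<in> pts E u" "f \<in> Arr E" "Dom E f = Dom E s"
  shows "ap E u (ap E s f u) z = ap E s f z"
proof -
  have "ap E s f (u \<cdot> fac E u z) = ap E s f u \<cdot> fac E u z"
    by (rule ap_comp) (use assms in simp_all)
  then show ?thesis
    using assms by (simp add: ap_def)
qed

lemma equivalent_triples_iff:
  assumes x: "(s0, s1, f) \<in> triples E D Z" and y: "(t0, t1, g) \<in> triples E D Z"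
  shows "equivalent_triples E D Z (s0, s1, f) (t0, t1, g) \<longleftrightarrow> eqv (s0, s1, f) (t0, t1, g)"
proof
  note X = tripleD[OF x] and Y = tripleD[OF y]
  assume "equivalent_triples E D Z (s0, s1, f) (t0, t1, g)"
  then obtain u0 u1 a b where u: "Cod E s1 = Cod E t1" "Cod E f = Cod E g" "u0 \<in> D" "u1 \<in> D"
    "Cod E u0 = Cod E s1" "Cod E u1 = Cod E s1" "is_union E u0 u1 (Ident E (Cod E s1))"
    "a \<in> hom E (Dom E u1) (Dom E s1)" "b \<in> hom E (Dom E u1) (Dom E t1)"
    "s1 \<cdot> a = u1" "t1 \<cdot> b = u1" "f \<cdot> a = g \<cdot> b"
    "trivial_on_meet E Z u0 s1 f" "trivial_on_meet E Z u0 t1 g"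
    unfolding equivalent_triples_def by blast
  have 1: "u1 \<in> pts E s1" "u1 \<in> pts E t1"
    using u(4) u(8-11) X(3) Y(3) pts_I[of s1 a] pts_I[of t1 b] by simp_all
  have 2: "fac E s1 u1 = a" "fac E t1 u1 = b"
    using u(8-11) X(3) Y(3) fac_unique[of s1 a u1] fac_unique[of t1 b u1] by simp_all
  show "eqv (s0, s1, f) (t0, t1, g)"
  proof (rule eqvI)
    show "covers (Cod E s1) u0 u1"
      using u X by (simp add: covers_def)
    show "ap E s1 f z = ap E t1 g z" if "z \<in> pts E u1" for z
    proof -
      have "ap E s1 f z = ap E u1 (ap E s1 f u1) z"
        using ap_restrict[of u1 s1 z f] u(4) X that 1 by simp
      also have "\<dots> = ap E u1 (ap E t1 g u1) z"
        using 2 u(12) by (simp add: ap_def)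
      also have "\<dots> = ap E t1 g z"
        using ap_restrict[of u1 t1 z g] u(4) Y that 1 by simp
      finally show ?thesis .
    qed
    show "pts E u1 \<subseteq> pts E s1" "pts E u1 \<subseteq> pts E t1"
      using 1 pts_le_iff u(4) X(3) Y(3) by simp_all
    show "ap E s1 f z \<in> Z" if "z \<in> pts E u0" "z \<in> pts E s1" for z
      using trivial_on_meet_iff[of u0 s1 f] u(3,5,13) X that by simp
    show "ap E t1 g z \<in> Z" if "z \<in> pts E u0" "z \<in> pts E t1" for z
      using trivial_on_meet_iff[of u0 t1 g] u(1,3,5,14) Y that by simp
  qed (use u in simp_all)
next
  note X = tripleD[OF x] and Y = tripleD[OF y]
  assume "eqv (s0, s1, f) (t0, t1, g)"
  then obtain u0 u1 where u: "eqv_on u0 u1 (s0, s1, f) (t0, t1, g)"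
    by (rule eqvE)
  note u = eqv_onD[OF u]
  note U = coversD[OF u(3)]
  have 1: "u1 \<in> pts E s1" "u1 \<in> pts E t1"
    using u(4,5) pts_self[of u1] U(3) by auto
  have "f \<cdot> fac E s1 u1 = g \<cdot> fac E t1 u1"
    using u(6)[of u1] U(3) by (simp add: ap_def)
  moreover have "trivial_on_meet E Z u0 s1 f"
    using trivial_on_meet_iff[of u0 s1 f] U X u(7) by simp
  moreover have "trivial_on_meet E Z u0 t1 g"
    using trivial_on_meet_iff[of u0 t1 g] U Y u(1,8) by simp
  moreover have "fac E s1 u1 \<in> hom E (Dom E u1) (Dom E s1)" "s1 \<cdot> fac E s1 u1 = u1"
    "fac E t1 u1 \<in> hom E (Dom E u1) (Dom E t1)" "t1 \<cdot> fac E t1 u1 = u1"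
    using 1 X(3) Y(3) by simp_all
  ultimately show "equivalent_triples E D Z (s0, s1, f) (t0, t1, g)"
    unfolding equivalent_triples_def prod.case using U u(1,2) by blast
qed

lemma covers_ap_Z:
  assumes "covers A a b" "s \<in> D" "Cod E s = A" "f \<in> Arr E" "Dom E f = Dom E s" "z \<in> pts E s"
    and "\<And>x. x \<in> Arr E \<Longrightarrow> Cod E x = Dom E z \<Longrightarrow> z \<cdot> x \<in> pts E a \<Longrightarrow> z \<cdot> x \<in> pts E s \<Longrightarrow>
        ap E s f (z \<cdot> x) \<in> Z"
    and "\<And>x. x \<in> Arr E \<Longrightarrow> Cod E x = Dom E z \<Longrightarrow> z \<cdot> x \<in> pts E b \<Longrightarrow> z \<cdot> x \<in> pts E s \<Longrightarrow>
        ap E s f (z \<cdot> x) \<in> Z"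
  shows "ap E s f z \<in> Z"
proof -
  have "ap E s f z \<cdot> x \<in> Z" if "x \<in> Arr E" "Cod E x = Dom E z"
    "z \<cdot> x \<in> pts E a \<or> z \<cdot> x \<in> pts E b" for x
    using assms(7,8)[of x] that assms(2-6) pts_comp[of s z x] ap_comp[of s z f x] by auto
  moreover have "z \<in> Arr E" "Cod E z = A"
    using assms(6,3) pts_arr pts_cod by auto
  ultimately show ?thesis
    using covers_local_Z[OF assms(1), of z "ap E s f z"] assms(2-6) by simp
qed

lemma union_ap_Z:
  assumes "a \<in> D" "b \<in> D" "is_union E a b u" "s \<in> D" "f \<in> Arr E" "Dom E f = Dom E s" "z \<in> pts E s"
    "z \<in> pts E u"
    and "\<And>x. x \<in> Arr E \<Longrightarrow> Cod E x = Dom E z \<Longrightarrow> z \<cdot> x \<in> pts E a \<Longrightarrow> z \<cdot> x \<in> pts E s \<Longrightarrow>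
        ap E s f (z \<cdot> x) \<in> Z"
    and "\<And>x. x \<in> Arr E \<Longrightarrow> Cod E x = Dom E z \<Longrightarrow> z \<cdot> x \<in> pts E b \<Longrightarrow> z \<cdot> x \<in> pts E s \<Longrightarrow>
        ap E s f (z \<cdot> x) \<in> Z"
  shows "ap E s f z \<in> Z"
proof -
  have "ap E s f z \<cdot> x \<in> Z" if "x \<in> Arr E" "Cod E x = Dom E z"
    "z \<cdot> x \<in> pts E a \<or> z \<cdot> x \<in> pts E b" for x
    using assms(9,10)[of x] that assms(4-7) pts_comp[of s z x] ap_comp[of s z f x] by auto
  then show ?thesis
    using union_local_Z[OF assms(1-3) assms(8), of "ap E s f z"] assms(4-7) by simp
qed

text \<open>If \<open>s \<cdot> x\<close> passes through a trivial object by way of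
  \<open>h\<close>, then \<open>x\<close> passes through the pullback of \<open>s\<close> along
  \<open>h\<close>, which is a distinguished subobject of that object and hence trivial by
  CC1.\<close>

lemma D_reflects_Z:
  assumes "s \<in> D" "x \<in> Arr E" "Cod E x = Dom E s" "s \<cdot> x \<in> Z"
  shows "x \<in> Z"
proof -
  from assms(4) obtain g h where gh: "g \<in> Arr E" "h \<in> Arr E" "Cod E g = Dom E h" "Cod E g \<in> T \<inter> F"
    "s \<cdot> x = h \<cdot> g" and "Dom E g = Dom E (s \<cdot> x)" "Cod E h = Cod E (s \<cdot> x)"
    by (rule factoring_E)
  then have dc: "Dom E g = Dom E x" "Cod E h = Cod E s"
    using comp_simps[of x s] assms by simp_all
  obtain p q where pq: "p \<in> D" "is_pullback E h s p q"
    using CS3[of s h] assms gh dc by auto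
  note P = pullbackD[OF pq(2)]
  obtain k where k: "k \<in> Arr E" "Cod E k = Dom E p" "q \<cdot> k = x"
    by (rule pullback_lift[OF pq(2), of g x]) (use gh dc assms in simp_all)
  have "Dom E p \<in> T \<inter> F"
    using CC1[OF pq(1)] P(5) gh by simp
  then have "q \<cdot> k \<in> Z"
    by (intro factoring_I) (use k P in simp_all)
  then show ?thesis
    using k by simp
qed

lemma ap_Z:
  assumes "s \<in> D" "p \<in> pts E s" "p \<in> Z" "f \<in> Arr E" "Dom E f = Dom E s"
  shows "ap E s f p \<in> Z"
proof -
  have "fac E s p \<in> Z"
    by (rule D_reflects_Z[of s]) (use assms in simp_all)
  then show ?thesis
    unfolding ap_def by (rule Z_comp_left) (use assms in simp_all)
qed

text \<open>Two comparison covers combine by uniting their zero parts and intersecting the others: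
  elements of \<open>u1\<close> are split further along \<open>v0\<close> and \<open>v1\<close>.
  This serves the transitivity of \<open>eqv\<close>.\<close>

lemma covers_refine:
  assumes "covers A u0 u1" "covers A v0 v1" "w0 \<in> D" "w1 \<in> D" "Cod E w0 = A" "Cod E w1 = A"
    "pts E u0 \<subseteq> pts E w0" "pts E v0 \<subseteq> pts E w0" "pts E u1 \<inter> pts E v1 \<subseteq> pts E w1"
  shows "covers A w0 w1"
proof (rule coversI)
  note U = coversD[OF assms(1)]
  show "A \<in> Obj E" by (rule U)
  fix w assume w: "w \<in> D" "Cod E w = A" "pts E w0 \<subseteq> pts E w" "pts E w1 \<subseteq> pts E w"
  have "x \<in> pts E w" if x: "x \<in> pts E u1" for x
  proof -
    have xa: "x \<in> Arr E" "Cod E x = A"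
      using x pts_arr pts_cod U by auto
    show ?thesis
    proof (rule covers_local[OF assms(2) xa xa(1) refl w(1)])
      show "x \<cdot> x' \<in> pts E w" if "x' \<in> Arr E" "Cod E x' = Dom E x" "x \<cdot> x' \<in> pts E v0" for x'
        using that w assms by auto
      show "x \<cdot> x' \<in> pts E w" if "x' \<in> Arr E" "Cod E x' = Dom E x" "x \<cdot> x' \<in> pts E v1" for x'
        using that w assms x pts_comp[of u1 x x'] U by auto
    qed (use xa w in simp)
  qed
  then show "Ident E A \<in> pts E w"
    using covers_pts[OF assms(1), of "Ident E A" w] w U assms by auto
qed (use assms in simp_all)

text \<open>A cover of the codomain is pulled back along the partial map on \<open>u1\<close>, and
  \<open>u0\<close> joins the zero part. This is the cover underlying a composite; the same shape
  returns in \<open>composite_eqv\<close> and \<open>covers_extend\<close>.\<close>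

lemma covers_composite:
  assumes "covers A u0 u1" "f \<in> Arr E" "Dom E f = Dom E u1" "covers (Cod E f) v0 v1"
    "w0 \<in> D" "w1 \<in> D" "Cod E w0 = A" "Cod E w1 = A"
    "pts E u0 \<subseteq> pts E w0" "\<And>z. z \<in> pts E u1 \<Longrightarrow> ap E u1 f z \<in> pts E v0 \<Longrightarrow> z \<in> pts E w0"
    "\<And>z. z \<in> pts E u1 \<Longrightarrow> ap E u1 f z \<in> pts E v1 \<Longrightarrow> z \<in> pts E w1"
  shows "covers A w0 w1"
proof (rule coversI)
  note U = coversD[OF assms(1)]
  show "A \<in> Obj E" by (rule U)
  fix w assume w: "w \<in> D" "Cod E w = A" "pts E w0 \<subseteq> pts E w" "pts E w1 \<subseteq> pts E w"
  have "x \<in> pts E w" if x: "x \<in> pts E u1" for x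
  proof -
    have xa: "x \<in> Arr E" "Cod E x = A"
      using x pts_arr pts_cod U by auto
    have ax: "ap E u1 f x \<in> Arr E" "Cod E (ap E u1 f x) = Cod E f" "Dom E (ap E u1 f x) = Dom E x"
      using x assms U by simp_all
    have step: "x \<cdot> x' \<in> pts E u1" "ap E u1 f (x \<cdot> x') = ap E u1 f x \<cdot> x'"
      if "x' \<in> Arr E" "Cod E x' = Dom E x" for x'
      using pts_comp[of u1 x x'] ap_comp[of u1 x f x'] x that assms(2,3) U by simp_all
    show ?thesis
    proof (rule covers_local[OF assms(4) ax(1,2) xa(1) ax(3)[symmetric] w(1)])
      show "x \<cdot> x' \<in> pts E w"
        if "x' \<in> Arr E" "Cod E x' = Dom E (ap E u1 f x)" "ap E u1 f x \<cdot> x' \<in> pts E v0" for x'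
        using step[of x'] that ax(3) w(3) assms(10)[of "x \<cdot> x'"] by auto
      show "x \<cdot> x' \<in> pts E w"
        if "x' \<in> Arr E" "Cod E x' = Dom E (ap E u1 f x)" "ap E u1 f x \<cdot> x' \<in> pts E v1" for x'
        using step[of x'] that ax(3) w(4) assms(11)[of "x \<cdot> x'"] by auto
    qed (use xa w in simp)
  qed
  then show "Ident E A \<in> pts E w"
    using covers_pts[OF assms(1), of "Ident E A" w] w U assms by auto
qed (use assms in simp_all)

lemma eqv_refl: "x \<in> triples E D Z \<Longrightarrow> eqv x x"
proof (cases x)
  case (fields s0 s1 f)
  assume "x \<in> triples E D Z"
  note X = tripleD[OF this[unfolded fields]]
  show "eqv x x"
    unfolding fields by (rule eqvI[of _ _ _ _ s0 s1]) (use X in auto)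
qed

lemma eqv_sym: "eqv x y \<Longrightarrow> eqv y x"
proof -
  have "eqv_on u0 u1 y x" if "eqv_on u0 u1 x y" for u0 u1
    using that by (cases x; cases y) (auto simp: eqv_on_def)
  then show "eqv x y \<Longrightarrow> eqv y x"
    unfolding eqv_def by blast
qed

lemma eqv_trans:
  assumes "x \<in> triples E D Z" "y \<in> triples E D Z" "r \<in> triples E D Z" "eqv x y" "eqv y r"
  shows "eqv x r"
proof -
  obtain s0 s1 f where xs: "x = (s0, s1, f)" by (cases x)
  obtain t0 t1 g where ys: "y = (t0, t1, g)" by (cases y)
  obtain r0 r1 h where rs: "r = (r0, r1, h)" by (cases r)
  note X = tripleD[OF assms(1)[unfolded xs]]
  note Y = tripleD[OF assms(2)[unfolded ys]]
  note R = tripleD[OF assms(3)[unfolded rs]]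
  obtain u0 u1 where u: "eqv_on u0 u1 (s0, s1, f) (t0, t1, g)"
    using assms(4)[unfolded xs ys] by (rule eqvE)
  note u = eqv_onD[OF u]
  obtain v0 v1 where v: "eqv_on v0 v1 (t0, t1, g) (r0, r1, h)"
    using assms(5)[unfolded ys rs] by (rule eqvE)
  note v = eqv_onD[OF v]
  note U = coversD[OF u(3)] and V = coversD[OF v(3)]
  have cv: "covers (Cod E s1) v0 v1"
    using v(3) u(1) by simp
  obtain w1 where w1: "w1 \<in> D" "Cod E w1 = Cod E u1" "pts E w1 = pts E u1 \<inter> pts E v1"
    by (rule intersection[of u1 v1]) (use U V u(1) in simp_all)
  obtain w0 where w0: "w0 \<in> D" "is_union E u0 v0 w0"
    using CS2[of u0 v0] U V u(1) by auto
  have le: "pts E u0 \<subseteq> pts E w0" "pts E v0 \<subseteq> pts E w0"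
    using w0(2) by (simp_all add: is_union_pts)
  have w0c: "Cod E w0 = Cod E s1"
    using le(1) pts_self[of u0] pts_cod[of u0 w0] U by (simp add: subset_iff)
  have cov: "covers (Cod E s1) w0 w1"
    by (rule covers_refine[OF u(3) cv]) (use w0 w1 le w0c U in simp_all)
  \<comment> \<open>Triviality of \<open>f\<close> on \<open>v0\<close> is not among the data.
    Locally an element of \<open>v0\<close> lies in \<open>u0\<close>, where \<open>f\<close> is
    trivial, or in \<open>u1\<close>, where \<open>f\<close> equals \<open>g\<close>, and
    \<open>g\<close> is trivial on \<open>v0\<close>.\<close>
  have fv: "ap E s1 f z \<in> Z" if z: "z \<in> pts E v0" "z \<in> pts E s1" for z
  proof (rule covers_ap_Z[OF u(3) X(3) refl X(5,6) z(2)])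
    fix x assume x: "x \<in> Arr E" "Cod E x = Dom E z"
    show "ap E s1 f (z \<cdot> x) \<in> Z" if "z \<cdot> x \<in> pts E u0" "z \<cdot> x \<in> pts E s1"
      using u(7) that .
    have zv: "z \<cdot> x \<in> pts E v0"
      using pts_comp[of v0 z x] x z V by simp
    show "ap E s1 f (z \<cdot> x) \<in> Z" if "z \<cdot> x \<in> pts E u1" "z \<cdot> x \<in> pts E s1"
      using u(6)[OF that(1)] v(7)[OF zv] u(5) that by auto
  qed
  have hu: "ap E r1 h z \<in> Z" if z: "z \<in> pts E u0" "z \<in> pts E r1" for z
  proof (rule covers_ap_Z[OF v(3) R(3) v(1)[symmetric] R(5,6) z(2)])
    fix x assume x: "x \<in> Arr E" "Cod E x = Dom E z"
    show "ap E r1 h (z \<cdot> x) \<in> Z" if "z \<cdot> x \<in> pts E v0" "z \<cdot> x \<in> pts E r1"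
      using v(8) that .
    have zv: "z \<cdot> x \<in> pts E u0"
      using pts_comp[of u0 z x] x z U by simp
    show "ap E r1 h (z \<cdot> x) \<in> Z" if "z \<cdot> x \<in> pts E v1" "z \<cdot> x \<in> pts E r1"
      using v(6)[OF that(1)] u(8)[OF zv] v(4) that by auto
  qed
  show ?thesis
    unfolding xs rs
  proof (rule eqvI[OF _ _ cov])
    show "ap E s1 f z = ap E r1 h z" if "z \<in> pts E w1" for z
      using that w1 u(6) v(6) by simp
    show "ap E s1 f z \<in> Z" if "z \<in> pts E w0" "z \<in> pts E s1" for z
      by (rule union_ap_Z[OF U(2) V(2) w0(2) X(3,5,6) that(2,1)]) (use u(7) fv in simp_all)
    show "ap E r1 h z \<in> Z" if "z \<in> pts E w0" "z \<in> pts E r1" for z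
      by (rule union_ap_Z[OF U(2) V(2) w0(2) R(3,5,6) that(2,1)]) (use v(8) hu in simp_all)
  qed (use u(1,2,4,5) v(1,2,4,5) w1 in auto)
qed

end

section \<open>Composition of distinguished partial morphisms\<close>

context compatible
begin

text \<open>The isomorphism demanded by \<open>same_triple\<close> is determined by the inclusions,
  being the factorization of \<open>s1\<close> through \<open>t1\<close>, so that elements suffice
  to express it.\<close>

lemma same_triple_iff:
  assumes x: "(s0, s1, f) \<in> triples E D Z" and y: "(t0, t1, g) \<in> triples E D Z"
  shows "same_triple E (s0, s1, f) (t0, t1, g) \<longleftrightarrow> pts E s0 = pts E t0 \<and> pts E s1 = pts E t1 \<and>
     (\<forall>z\<in>pts E s1. ap E s1 f z = ap E t1 g z)"
proof -
  note X = tripleD[OF x] and Y = tripleD[OF y]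
  show ?thesis
  proof
    assume "same_triple E (s0, s1, f) (t0, t1, g)"
    then obtain i where i: "same_sub E s0 t0" "i \<in> hom E (Dom E s1) (Dom E t1)" "is_iso E i"
      "t1 \<cdot> i = s1" "g \<cdot> i = f"
      unfolding same_triple_def by blast
    from i(3) obtain j where j: "i \<in> Arr E" "j \<in> Arr E" "Dom E j = Cod E i" "Cod E j = Dom E i"
      "i \<cdot> j = Ident E (Cod E i)" by (rule isoE)
    have "s1 \<in> pts E t1"
      using pts_I[of t1 i] i Y by simp
    moreover have "s1 \<cdot> j = t1"
    proof -
      have "(t1 \<cdot> i) \<cdot> j = t1 \<cdot> (i \<cdot> j)"
        using i(2) j(1-4) Y by (simp add: assoc)
      then show ?thesis
        using i j Y by simp
    qed
    then have "t1 \<in> pts E s1"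
      using pts_I[of s1 j] i(2) j X by simp
    ultimately have eq: "pts E s1 = pts E t1"
      using pts_le_iff[of s1 t1] pts_le_iff[of t1 s1] X Y by simp
    have "ap E s1 f z = ap E t1 g z" if z: "z \<in> pts E s1" for z
    proof -
      have "t1 \<cdot> (i \<cdot> fac E s1 z) = (t1 \<cdot> i) \<cdot> fac E s1 z"
        using i(2) z X Y by (simp add: assoc)
      also have "\<dots> = z"
        using i(4) z X by simp
      finally have "fac E t1 z = i \<cdot> fac E s1 z"
        by (intro fac_unique) (use i(2) z X Y in simp_all)
      moreover have "g \<cdot> (i \<cdot> fac E s1 z) = (g \<cdot> i) \<cdot> fac E s1 z"
        using i(2) z X Y by (simp add: assoc)
      ultimately show ?thesis
        using i(5) by (simp add: ap_def)
    qed
    then show "pts E s0 = pts E t0 \<and> pts E s1 = pts E t1 \<and> (\<forall>z\<in>pts E s1. ap E s1 f z = ap E t1 g z)"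
      using i(1) eq by (simp add: same_sub_pts)
  next
    assume *: "pts E s0 = pts E t0 \<and> pts E s1 = pts E t1 \<and> (\<forall>z\<in>pts E s1. ap E s1 f z = ap E t1 g z)"
    then have 1: "s1 \<in> pts E t1" "t1 \<in> pts E s1"
      using pts_self[of s1] pts_self[of t1] X Y by simp_all
    let ?i = "fac E t1 s1" and ?j = "fac E s1 t1"
    have "t1 \<cdot> (?i \<cdot> ?j) = t1 \<cdot> Ident E (Dom E t1)"
      using 1 X Y by (simp add: assoc[symmetric])
    then have a: "?i \<cdot> ?j = Ident E (Dom E t1)"
      by (rule monoD[of t1, rotated]) (use 1 X Y in simp_all)
    have "s1 \<cdot> (?j \<cdot> ?i) = s1 \<cdot> Ident E (Dom E s1)"
      using 1 X Y by (simp add: assoc[symmetric])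
    then have b: "?j \<cdot> ?i = Ident E (Dom E s1)"
      by (rule monoD[of s1, rotated]) (use 1 X Y in simp_all)
    have "is_iso E ?i"
      by (rule isoI[of ?i ?j]) (use 1 a b X Y in simp_all)
    moreover have "ap E s1 f s1 = ap E t1 g s1"
      by (rule *[THEN conjunct2, THEN conjunct2, THEN bspec]) (use X in simp)
    then have "g \<cdot> ?i = f"
      using X by (simp add: ap_def)
    moreover have "same_sub E s0 t0"
      using * X Y by (simp add: same_sub_pts)
    moreover have "?i \<in> hom E (Dom E s1) (Dom E t1)" "t1 \<cdot> ?i = s1"
      using 1 Y by simp_all
    ultimately show "same_triple E (s0, s1, f) (t0, t1, g)"
      unfolding same_triple_def by blast
  qed
qed

lemma same_triple_cod:
  assumes x: "(s0, s1, f) \<in> triples E D Z" and y: "(t0, t1, g) \<in> triples E D Z"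
    and "same_triple E (s0, s1, f) (t0, t1, g)"
  shows "Cod E s1 = Cod E t1" "Cod E f = Cod E g"
proof -
  note X = tripleD[OF x] and Y = tripleD[OF y]
  have *: "pts E s1 = pts E t1" "\<And>z. z \<in> pts E s1 \<Longrightarrow> ap E s1 f z = ap E t1 g z"
    using assms(3) same_triple_iff[OF x y] by auto
  show "Cod E s1 = Cod E t1"
    using pts_eq_cod[of s1 t1] * X by simp
  have "s1 \<in> pts E s1"
    using X by simp
  then have "ap E s1 f s1 = ap E t1 g s1" "s1 \<in> pts E t1"
    using * by simp_all
  moreover have "Cod E (ap E s1 f s1) = Cod E f"
    using X by simp
  moreover have "Cod E (ap E t1 g s1) = Cod E g"
    using calculation(2) Y by simp
  ultimately show "Cod E f = Cod E g"
    by simp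
qed

lemma same_eqv:
  assumes "x \<in> triples E D Z" "y \<in> triples E D Z" "same_triple E x y"
  shows "eqv x y"
proof -
  obtain s0 s1 f where xs: "x = (s0, s1, f)" by (cases x)
  obtain t0 t1 g where ys: "y = (t0, t1, g)" by (cases y)
  note X = tripleD[OF assms(1)[unfolded xs]]
  note Y = tripleD[OF assms(2)[unfolded ys]]
  have *: "pts E s0 = pts E t0" "pts E s1 = pts E t1" "\<And>z. z \<in> pts E s1 \<Longrightarrow> ap E s1 f z = ap E t1 g z"
    using assms same_triple_iff unfolding xs ys by auto
  show ?thesis
    unfolding xs ys
    by (rule eqvI[OF _ _ X(1)]) (use * X Y same_triple_cod assms[unfolded xs ys] in auto)
qed

text \<open>Elementwise form of \<open>is_composite\<close>: \<open>v\<close> is the inverse image of \<open>t0\<close>.\<close>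

definition composite_pts :: "'m triple \<Rightarrow> 'm triple \<Rightarrow> 'm triple \<Rightarrow> bool" where
  "composite_pts = (\<lambda>(t0, t1, g) (s0, s1, f) (w0, w1, h).
     Cod E f = Cod E t1 \<and> is_mono E w1 \<and>
     (\<exists>v\<in>D. Cod E v = Cod E s1 \<and> pts E v = {z \<in> pts E s1. ap E s1 f z \<in> pts E t0} \<and>
       is_union E s0 v w0) \<and>
     pts E w1 = {z \<in> pts E s1. ap E s1 f z \<in> pts E t1} \<and>
     h \<in> Arr E \<and> Dom E h = Dom E w1 \<and> (\<forall>z\<in>pts E w1. ap E w1 h z = ap E t1 g (ap E s1 f z)))"

lemma is_composite_iff:
  assumes x: "(s0, s1, f) \<in> triples E D Z" and y: "(t0, t1, g) \<in> triples E D Z"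
  shows "is_composite E (t0, t1, g) (s0, s1, f) (w0, w1, h) \<longleftrightarrow>
    composite_pts (t0, t1, g) (s0, s1, f) (w0, w1, h)"
proof -
  note X = tripleD[OF x] and Y = tripleD[OF y]
  show ?thesis
  proof
    assume "is_composite E (t0, t1, g) (s0, s1, f) (w0, w1, h)"
    then obtain p0 f0 p1 f1 where c: "Cod E f = Cod E t1" "is_pullback E f t0 p0 f0"
      "is_union E s0 (s1 \<cdot> p0) w0" "is_pullback E f t1 p1 f1" "w1 = s1 \<cdot> p1" "h = g \<cdot> f1"
      unfolding is_composite_def prod.case by blast
    note P0 = pullbackD[OF c(2)] pullback_pts[OF c(2) D_simps(1)[OF Y(2)]]
    note P1 = pullbackD[OF c(4)] pullback_pts[OF c(4) D_simps(1)[OF Y(3)]]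
    have m0: "is_mono E s1" "is_mono E p0" "Cod E p0 = Dom E s1"
      using X P0 by simp_all
    have m1: "is_mono E s1" "is_mono E p1" "Cod E p1 = Dom E s1"
      using X P1 by simp_all
    \<comment> \<open>\<open>p0\<close> belongs to an arbitrary pullback square, whereas CS3 only
      provides some distinguished one; the two have the same elements.\<close>
    obtain w q where wq: "w \<in> D" "is_pullback E f t0 w q"
      using CS3[of t0 f] X Y c(1) by auto
    have "p0 \<in> D"
      by (rule D_pts_eq[OF wq(1) m0(2)]) (use pullback_pts[OF wq(2) D_simps(1)[OF Y(2)]] P0 in simp)
    then have v: "s1 \<cdot> p0 \<in> D" "Cod E (s1 \<cdot> p0) = Cod E s1"
      using CS5[of p0 s1] X m0 by simp_all
    have vp: "pts E (s1 \<cdot> p0) = {z \<in> pts E s1. ap E s1 f z \<in> pts E t0}"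
      unfolding pts_comp_iff(1)[OF m0] P0(11) using X by (auto simp: ap_def)
    have wp: "pts E (s1 \<cdot> p1) = {z \<in> pts E s1. ap E s1 f z \<in> pts E t1}"
      unfolding pts_comp_iff(1)[OF m1] P1(11) using X by (auto simp: ap_def)
    have "ap E w1 h z = ap E t1 g (ap E s1 f z)" if "z \<in> pts E w1" for z
    proof -
      have z: "z \<in> pts E (s1 \<cdot> p1)" "z \<in> pts E s1" "fac E s1 z \<in> pts E p1"
        using that pts_comp_iff(1)[OF m1] c(5) by auto
      have "ap E w1 h z = (g \<cdot> f1) \<cdot> fac E p1 (fac E s1 z)"
        using pts_comp_iff(2)[OF m1 z(1)] c by (simp add: ap_def)
      also have "\<dots> = g \<cdot> (f1 \<cdot> fac E p1 (fac E s1 z))"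
        using z m1 Y P1(1-8) by (simp add: assoc)
      also have "f1 \<cdot> fac E p1 (fac E s1 z) = fac E t1 (f \<cdot> fac E s1 z)"
        by (rule P1(12)[OF z(3)])
      finally show ?thesis
        by (simp add: ap_def)
    qed
    then show "composite_pts (t0, t1, g) (s0, s1, f) (w0, w1, h)"
      unfolding composite_pts_def prod.case
      using c(1,3,5,6) v vp wp mono_comp[OF m1(2,1,3)] P1(1-8) Y X by auto
  next
    assume "composite_pts (t0, t1, g) (s0, s1, f) (w0, w1, h)"
    then obtain v where c: "Cod E f = Cod E t1" "is_mono E w1" "v \<in> D" "Cod E v = Cod E s1"
      "pts E v = {z \<in> pts E s1. ap E s1 f z \<in> pts E t0}" "is_union E s0 v w0"
      "pts E w1 = {z \<in> pts E s1. ap E s1 f z \<in> pts E t1}" "h \<in> Arr E" "Dom E h = Dom E w1"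
      "\<And>z. z \<in> pts E w1 \<Longrightarrow> ap E w1 h z = ap E t1 g (ap E s1 f z)"
      unfolding composite_pts_def prod.case by blast
    obtain p0 f0 where p0: "p0 \<in> D" "is_pullback E f t0 p0 f0"
      using CS3[of t0 f] X Y c(1) by auto
    note P0 = pullbackD[OF p0(2)] pullback_pts[OF p0(2) D_simps(1)[OF Y(2)]]
    have m0: "is_mono E s1" "is_mono E p0" "Cod E p0 = Dom E s1"
      using X P0 by simp_all
    have vp: "pts E (s1 \<cdot> p0) = pts E v"
      unfolding pts_comp_iff(1)[OF m0] P0(11) c(5) using X by (auto simp: ap_def)
    have u: "is_union E s0 (s1 \<cdot> p0) w0"
      by (rule is_union_same[OF c(6)])
        (use vp c(6) mono_comp[OF m0(2,1,3)] in \<open>simp_all add: is_union_pts\<close>)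
    have ws: "w1 \<in> pts E s1" "ap E s1 f w1 \<in> pts E t1"
      using pts_self[of w1] c(2,7) by auto
    \<comment> \<open>The projection sought must give \<open>w1\<close> after composition with
      \<open>s1\<close>, which leaves only the factorization of \<open>w1\<close> through
      \<open>s1\<close>.\<close>
    let ?p = "fac E s1 w1"
    have p: "?p \<in> Arr E" "Dom E ?p = Dom E w1" "Cod E ?p = Dom E s1" "s1 \<cdot> ?p = w1"
      using ws X by simp_all
    have mp: "is_mono E ?p"
      by (rule mono_rightcancel[of s1]) (use p c(2) X in simp_all)
    have "pts E ?p = {z \<in> Arr E. Cod E z = Dom E f \<and> f \<cdot> z \<in> pts E t1}"
    proof (intro equalityI subsetI)
      fix z assume z: "z \<in> pts E ?p"
      have za: "z \<in> Arr E" "Cod E z = Dom E s1"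
        using z pts_arr pts_cod p by auto
      have "fac E s1 (s1 \<cdot> z) = z"
        by (rule fac_unique) (use za X in simp_all)
      moreover have "s1 \<cdot> z \<in> pts E w1"
        using pts_comp_iff(1)[of s1 ?p] mp p X z pts_I[of s1 z] za calculation by auto
      ultimately have "f \<cdot> z \<in> pts E t1"
        using c(7) by (auto simp: ap_def)
      then show "z \<in> {z \<in> Arr E. Cod E z = Dom E f \<and> f \<cdot> z \<in> pts E t1}"
        using za X by simp
    next
      fix z assume "z \<in> {z \<in> Arr E. Cod E z = Dom E f \<and> f \<cdot> z \<in> pts E t1}"
      then have z: "z \<in> Arr E" "Cod E z = Dom E s1" "f \<cdot> z \<in> pts E t1"
        using X by auto
      have fz: "fac E s1 (s1 \<cdot> z) = z"
        by (rule fac_unique) (use z X in simp_all)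
      have "s1 \<cdot> z \<in> pts E w1"
        using c(7) z fz pts_I[of s1 z] X by (simp add: ap_def)
      then show "z \<in> pts E ?p"
        using pts_comp_iff(1)[of s1 ?p] mp p X fz by auto
    qed
    then have "is_pullback E f t1 ?p (fac E t1 (f \<cdot> ?p))"
      by (intro pullbackI) (use mp p X Y c(1) in simp_all)
    moreover have "h = g \<cdot> fac E t1 (f \<cdot> ?p)"
      using c(10)[of w1] c(2,8,9) by (simp add: ap_def)
    ultimately show "is_composite E (t0, t1, g) (s0, s1, f) (w0, w1, h)"
      unfolding is_composite_def prod.case using c(1) p0(2) u p(4) by metis
  qed
qed

lemma composite_exists:
  assumes x: "(s0, s1, f) \<in> triples E D Z" and y: "(t0, t1, g) \<in> triples E D Z"
    and cod: "Cod E f = Cod E t1"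
  obtains w where "is_composite E (t0, t1, g) (s0, s1, f) w"
proof -
  note X = tripleD[OF x] and Y = tripleD[OF y]
  obtain p0 f0 where p0: "p0 \<in> D" "is_pullback E f t0 p0 f0"
    using CS3[of t0 f] X Y cod by auto
  obtain p1 f1 where p1: "p1 \<in> D" "is_pullback E f t1 p1 f1"
    using CS3[of t1 f] X Y cod by auto
  note P0 = pullbackD[OF p0(2)]
  have "s1 \<cdot> p0 \<in> D"
    using CS5[of p0 s1] p0 X P0 by simp
  then obtain w0 where "is_union E s0 (s1 \<cdot> p0) w0"
    using CS2[of s0 "s1 \<cdot> p0"] X p0 P0 by auto
  then show thesis
    using that[of "(w0, s1 \<cdot> p1, g \<cdot> f1)"] p0 p1 cod unfolding is_composite_def prod.case by blast
qed

text \<open>That \<open>w0\<close> and \<open>w1\<close> are distinguished follows by comparison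
  with the union from CS2 and with the subobject from \<open>preimage\<close>, which have the same
  elements.\<close>

lemma compositeE:
  assumes x: "(s0, s1, f) \<in> triples E D Z" and y: "(t0, t1, g) \<in> triples E D Z"
    and "is_composite E (t0, t1, g) (s0, s1, f) (w0, w1, h)"
  obtains v where "Cod E f = Cod E t1" "w0 \<in> D" "w1 \<in> D" "v \<in> D" "Cod E v = Cod E s1"
      "Cod E w0 = Cod E s1" "Cod E w1 = Cod E s1" "h \<in> Arr E" "Dom E h = Dom E w1"
      "Cod E h = Cod E g"
      "pts E v = {z \<in> pts E s1. ap E s1 f z \<in> pts E t0}" "is_union E s0 v w0"
      "pts E w1 = {z \<in> pts E s1. ap E s1 f z \<in> pts E t1}"
      "\<And>z. z \<in> pts E w1 \<Longrightarrow> ap E w1 h z = ap E t1 g (ap E s1 f z)"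
proof -
  note X = tripleD[OF x] and Y = tripleD[OF y]
  from assms(3) obtain v where c: "Cod E f = Cod E t1" "is_mono E w1" "v \<in> D" "Cod E v = Cod E s1"
      "pts E v = {z \<in> pts E s1. ap E s1 f z \<in> pts E t0}" "is_union E s0 v w0"
      "pts E w1 = {z \<in> pts E s1. ap E s1 f z \<in> pts E t1}" "h \<in> Arr E" "Dom E h = Dom E w1"
      "\<And>z. z \<in> pts E w1 \<Longrightarrow> ap E w1 h z = ap E t1 g (ap E s1 f z)"
    unfolding is_composite_iff[OF x y] composite_pts_def prod.case by blast
  obtain u where u: "u \<in> D" "is_union E s0 v u"
    using CS2[of s0 v] c X by auto
  have "w0 \<in> D"
    by (rule D_pts_eq[OF u(1)]) (use is_union_unique[OF u(2) c(6)]
      c(6) in \<open>simp_all add: is_union_pts\<close>)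
  moreover have "Cod E w0 = Cod E s1"
  proof -
    have "v \<in> pts E w0"
      using c(6) pts_self[of v] c(3) by (auto simp: is_union_pts)
    then show ?thesis
      using pts_cod[of v w0] c(4) by simp
  qed
  moreover obtain w where w: "w \<in> D" "Cod E w = Cod E s1"
    "pts E w = {z \<in> pts E s1. ap E s1 f z \<in> pts E t1}"
    by (rule preimage[of s1 f t1]) (use X Y c(1) in simp_all)
  have "w1 \<in> D"
    by (rule D_pts_eq[OF w(1) c(2)]) (use w c(7) in simp)
  moreover have "Cod E w1 = Cod E s1"
    using pts_eq_cod[OF c(2), of w] w c(7) by simp
  moreover have "Cod E h = Cod E g"
  proof -
    have "w1 \<in> pts E w1" "w1 \<in> pts E s1" "ap E s1 f w1 \<in> pts E t1"
      using pts_self[of w1] c(2,7) by auto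
    then have "ap E w1 h w1 = ap E t1 g (ap E s1 f w1)" "Cod E (ap E t1 g (ap E s1 f w1)) = Cod E g"
      using c(10) Y by simp_all
    then show ?thesis
      using c(2,8,9) by simp
  qed
  ultimately show thesis
    using that[OF c(1) _ _ c(3,4) _ _ c(8,9) _ c(5-7) c(10)] by blast
qed

text \<open>\<open>w0\<close> is the union of \<open>s0\<close> and \<open>v\<close>, and triviality
  is tested on each. Over \<open>s0\<close> the value of \<open>f\<close> is already trivial and
  stays so under \<open>g\<close> by \<open>ap_Z\<close>; over \<open>v\<close> it lies in both
  \<open>t0\<close> and \<open>t1\<close>, where \<open>g\<close> is trivial.\<close>

lemma composite_triple:
  assumes x: "(s0, s1, f) \<in> triples E D Z" and y: "(t0, t1, g) \<in> triples E D Z"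
    and c: "is_composite E (t0, t1, g) (s0, s1, f) (w0, w1, h)"
  shows "(w0, w1, h) \<in> triples E D Z"
proof -
  note X = tripleD[OF x] and Y = tripleD[OF y]
  obtain v where v: "Cod E f = Cod E t1" "w0 \<in> D" "w1 \<in> D" "v \<in> D" "Cod E v = Cod E s1"
      "Cod E w0 = Cod E s1" "Cod E w1 = Cod E s1" "h \<in> Arr E" "Dom E h = Dom E w1"
      "Cod E h = Cod E g"
      "pts E v = {z \<in> pts E s1. ap E s1 f z \<in> pts E t0}" "is_union E s0 v w0"
      "pts E w1 = {z \<in> pts E s1. ap E s1 f z \<in> pts E t1}"
      "\<And>z. z \<in> pts E w1 \<Longrightarrow> ap E w1 h z = ap E t1 g (ap E s1 f z)"
    by (rule compositeE[OF assms]) blast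
  have le: "pts E s0 \<subseteq> pts E w0" "pts E v \<subseteq> pts E w0"
    using v(12) by (simp_all add: is_union_pts)
  have cov: "covers (Cod E s1) w0 w1"
    by (rule covers_composite[OF X(1) X(5,6), of t0 t1]) (use Y v le in auto)
  have "ap E w1 h z \<in> Z" if z: "z \<in> pts E w0" "z \<in> pts E w1" for z
  proof (rule union_ap_Z[OF X(2) v(4) v(12) v(3,8,9) z(2,1)])
    fix x assume x: "x \<in> Arr E" "Cod E x = Dom E z" and zx: "z \<cdot> x \<in> pts E w1"
    have sx: "z \<cdot> x \<in> pts E s1" "ap E s1 f (z \<cdot> x) \<in> pts E t1"
      using zx v(13) by auto
    show "ap E w1 h (z \<cdot> x) \<in> Z" if "z \<cdot> x \<in> pts E s0"
      using ap_Z[of t1 "ap E s1 f (z \<cdot> x)" g] X(7)[OF that sx(1)] Y sx v(14)[OF zx] by simp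
    show "ap E w1 h (z \<cdot> x) \<in> Z" if "z \<cdot> x \<in> pts E v"
      using Y(7)[of "ap E s1 f (z \<cdot> x)"] that v(11) sx v(14)[OF zx] by auto
  qed
  then show ?thesis
    unfolding triples_iff using cov v(7-9) by simp
qed

lemma composite_eqv:
  assumes x: "(s0, s1, f) \<in> triples E D Z" and y: "(t0, t1, g) \<in> triples E D Z"
    and x': "(s0', s1', f') \<in> triples E D Z" and y': "(t0', t1', g') \<in> triples E D Z"
    and xx: "eqv (s0, s1, f) (s0', s1', f')" and yy: "eqv (t0, t1, g) (t0', t1', g')"
    and w: "is_composite E (t0, t1, g) (s0, s1, f) (w0, w1, h)"
    and w': "is_composite E (t0', t1', g') (s0', s1', f') (w0', w1', h')"
  shows "eqv (w0, w1, h) (w0', w1', h')"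
proof -
  note X = tripleD[OF x] and Y = tripleD[OF y] and X' = tripleD[OF x'] and Y' = tripleD[OF y']
  obtain u0 u1 where u: "eqv_on u0 u1 (s0, s1, f) (s0', s1', f')"
    using xx by (rule eqvE)
  note u = eqv_onD[OF u]
  obtain v0 v1 where v: "eqv_on v0 v1 (t0, t1, g) (t0', t1', g')"
    using yy by (rule eqvE)
  note v = eqv_onD[OF v]
  note U = coversD[OF u(3)] and V = coversD[OF v(3)]
  have c: "Cod E f = Cod E t1" "w1 \<in> D" "Cod E w1 = Cod E s1" "h \<in> Arr E" "Dom E h = Dom E w1"
      "Cod E h = Cod E g" "pts E w1 = {z \<in> pts E s1. ap E s1 f z \<in> pts E t1}"
      "\<And>z. z \<in> pts E w1 \<Longrightarrow> ap E w1 h z = ap E t1 g (ap E s1 f z)"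
    by (rule compositeE[OF x y w]; blast)+
  have c': "w1' \<in> D" "Cod E w1' = Cod E s1'" "h' \<in> Arr E" "Dom E h' = Dom E w1'"
      "Cod E h' = Cod E g'" "pts E w1' = {z \<in> pts E s1'. ap E s1' f' z \<in> pts E t1'}"
      "\<And>z. z \<in> pts E w1' \<Longrightarrow> ap E w1' h' z = ap E t1' g' (ap E s1' f' z)"
    by (rule compositeE[OF x' y' w']; blast)+
  \<comment> \<open>The comparison cover consists of \<open>a0\<close>, uniting \<open>u0\<close>
    with the part of \<open>u1\<close> that \<open>f\<close> sends into \<open>v0\<close>, and of
    \<open>b1\<close>, the part of \<open>u1\<close> that \<open>f\<close> sends into
    \<open>v1\<close>. Since \<open>f\<close> and \<open>f'\<close> agree on \<open>u1\<close>, one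
    cover serves both composites.\<close>
  let ?k = "ap E s1 f u1"
  have us: "u1 \<in> pts E s1"
    using u(4) U(3) pts_self[of u1] by auto
  have k: "?k \<in> Arr E" "Dom E ?k = Dom E u1" "Cod E ?k = Cod E t1"
    using us X c(1) by simp_all
  have apk: "ap E u1 ?k z = ap E s1 f z" if "z \<in> pts E u1" for z
    using ap_restrict[of u1 s1 z f] that U X us by simp
  obtain b0 where b0: "b0 \<in> D" "Cod E b0 = Cod E u1"
    "pts E b0 = {z \<in> pts E u1. ap E u1 ?k z \<in> pts E v0}"
    by (rule preimage[of u1 ?k v0]) (use U V k in simp_all)
  obtain b1 where b1: "b1 \<in> D" "Cod E b1 = Cod E u1"
    "pts E b1 = {z \<in> pts E u1. ap E u1 ?k z \<in> pts E v1}"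
    by (rule preimage[of u1 ?k v1]) (use U V k in simp_all)
  obtain a0 where a0: "a0 \<in> D" "is_union E u0 b0 a0"
    using CS2[of u0 b0] U b0 by auto
  have le: "pts E u0 \<subseteq> pts E a0" "pts E b0 \<subseteq> pts E a0"
    using a0(2) by (simp_all add: is_union_pts)
  have a0c: "Cod E a0 = Cod E s1"
    using le(1) pts_self[of u0] pts_cod[of u0 a0] U by (simp add: subset_iff)
  have cov: "covers (Cod E s1) a0 b1"
    by (rule covers_composite[OF u(3) k(1,2), of v0 v1]) (use v(3) k a0 a0c b0 b1 le U in auto)
  show ?thesis
  proof (rule eqvI[of _ _ _ _ a0 b1])
    show "covers (Cod E w1) a0 b1"
      using cov c by simp
    show le1: "pts E b1 \<subseteq> pts E w1"
      using b1(3) c(7) u(4) v(4) apk by auto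
    show le1': "pts E b1 \<subseteq> pts E w1'"
      using b1(3) c'(6) u(5,6) v(5) apk by auto
    show "ap E w1 h z = ap E w1' h' z" if z: "z \<in> pts E b1" for z
    proof -
      have "z \<in> pts E w1" "z \<in> pts E w1'" "z \<in> pts E u1" "ap E s1 f z \<in> pts E v1"
        using z le1 le1' b1(3) apk by auto
      then show ?thesis
        using c(8)[of z] c'(7)[of z] u(6)[of z] v(6)[of "ap E s1 f z"] by simp
    qed
    have step: "ap E s1 f y = ap E s1' f' y" "ap E s1 f y \<in> pts E v0" if "y \<in> pts E b0" for y
      using that b0(3) apk u(6) by auto
    show "ap E w1 h z \<in> Z" if z: "z \<in> pts E a0" "z \<in> pts E w1" for z
    proof (rule union_ap_Z[OF U(2) b0(1) a0(2) c(2,4,5) z(2,1)])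
      fix x assume x: "x \<in> Arr E" "Cod E x = Dom E z" and zx: "z \<cdot> x \<in> pts E w1"
      have sx: "z \<cdot> x \<in> pts E s1" "ap E s1 f (z \<cdot> x) \<in> pts E t1"
        using zx c(7) by auto
      show "ap E w1 h (z \<cdot> x) \<in> Z" if "z \<cdot> x \<in> pts E u0"
        using ap_Z[of t1 "ap E s1 f (z \<cdot> x)" g] u(7)[OF that sx(1)] Y sx c(8)[OF zx] by simp
      show "ap E w1 h (z \<cdot> x) \<in> Z" if "z \<cdot> x \<in> pts E b0"
        using v(7)[of "ap E s1 f (z \<cdot> x)"] step[OF that] sx c(8)[OF zx] by simp
    qed
    show "ap E w1' h' z \<in> Z" if z: "z \<in> pts E a0" "z \<in> pts E w1'" for z
    proof (rule union_ap_Z[OF U(2) b0(1) a0(2) c'(1,3,4) z(2,1)])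
      fix x assume x: "x \<in> Arr E" "Cod E x = Dom E z" and zx: "z \<cdot> x \<in> pts E w1'"
      have sx: "z \<cdot> x \<in> pts E s1'" "ap E s1' f' (z \<cdot> x) \<in> pts E t1'"
        using zx c'(6) by auto
      show "ap E w1' h' (z \<cdot> x) \<in> Z" if "z \<cdot> x \<in> pts E u0"
        using ap_Z[of t1' "ap E s1' f' (z \<cdot> x)" g'] u(8)[OF that sx(1)] Y' sx c'(7)[OF zx] by simp
      show "ap E w1' h' (z \<cdot> x) \<in> Z" if "z \<cdot> x \<in> pts E b0"
        using v(8)[of "ap E s1' f' (z \<cdot> x)"] step[OF that] sx c'(7)[OF zx] by simp
    qed
  qed (use c c' u(1) v(2) in simp_all)
qed

lemma composite_same:
  assumes x: "(s0, s1, f) \<in> triples E D Z" and y: "(t0, t1, g) \<in> triples E D Z"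
    and x': "(s0', s1', f') \<in> triples E D Z" and y': "(t0', t1', g') \<in> triples E D Z"
    and xx: "same_triple E (s0, s1, f) (s0', s1', f')" and yy: "same_triple E (t0, t1, g) (t0', t1',
      g')"
    and w: "is_composite E (t0, t1, g) (s0, s1, f) (w0, w1, h)"
    and w': "is_composite E (t0', t1', g') (s0', s1', f') (w0', w1', h')"
  shows "same_triple E (w0, w1, h) (w0', w1', h')"
proof -
  have xs: "pts E s0 = pts E s0'" "pts E s1 = pts E s1'"
    "\<And>z. z \<in> pts E s1 \<Longrightarrow> ap E s1 f z = ap E s1' f' z"
    using xx same_triple_iff[OF x x'] by auto
  have ys: "pts E t0 = pts E t0'" "pts E t1 = pts E t1'"
    "\<And>z. z \<in> pts E t1 \<Longrightarrow> ap E t1 g z = ap E t1' g' z"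
    using yy same_triple_iff[OF y y'] by auto
  obtain v where c: "w0 \<in> D" "pts E v = {z \<in> pts E s1. ap E s1 f z \<in> pts E t0}" "is_union E s0 v w0"
      "pts E w1 = {z \<in> pts E s1. ap E s1 f z \<in> pts E t1}"
      "\<And>z. z \<in> pts E w1 \<Longrightarrow> ap E w1 h z = ap E t1 g (ap E s1 f z)"
    by (rule compositeE[OF x y w]) blast
  obtain v' where c': "w0' \<in> D" "v' \<in> D" "pts E v' = {z \<in> pts E s1'. ap E s1' f' z \<in> pts E t0'}"
    "is_union E s0' v' w0'"
      "pts E w1' = {z \<in> pts E s1'. ap E s1' f' z \<in> pts E t1'}"
      "\<And>z. z \<in> pts E w1' \<Longrightarrow> ap E w1' h' z = ap E t1' g' (ap E s1' f' z)"
    by (rule compositeE[OF x' y' w']) blast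
  have "pts E v = pts E v'"
    using c(2) c'(3) xs ys by auto
  then have "is_union E s0' v' w0"
    by (intro is_union_same[OF c(3)]) (use c'(2) c(1) xs tripleD(2)[OF x'] in simp_all)
  then have "pts E w0 = pts E w0'"
    using is_union_unique c'(4) by blast
  moreover have w1: "pts E w1 = pts E w1'"
    using c(4) c'(5) xs ys by auto
  moreover have "ap E w1 h z = ap E w1' h' z" if "z \<in> pts E w1" for z
    using that c(4) c(5)[of z] c'(6)[of z] w1 xs ys by auto
  ultimately show ?thesis
    using same_triple_iff[OF composite_triple[OF x y w] composite_triple[OF x' y' w']] by simp
qed

text \<open>\<open>Comp\<close> of \<open>DisPar\<close> returns the set of all composites of
  members of two classes. Together with \<open>composite_same\<close> this shows that the set is a
  full class under change of representatives.\<close>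

lemma composite_of_same:
  assumes x: "(s0, s1, f) \<in> triples E D Z" and y: "(t0, t1, g) \<in> triples E D Z"
    and w: "is_composite E (t0, t1, g) (s0, s1, f) (w0, w1, h)"
    and w't: "(w0', w1', h') \<in> triples E D Z" and ww: "same_triple E (w0, w1, h) (w0', w1', h')"
  shows "is_composite E (t0, t1, g) (s0, s1, f) (w0', w1', h')"
proof -
  note W = tripleD[OF w't]
  obtain v where c: "Cod E f = Cod E t1" "v \<in> D" "Cod E v = Cod E s1"
      "pts E v = {z \<in> pts E s1. ap E s1 f z \<in> pts E t0}" "is_union E s0 v w0"
      "pts E w1 = {z \<in> pts E s1. ap E s1 f z \<in> pts E t1}"
      "\<And>z. z \<in> pts E w1 \<Longrightarrow> ap E w1 h z = ap E t1 g (ap E s1 f z)"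
    by (rule compositeE[OF x y w]) blast
  have ws: "pts E w0 = pts E w0'" "pts E w1 = pts E w1'"
    "\<And>z. z \<in> pts E w1 \<Longrightarrow> ap E w1 h z = ap E w1' h' z"
    using ww same_triple_iff[OF composite_triple[OF x y w] w't] by auto
  have "is_union E s0 v w0'"
    by (rule is_union_same[OF c(5)]) (use ws W c(5) in \<open>simp_all add: is_union_pts\<close>)
  then show ?thesis
    unfolding is_composite_iff[OF x y] composite_pts_def prod.case using c ws W by auto
qed

end

section \<open>The stable category\<close>

context compatible
begin

abbreviation \<S> where "\<S> \<equiv> same_rel E D Z"
abbreviation \<R> where "\<R> \<equiv> stab_rel E zero D Z"
abbreviation St where "St \<equiv> Stab E zero D T F"

definition cls :: "'m triple \<Rightarrow> 'm triple set set" where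
  "cls x = \<R> `` {\<S> `` {x}}"

text \<open>This is \<open>\<sigma>\<close> on arrows (\<open>stab_functor_simps\<close>), written
  as a class so that composites with it can be computed before the functor is considered.\<close>

definition sg :: "'m \<Rightarrow> 'm triple set set" where
  "sg f = cls (from_initial E zero (Dom E f), Ident E (Dom E f), f)"

lemma same_rel_iff: "(x, y) \<in> \<S> \<longleftrightarrow> x \<in> triples E D Z \<and> y \<in> triples E D Z \<and> same_triple E x y"
  by (auto simp: same_rel_def)

lemma same_refl: "x \<in> triples E D Z \<Longrightarrow> same_triple E x x"
  by (cases x) (simp add: same_triple_iff)

lemma same_sym:
  "x \<in> triples E D Z \<Longrightarrow> y \<in> triples E D Z \<Longrightarrow> same_triple E x y \<Longrightarrow> same_triple E y x"
  by (cases x; cases y) (simp add: same_triple_iff)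

lemma same_trans:
  "x \<in> triples E D Z \<Longrightarrow> y \<in> triples E D Z \<Longrightarrow> w \<in> triples E D Z \<Longrightarrow> same_triple E x y \<Longrightarrow>
    same_triple E y w \<Longrightarrow> same_triple E x w"
  by (cases x; cases y; cases w) (simp add: same_triple_iff)

lemma same_class_iff:
  "x \<in> triples E D Z \<Longrightarrow> y \<in> triples E D Z \<Longrightarrow> \<S> `` {x} = \<S> `` {y} \<longleftrightarrow> same_triple E x y"
proof -
  assume x: "x \<in> triples E D Z" and y: "y \<in> triples E D Z"
  have "same_triple E x w \<longleftrightarrow> same_triple E y w" if "same_triple E x y" "w \<in> triples E D Z" for w
    using same_trans[OF x y that(2) that(1)] same_trans[OF y x that(2) same_sym[OF x y that(1)]]
      by blast
  then have "\<S> `` {x} = \<S> `` {y}" if "same_triple E x y"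
    using that x y by (intro set_eqI) (simp only: Image_singleton_iff same_rel_iff, blast)
  moreover have "same_triple E x y" if "\<S> `` {x} = \<S> `` {y}"
  proof -
    have "y \<in> \<S> `` {y}"
      using y same_refl by (simp only: Image_singleton_iff same_rel_iff)
    then have "y \<in> \<S> `` {x}"
      using that by simp
    then show ?thesis
      by (simp only: Image_singleton_iff same_rel_iff)
  qed
  ultimately show ?thesis
    by blast
qed

lemma image_singletonI: "a \<in> A \<Longrightarrow> (\<And>x. x \<in> A \<Longrightarrow> f x = c) \<Longrightarrow> f ` A = {c}"
  by (auto intro!: image_eqI[of c f a])

lemma DisPar_arr: "Arr (DisPar E zero D Z) = (\<lambda>x. \<S> `` {x}) ` triples E D Z"
  by (auto simp: DisPar_def quotient_def)

lemma stab_rel_iff: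
  assumes "x \<in> triples E D Z" "y \<in> triples E D Z"
  shows "(\<S> `` {x}, \<S> `` {y}) \<in> \<R> \<longleftrightarrow> eqv x y"
proof
  assume "(\<S> `` {x}, \<S> `` {y}) \<in> \<R>"
  then obtain x' y' where *: "(x, x') \<in> \<S>" "(y, y') \<in> \<S>" "equivalent_triples E D Z x' y'"
    unfolding stab_rel_def by auto
  have t: "x' \<in> triples E D Z" "y' \<in> triples E D Z"
    using * by (auto simp: same_rel_iff)
  then have "eqv x' y'"
    using *(3) equivalent_triples_iff by (cases x'; cases y') simp
  moreover have "eqv x x'" "eqv y' y"
    using * same_eqv eqv_sym by (auto simp: same_rel_iff)
  ultimately show "eqv x y"
    using eqv_trans assms t by meson
next
  assume "eqv x y"
  then have "equivalent_triples E D Z x y"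
    using assms equivalent_triples_iff by (cases x; cases y) simp
  moreover have "x \<in> \<S> `` {x}" "y \<in> \<S> `` {y}"
    using assms same_refl by (auto simp: same_rel_iff)
  ultimately show "(\<S> `` {x}, \<S> `` {y}) \<in> \<R>"
    unfolding stab_rel_def DisPar_arr using assms by blast
qed

lemma cls_mem:
  assumes "x \<in> triples E D Z"
  shows "\<alpha> \<in> cls x \<longleftrightarrow> (\<exists>y\<in>triples E D Z. eqv x y \<and> \<alpha> = \<S> `` {y})"
proof
  assume "\<alpha> \<in> cls x"
  then have *: "(\<S> `` {x}, \<alpha>) \<in> \<R>"
    by (simp add: cls_def)
  then have "\<alpha> \<in> Arr (DisPar E zero D Z)"
    by (simp add: stab_rel_def)
  then obtain y where "y \<in> triples E D Z" "\<alpha> = \<S> `` {y}"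
    unfolding DisPar_arr by blast
  then show "\<exists>y\<in>triples E D Z. eqv x y \<and> \<alpha> = \<S> `` {y}"
    using * stab_rel_iff assms by blast
next
  assume "\<exists>y\<in>triples E D Z. eqv x y \<and> \<alpha> = \<S> `` {y}"
  then show "\<alpha> \<in> cls x"
    unfolding cls_def Image_singleton_iff using stab_rel_iff[OF assms] by blast
qed

lemma cls_eq:
  assumes "x \<in> triples E D Z" "y \<in> triples E D Z"
  shows "cls x = cls y \<longleftrightarrow> eqv x y"
proof
  assume "cls x = cls y"
  moreover have "\<S> `` {y} \<in> cls y"
    using cls_mem assms eqv_refl by blast
  ultimately obtain y' where "y' \<in> triples E D Z" "eqv x y'" "\<S> `` {y} = \<S> `` {y'}"
    using cls_mem assms by blast
  moreover from this have "eqv y' y"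
    using same_class_iff assms same_eqv eqv_sym by blast
  ultimately show "eqv x y"
    using eqv_trans assms by blast
next
  have sub: "cls x \<subseteq> cls y" if xy: "x \<in> triples E D Z" "y \<in> triples E D Z" "eqv x y" for x y
  proof
    fix \<alpha> assume "\<alpha> \<in> cls x"
    then obtain r where r: "r \<in> triples E D Z" "eqv x r" "\<alpha> = \<S> `` {r}"
      unfolding cls_mem[OF xy(1)] by blast
    then have "eqv y r"
      using eqv_trans[OF xy(2,1) r(1) eqv_sym[OF xy(3)]] by blast
    then show "\<alpha> \<in> cls y"
      unfolding cls_mem[OF xy(2)] using r by blast
  qed
  assume "eqv x y"
  then show "cls x = cls y"
    using sub[OF assms] sub[OF assms(2,1) eqv_sym] by blast
qed

lemma Stab_Obj [simp]: "Obj St = Obj E"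
  by (simp add: Stab_def quotient_cat_def DisPar_def)

lemma Stab_Arr: "Arr St = cls ` triples E D Z"
  by (auto simp: Stab_def quotient_cat_def quotient_def DisPar_arr cls_def)

lemma Stab_arrE:
  assumes "\<alpha> \<in> Arr St"
  obtains s0 s1 f where "(s0, s1, f) \<in> triples E D Z" "\<alpha> = cls (s0, s1, f)"
  using assms unfolding Stab_Arr by auto

lemma DisPar_Dom:
  assumes "(s0, s1, f) \<in> triples E D Z"
  shows "Dom (DisPar E zero D Z) (\<S> `` {(s0, s1, f)}) = Cod E s1"
    "Cod (DisPar E zero D Z) (\<S> `` {(s0, s1, f)}) = Cod E f"
proof -
  have self: "(s0, s1, f) \<in> \<S> `` {(s0, s1, f)}"
    using assms same_refl by (simp only: Image_singleton_iff same_rel_iff)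
  have eq: "(\<lambda>(s0, s1, f). Cod E s1) y = Cod E s1" "(\<lambda>(s0, s1, f). Cod E f) y = Cod E f"
    if "y \<in> \<S> `` {(s0, s1, f)}" for y
  proof -
    obtain t0 t1 g where y: "y = (t0, t1, g)" by (cases y)
    have "(t0, t1, g) \<in> triples E D Z" "same_triple E (s0, s1, f) (t0, t1, g)"
      using that unfolding y Image_singleton_iff same_rel_iff by blast+
    then show "(\<lambda>(s0, s1, f). Cod E s1) y = Cod E s1" "(\<lambda>(s0, s1, f). Cod E f) y = Cod E f"
      unfolding y prod.case using same_triple_cod[OF assms, of t0 t1 g] by simp_all
  qed
  have "(\<lambda>(s0, s1, f). Cod E s1) ` (\<S> `` {(s0, s1, f)}) = {Cod E s1}"
    "(\<lambda>(s0, s1, f). Cod E f) ` (\<S> `` {(s0, s1, f)}) = {Cod E f}"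
    by (rule image_singletonI[OF self], rule eq, assumption)+
  then show "Dom (DisPar E zero D Z) (\<S> `` {(s0, s1, f)}) = Cod E s1"
    "Cod (DisPar E zero D Z) (\<S> `` {(s0, s1, f)}) = Cod E f"
    unfolding DisPar_def by simp_all
qed

lemma Stab_Dom:
  assumes "(s0, s1, f) \<in> triples E D Z"
  shows "Dom St (cls (s0, s1, f)) = Cod E s1" "Cod St (cls (s0, s1, f)) = Cod E f"
proof -
  have self: "\<S> `` {(s0, s1, f)} \<in> cls (s0, s1, f)"
    using cls_mem assms eqv_refl by blast
  have "Dom (DisPar E zero D Z) \<alpha> = Cod E s1 \<and> Cod (DisPar E zero D Z) \<alpha> = Cod E f"
    if mem: "\<alpha> \<in> cls (s0, s1, f)" for \<alpha>
  proof -
    obtain y where y: "y \<in> triples E D Z" "eqv (s0, s1, f) y" "\<alpha> = \<S> `` {y}"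
      using mem cls_mem[OF assms] by blast
    obtain t0 t1 g where ys: "y = (t0, t1, g)" by (cases y)
    note t = y[unfolded ys]
    then show ?thesis
      using DisPar_Dom[OF t(1)] by (auto simp: eqv_def eqv_on_def)
  qed
  then have "Dom (DisPar E zero D Z) ` cls (s0, s1, f) = {Cod E s1}"
    "Cod (DisPar E zero D Z) ` cls (s0, s1, f) = {Cod E f}"
    by (intro image_singletonI[OF self]; blast)+
  then show "Dom St (cls (s0, s1, f)) = Cod E s1" "Cod St (cls (s0, s1, f)) = Cod E f"
    by (simp_all add: Stab_def quotient_cat_def)
qed

lemma DisPar_Comp:
  assumes x: "(s0, s1, f) \<in> triples E D Z" and y: "(t0, t1, g) \<in> triples E D Z"
    and w: "is_composite E (t0, t1, g) (s0, s1, f) (w0, w1, h)"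
  shows "Comp (DisPar E zero D Z) (\<S> `` {(t0, t1, g)}) (\<S> `` {(s0, s1, f)}) = \<S> `` {(w0, w1, h)}"
proof (intro set_eqI iffI)
  fix r assume "r \<in> Comp (DisPar E zero D Z) (\<S> `` {(t0, t1, g)}) (\<S> `` {(s0, s1, f)})"
  then obtain x' y' where *: "((t0, t1, g), y') \<in> \<S>" "((s0, s1, f), x') \<in> \<S>"
    "is_composite E y' x' r"
    by (auto simp: DisPar_def)
  obtain s0' s1' f' where xs: "x' = (s0', s1', f')" by (cases x')
  obtain t0' t1' g' where ys: "y' = (t0', t1', g')" by (cases y')
  obtain r0 r1 k where rs: "r = (r0, r1, k)" by (cases r)
  have t: "(s0', s1', f') \<in> triples E D Z" "(t0', t1', g') \<in> triples E D Z"
    "same_triple E (s0, s1, f) (s0', s1', f')" "same_triple E (t0, t1, g) (t0', t1', g')"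
    using * xs ys by (auto simp: same_rel_iff)
  have c: "is_composite E (t0', t1', g') (s0', s1', f') (r0, r1, k)"
    using * xs ys rs by simp
  show "r \<in> \<S> `` {(w0, w1, h)}"
    using composite_same[OF x y t w c] composite_triple[OF x y w] composite_triple[OF t(1,2) c] rs
    by (simp add: same_rel_iff)
next
  fix r assume r: "r \<in> \<S> `` {(w0, w1, h)}"
  obtain r0 r1 k where rs: "r = (r0, r1, k)" by (cases r)
  have "is_composite E (t0, t1, g) (s0, s1, f) r"
    unfolding rs by (rule composite_of_same[OF x y w]) (use r rs in \<open>simp_all add: same_rel_iff\<close>)
  then
  show "r \<in> Comp (DisPar E zero D Z) (\<S> `` {(t0, t1, g)}) (\<S> `` {(s0, s1, f)})"
  proof -
    have "(t0, t1, g) \<in> \<S> `` {(t0, t1, g)}" "(s0, s1, f) \<in> \<S> `` {(s0, s1, f)}"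
      using x y same_refl by (simp_all only: Image_singleton_iff same_rel_iff)
    then have "r \<in> {w. \<exists>y\<in>\<S> `` {(t0, t1, g)}. \<exists>x\<in>\<S> `` {(s0, s1, f)}. is_composite E y x w}"
      using \<open>is_composite E (t0, t1, g) (s0, s1, f) r\<close> by blast
    then show ?thesis
      by (simp only: DisPar_def cat.select_convs)
  qed
qed

text \<open>The quotient composes all pairs of representatives and saturates the result. By
  \<open>composite_eqv\<close> everything obtained lies in a single class, and the given composite
  is among it.\<close>

lemma Stab_Comp:
  assumes x: "(s0, s1, f) \<in> triples E D Z" and y: "(t0, t1, g) \<in> triples E D Z"
    and w: "is_composite E (t0, t1, g) (s0, s1, f) (w0, w1, h)"
  shows "Comp St (cls (t0, t1, g)) (cls (s0, s1, f)) = cls (w0, w1, h)"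
proof -
  let ?P = "{Comp (DisPar E zero D Z) \<beta> \<alpha> | \<alpha> \<beta>. \<alpha> \<in> cls (s0, s1, f) \<and> \<beta> \<in> cls (t0, t1, g)}"
  have wt: "(w0, w1, h) \<in> triples E D Z"
    by (rule composite_triple[OF x y w])
  have comp: "Cod E f = Cod E t1"
    by (rule compositeE[OF x y w]) blast
  have 1: "\<exists>r\<in>triples E D Z. eqv (w0, w1, h) r \<and> \<gamma> = \<S> `` {r}" if mem: "\<gamma> \<in> ?P" for \<gamma>
  proof -
    obtain x' y' where xy: "x' \<in> triples E D Z" "y' \<in> triples E D Z"
      "eqv (s0, s1, f) x'" "eqv (t0, t1, g) y'"
      "\<gamma> = Comp (DisPar E zero D Z) (\<S> `` {y'}) (\<S> `` {x'})"
      using mem unfolding mem_Collect_eq cls_mem[OF x] cls_mem[OF y] by blast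
    obtain s0' s1' f' where xs: "x' = (s0', s1', f')" by (cases x')
    obtain t0' t1' g' where ys: "y' = (t0', t1', g')" by (cases y')
    note p = xy[unfolded xs ys]
    have "Cod E f' = Cod E t1'"
      using p(3,4) comp by (auto simp: eqv_def eqv_on_def)
    then obtain r0 r1 k where r: "is_composite E (t0', t1', g') (s0', s1', f') (r0, r1, k)"
      using composite_exists[OF p(1,2)] by (metis prod_cases3)
    then show ?thesis
      using composite_eqv[OF x y p(1-4) w r] composite_triple[OF p(1,2) r] DisPar_Comp[OF p(1,2) r]
        p(5)
      by blast
  qed
  have 2: "\<S> `` {(w0, w1, h)} \<in> ?P"
  proof -
    have "\<S> `` {(s0, s1, f)} \<in> cls (s0, s1, f)" "\<S> `` {(t0, t1, g)} \<in> cls (t0, t1, g)"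
      using cls_mem x y eqv_refl by blast+
    then show ?thesis
      using DisPar_Comp[OF x y w] by blast
  qed
  have "\<R> `` ?P = cls (w0, w1, h)"
  proof (intro set_eqI iffI)
    fix \<alpha> assume "\<alpha> \<in> \<R> `` ?P"
    then obtain \<gamma> where \<gamma>: "\<gamma> \<in> ?P" "(\<gamma>, \<alpha>) \<in> \<R>"
      by (rule ImageE)
    then obtain r where r: "r \<in> triples E D Z" "eqv (w0, w1, h) r" "\<gamma> = \<S> `` {r}"
      using 1[OF \<gamma>(1)] by blast
    with \<gamma>(2) have "\<alpha> \<in> cls r"
      by (simp only: cls_def Image_singleton_iff)
    then show "\<alpha> \<in> cls (w0, w1, h)"
      using cls_eq[OF wt r(1)] r(2) by simp
  next
    fix \<alpha> assume "\<alpha> \<in> cls (w0, w1, h)"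
    then have "(\<S> `` {(w0, w1, h)}, \<alpha>) \<in> \<R>"
      by (simp only: cls_def Image_singleton_iff)
    then show "\<alpha> \<in> \<R> `` ?P"
      using 2 by (rule ImageI)
  qed
  then show ?thesis
    by (simp add: Stab_def quotient_cat_def)
qed

text \<open>The domain of a partial map may shrink without change of class as long as the map is
  trivial on what replaces it; the cover of the smaller triple is itself the comparison
  cover.\<close>

lemma eqv_restrict:
  assumes x: "(s0, s1, f) \<in> triples E D Z" and y: "(t0, t1, g) \<in> triples E D Z"
    and "Cod E s1 = Cod E t1" "pts E s1 \<subseteq> pts E t1" "\<And>z. z \<in> pts E s1 \<Longrightarrow> ap E s1 f z = ap E t1 g z"
    "\<And>z. z \<in> pts E s0 \<Longrightarrow> z \<in> pts E t1 \<Longrightarrow> ap E t1 g z \<in> Z"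
  shows "eqv (s0, s1, f) (t0, t1, g)"
proof (rule eqvI[of _ _ _ _ s0 s1])
  note X = tripleD[OF x] and Y = tripleD[OF y]
  have "s1 \<in> pts E s1" "s1 \<in> pts E t1"
    using X assms(4) pts_self[of s1] by auto
  then have "f = ap E t1 g s1" "Cod E (ap E t1 g s1) = Cod E g"
    using X(3,5,6) Y(3,5,6) assms(5)[of s1] by simp_all
  then show "Cod E f = Cod E g"
    by simp
  show "covers (Cod E s1) s0 s1" by (rule X)
  show "\<And>z. z \<in> pts E s0 \<Longrightarrow> z \<in> pts E s1 \<Longrightarrow> ap E s1 f z \<in> Z" by (rule X)
qed (use assms in auto)

text \<open>The triviality of \<open>g\<close> on \<open>s0\<close> that \<open>eqv_restrict\<close>
  demands is inherited from \<open>f\<close>, so a class is determined by the partial map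
  \<open>(s1, f)\<close>. Most equations in the stable category are proved through this.\<close>

lemma cls_eqI:
  assumes x: "(s0, s1, f) \<in> triples E D Z" and y: "(t0, t1, g) \<in> triples E D Z"
    and "pts E s1 = pts E t1" "\<And>z. z \<in> pts E s1 \<Longrightarrow> ap E s1 f z = ap E t1 g z"
  shows "cls (s0, s1, f) = cls (t0, t1, g)"
proof -
  have "Cod E s1 = Cod E t1"
    using pts_eq_cod[of s1 t1] tripleD[OF x] assms(3) by simp
  moreover have "ap E t1 g z \<in> Z" if "z \<in> pts E s0" "z \<in> pts E t1" for z
    using tripleD(7)[OF x that(1)] that(2) assms(3) assms(4)[of z] by simp
  ultimately show ?thesis
    using cls_eq[OF x y] eqv_restrict[OF x y] assms(3,4) by simp
qed

lemma comp_cls: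
  assumes x: "(s0, s1, f) \<in> triples E D Z" and y: "(t0, t1, g) \<in> triples E D Z"
    and cod: "Cod E f = Cod E t1"
  obtains w0 w1 h where "(w0, w1, h) \<in> triples E D Z"
    "Comp St (cls (t0, t1, g)) (cls (s0, s1, f)) = cls (w0, w1, h)"
    "Cod E w1 = Cod E s1" "Cod E h = Cod E g" "pts E w1 = {z \<in> pts E s1. ap E s1 f z \<in> pts E t1}"
    "\<And>z. z \<in> pts E w1 \<Longrightarrow> ap E w1 h z = ap E t1 g (ap E s1 f z)"
proof -
  obtain w0 w1 h where w: "is_composite E (t0, t1, g) (s0, s1, f) (w0, w1, h)"
    using composite_exists[OF x y cod] by (metis prod_cases3)
  have "Cod E w1 = Cod E s1" "Cod E h = Cod E g" "pts E w1 = {z \<in> pts E s1. ap E s1 f z \<in> pts E t1}"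
    "\<And>z. z \<in> pts E w1 \<Longrightarrow> ap E w1 h z = ap E t1 g (ap E s1 f z)"
    by (rule compositeE[OF x y w]; blast)+
  then show thesis
    using that[OF composite_triple[OF x y w] Stab_Comp[OF x y w]] by blast
qed

lemma comp_cls_eqI:
  assumes x: "(s0, s1, f) \<in> triples E D Z" and y: "(t0, t1, g) \<in> triples E D Z"
    and r: "(r0, r1, k) \<in> triples E D Z" and cod: "Cod E f = Cod E t1"
    and "pts E r1 = {z \<in> pts E s1. ap E s1 f z \<in> pts E t1}"
    "\<And>z. z \<in> pts E r1 \<Longrightarrow> ap E r1 k z = ap E t1 g (ap E s1 f z)"
  shows "Comp St (cls (t0, t1, g)) (cls (s0, s1, f)) = cls (r0, r1, k)"
proof -
  obtain w0 w1 h where w: "(w0, w1, h) \<in> triples E D Z"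
    "Comp St (cls (t0, t1, g)) (cls (s0, s1, f)) = cls (w0, w1, h)"
    "pts E w1 = {z \<in> pts E s1. ap E s1 f z \<in> pts E t1}"
    "\<And>z. z \<in> pts E w1 \<Longrightarrow> ap E w1 h z = ap E t1 g (ap E s1 f z)"
    by (rule comp_cls[OF x y cod]) blast
  have "cls (w0, w1, h) = cls (r0, r1, k)"
    by (rule cls_eqI[OF w(1) r]) (use w(3,4) assms(5,6) in simp_all)
  then show ?thesis
    using w(2) by simp
qed

section \<open>Total morphisms in the stable category, and the category laws\<close>

lemma sg_triple:
  assumes "f \<in> Arr E"
  shows "(from_initial E zero (Dom E f), Ident E (Dom E f), f) \<in> triples E D Z"
  unfolding triples_iff
proof (intro conjI ballI)
  fix z assume z: "z \<in> pts E (from_initial E zero (Dom E f)) \<inter> pts E (Ident E (Dom E f))"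
  then have "z \<in> Z" "z \<in> Arr E" "Cod E z = Dom E f"
    using pts_zero_trivial[of "Dom E f" z] assms by auto
  then show "ap E (Ident E (Dom E f)) f z \<in> Z"
    using Z_comp_left[of z f] assms by simp
qed (use assms covers_zero in simp_all)

lemma Stab_Ident: "A \<in> Obj E \<Longrightarrow> Ident St A = sg (Ident E A)"
  by (simp add: Stab_def quotient_cat_def DisPar_def sg_def cls_def)

lemma sg_simps:
  assumes "f \<in> Arr E"
  shows "sg f \<in> Arr St" "Dom St (sg f) = Dom E f" "Cod St (sg f) = Cod E f"
  using sg_triple[OF assms] Stab_Dom[OF sg_triple[OF assms]] assms unfolding sg_def Stab_Arr by auto

lemma cls_arr: "x \<in> triples E D Z \<Longrightarrow> cls x \<in> Arr St"
  by (simp add: Stab_Arr)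

lemma sg_comp_cls:
  assumes x: "(s0, s1, f) \<in> triples E D Z" and k: "k \<in> Arr E" "Dom E k = Cod E f"
  shows "(s0, s1, k \<cdot> f) \<in> triples E D Z" "Comp St (sg k) (cls (s0, s1, f)) = cls (s0, s1, k \<cdot> f)"
proof -
  note X = tripleD[OF x]
  have ap: "ap E s1 (k \<cdot> f) z = k \<cdot> ap E s1 f z" if "z \<in> pts E s1" for z
    using that X k by (simp add: ap_def assoc)
  show t: "(s0, s1, k \<cdot> f) \<in> triples E D Z"
    unfolding triples_iff using X k ap Z_comp_left by simp
  show "Comp St (sg k) (cls (s0, s1, f)) = cls (s0, s1, k \<cdot> f)"
    unfolding sg_def by (rule comp_cls_eqI[OF x sg_triple t]) (use X k ap in auto)
qed

lemma cls_comp_sg: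
  assumes x: "(s0, s1, f) \<in> triples E D Z" and k: "k \<in> Arr E" "Cod E k = Cod E s1"
  obtains w0 w1 h where "(w0, w1, h) \<in> triples E D Z"
    "Comp St (cls (s0, s1, f)) (sg k) = cls (w0, w1, h)" "Cod E w1 = Dom E k" "Cod E h = Cod E f"
    "pts E w1 = {z \<in> Arr E. Cod E z = Dom E k \<and> k \<cdot> z \<in> pts E s1}"
    "\<And>z. z \<in> pts E w1 \<Longrightarrow> ap E w1 h z = ap E s1 f (k \<cdot> z)"
proof -
  obtain w0 w1 h where w: "(w0, w1, h) \<in> triples E D Z"
    "Comp St (cls (s0, s1, f)) (sg k) = cls (w0, w1, h)"
    "Cod E w1 = Cod E (Ident E (Dom E k))" "Cod E h = Cod E f"
    "pts E w1 = {z \<in> pts E (Ident E (Dom E k)). ap E (Ident E (Dom E k)) k z \<in> pts E s1}"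
    "\<And>z. z \<in> pts E w1 \<Longrightarrow> ap E w1 h z = ap E s1 f (ap E (Ident E (Dom E k)) k z)"
    unfolding sg_def by (rule comp_cls[OF sg_triple[OF k(1)] x k(2)]) blast
  have p: "pts E w1 = {z \<in> Arr E. Cod E z = Dom E k \<and> k \<cdot> z \<in> pts E s1}"
    unfolding w(5) using k(1) by auto
  show thesis
    by (rule that[OF w(1,2) _ w(4) p]) (use w(3,6) p k in auto)
qed

lemma sg_comp:
  assumes "f \<in> Arr E" "g \<in> Arr E" "Cod E f = Dom E g"
  shows "Comp St (sg g) (sg f) = sg (g \<cdot> f)"
  using sg_comp_cls(2)[OF sg_triple[OF assms(1)] assms(2)] assms by (simp add: sg_def)

lemma Stab_category: "category St"
proof
  fix \<alpha> assume "\<alpha> \<in> Arr St"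
  then obtain s0 s1 f where x: "(s0, s1, f) \<in> triples E D Z" "\<alpha> = cls (s0, s1, f)"
    by (rule Stab_arrE)
  then show "Dom St \<alpha> \<in> Obj St" "Cod St \<alpha> \<in> Obj St"
    using Stab_Dom[OF x(1)] tripleD[OF x(1)] by simp_all
next
  fix A assume "A \<in> Obj St"
  then show "Ident St A \<in> hom St A A"
    using Stab_Ident[of A] sg_simps[of "Ident E A"] by (simp add: hom_def)
next
  fix \<alpha> A B assume "\<alpha> \<in> hom St A B"
  then obtain s0 s1 f where x: "(s0, s1, f) \<in> triples E D Z" "\<alpha> = cls (s0, s1, f)" "Dom St \<alpha> = A"
    "Cod St \<alpha> = B"
    unfolding hom_def using Stab_arrE by blast
  note X = tripleD[OF x(1)]
  have AB: "A = Cod E s1" "B = Cod E f"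
    using Stab_Dom[OF x(1)] x by simp_all
  show "Comp St \<alpha> (Ident St A) = \<alpha>"
    unfolding x(2) Stab_Ident[OF X(8), folded AB(1)] sg_def
    by (rule comp_cls_eqI[OF sg_triple x(1) x(1)]) (use AB X pts_arr pts_cod in auto)
  show "Comp St (Ident St B) \<alpha> = \<alpha>"
    using sg_comp_cls(2)[OF x(1), of "Ident E B"] Stab_Ident[of B] X x(2) AB by simp
next
  fix \<alpha> A B \<beta> B' assume "\<alpha> \<in> hom St A B" "\<beta> \<in> hom St B B'"
  then obtain s0 s1 f t0 t1 g where x: "(s0, s1, f) \<in> triples E D Z" "\<alpha> = cls (s0, s1, f)"
    "(t0, t1, g) \<in> triples E D Z" "\<beta> = cls (t0, t1, g)" "Dom St \<alpha> = A" "Cod St \<alpha> = B" "Dom St \<beta> = B"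
    "Cod St \<beta> = B'"
    unfolding hom_def mem_Collect_eq by (elim conjE Stab_arrE) blast
  then have "Cod E f = Cod E t1"
    using Stab_Dom[OF x(1)] Stab_Dom[OF x(3)] by simp
  then obtain w0 w1 h where w: "(w0, w1, h) \<in> triples E D Z"
    "Comp St (cls (t0, t1, g)) (cls (s0, s1, f)) = cls (w0, w1, h)" "Cod E w1 = Cod E s1"
    "Cod E h = Cod E g"
    by (rule comp_cls[OF x(1,3)]) blast
  then show "Comp St \<beta> \<alpha> \<in> hom St A B'"
    using Stab_Dom[OF w(1)] cls_arr[OF w(1)] Stab_Dom[OF x(1)] Stab_Dom[OF x(3)] x
      by (simp add: hom_def)
next
  fix \<alpha> A B \<beta> B' \<gamma> B'' assume "\<alpha> \<in> hom St A B" "\<beta> \<in> hom St B B'" "\<gamma> \<in> hom St B' B''"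
  then obtain s0 s1 f t0 t1 g r0 r1 k where x: "(s0, s1, f) \<in> triples E D Z" "\<alpha> = cls (s0, s1, f)"
    "(t0, t1, g) \<in> triples E D Z" "\<beta> = cls (t0, t1, g)" "(r0, r1, k) \<in> triples E D Z"
    "\<gamma> = cls (r0, r1, k)"
    and dc: "Cod St \<alpha> = B" "Dom St \<beta> = B" "Cod St \<beta> = B'" "Dom St \<gamma> = B'"
    unfolding hom_def mem_Collect_eq by (elim conjE Stab_arrE) blast
  have cod: "Cod E f = Cod E t1" "Cod E g = Cod E r1"
    using Stab_Dom[OF x(1)] Stab_Dom[OF x(3)] Stab_Dom[OF x(5)] dc x by simp_all
  obtain w0 w1 h where w: "(w0, w1, h) \<in> triples E D Z"
    "Comp St (cls (t0, t1, g)) (cls (s0, s1, f)) = cls (w0, w1, h)" "Cod E w1 = Cod E s1"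
    "Cod E h = Cod E g"
    "pts E w1 = {z \<in> pts E s1. ap E s1 f z \<in> pts E t1}"
    "\<And>z. z \<in> pts E w1 \<Longrightarrow> ap E w1 h z = ap E t1 g (ap E s1 f z)"
    by (rule comp_cls[OF x(1,3) cod(1)]) blast
  obtain v0 v1 l where v: "(v0, v1, l) \<in> triples E D Z"
    "Comp St (cls (r0, r1, k)) (cls (t0, t1, g)) = cls (v0, v1, l)" "Cod E v1 = Cod E t1"
    "Cod E l = Cod E k"
    "pts E v1 = {z \<in> pts E t1. ap E t1 g z \<in> pts E r1}"
    "\<And>z. z \<in> pts E v1 \<Longrightarrow> ap E v1 l z = ap E r1 k (ap E t1 g z)"
    by (rule comp_cls[OF x(3,5) cod(2)]) blast
  have "Cod E h = Cod E r1"
    using w cod by simp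
  then obtain q0 q1 m where q: "(q0, q1, m) \<in> triples E D Z"
    "Comp St (cls (r0, r1, k)) (cls (w0, w1, h)) = cls (q0, q1, m)"
    "pts E q1 = {z \<in> pts E w1. ap E w1 h z \<in> pts E r1}"
    "\<And>z. z \<in> pts E q1 \<Longrightarrow> ap E q1 m z = ap E r1 k (ap E w1 h z)"
    by (rule comp_cls[OF w(1) x(5)]) blast
  \<comment> \<open>Both bracketings have the same partial map: the threefold composite, defined
    where every successive value lies in the next domain.\<close>
  have "Comp St (cls (v0, v1, l)) (cls (s0, s1, f)) = cls (q0, q1, m)"
    by (rule comp_cls_eqI[OF x(1) v(1) q(1)]) (use cod v(3,5,6) w(5,6) q(3,4) in auto)
  then show "Comp St \<gamma> (Comp St \<beta> \<alpha>) = Comp St (Comp St \<gamma> \<beta>) \<alpha>"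
    using x w v q by simp
qed

end

section \<open>The torsion theory on the stable category\<close>

context torsion_theory
begin

text \<open>Converse of \<open>trivial_zero\<close>. A trivial object exists, since the composite of
  a canonical sequence factors through one; it is a zero object, hence isomorphic to
  \<open>A\<close>, and \<open>T\<close> and \<open>F\<close> are closed under isomorphism.\<close>

lemma zero_obj_trivial:
  assumes "zero_obj C A" shows "A \<in> T \<inter> F"
proof -
  have A: "A \<in> Obj C"
    using assms by (simp add: zero_obj_def initial_obj_def)
  obtain k q where "canonical_seq C T F A k q"
    using PT2[OF A] by blast
  from canonicalD(8)[OF this] obtain g :: 'b and h where "g \<in> Arr C" "Cod C g \<in> T \<inter> F"
    by (rule factoring_E) blast
  then obtain N where N: "N \<in> T \<inter> F" "N \<in> Obj C"
    by auto
  then have "zero_obj C N"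
    using trivial_zero by blast
  then have init: "initial_obj C A" "initial_obj C N"
    using assms by (auto simp: zero_obj_def)
  then obtain a b where ab: "a \<in> hom C A N" "b \<in> hom C N A"
    using A N unfolding initial_obj_def by blast
  have "a \<cdot> b \<in> hom C N N" "Ident C N \<in> hom C N N" "b \<cdot> a \<in> hom C A A" "Ident C A \<in> hom C A A"
    using ab A N by auto
  then have "a \<cdot> b = Ident C N" "b \<cdot> a = Ident C A"
    using init A N unfolding initial_obj_def by blast+
  then have "is_iso C b"
    by (intro isoI[of b a]) (use ab in auto)
  then show ?thesis
    using T_iso[of b] F_iso[of b] ab N by simp
qed

lemma zero_arr_iff: "zero_arr C f \<longleftrightarrow> f \<in> trivials C T F"
proof -
  have "{z. zero_obj C z} = T \<inter> F"
    using zero_obj_trivial trivial_zero by blast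
  then show ?thesis
    by simp
qed

end

section \<open>Trivial arrows, torsion and torsion free objects of the stable category\<close>

context compatible
begin

interpretation St: category St
  by (rule Stab_category)

text \<open>Triviality of the representing arrow is an invariant of the class: on \<open>u1\<close>
  the arrow has the values of \<open>g\<close>, on \<open>u0\<close> it is trivial by the
  congruence, and triviality is local.\<close>

lemma eqv_Z:
  assumes x: "(s0, s1, f) \<in> triples E D Z" and "eqv (s0, s1, f) (t0, t1, g)"
    and "\<And>z. z \<in> pts E t1 \<Longrightarrow> ap E t1 g z \<in> Z"
  shows "f \<in> Z"
proof -
  note X = tripleD[OF x]
  obtain u0 u1 where u: "eqv_on u0 u1 (s0, s1, f) (t0, t1, g)"
    using assms(2) by (rule eqvE)
  note u = eqv_onD(3,5,6,7)[OF u]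
  have "ap E s1 f s1 \<in> Z"
    by (rule covers_ap_Z[OF u(1) X(3) refl X(5,6)]) (use X u assms(3) in auto)
  then show ?thesis
    using X by simp
qed

text \<open>This makes triviality in the stable category a question about \<open>E\<close>. A
  trivial \<open>f\<close> splits through a trivial object inside \<open>E\<close>, with the same
  two subobjects; the converse combines CC1 with \<open>eqv_Z\<close>.\<close>

lemma trivial_cls:
  assumes x: "(s0, s1, f) \<in> triples E D Z"
  shows "cls (s0, s1, f) \<in> trivials St T F \<longleftrightarrow> f \<in> Z"
proof
  note X = tripleD[OF x]
  assume "f \<in> Z"
  then obtain g h where gh: "g \<in> Arr E" "h \<in> Arr E" "Cod E g = Dom E h" "Cod E g \<in> T \<inter> F"
    "f = h \<cdot> g"
    and "Dom E g = Dom E f"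
    by (rule factoring_E) blast
  then have g: "g \<in> Arr E" "Cod E g \<in> T \<inter> F" "Dom E g = Dom E s1"
    using X(6) by simp_all
  have "ap E s1 g z \<in> Z" if "z \<in> pts E s1" for z
    using factoring_cod[of "ap E s1 g z" "T \<inter> F"] that g X(3) by simp
  then have t: "(s0, s1, g) \<in> triples E D Z"
    unfolding triples_iff using X(1-4) g by simp
  have "Comp St (sg h) (cls (s0, s1, g)) = cls (s0, s1, f)"
    using sg_comp_cls(2)[OF t, of h] gh by simp
  moreover have "Comp St (sg h) (cls (s0, s1, g)) \<in> trivials St T F"
    by (rule St.factoring_I) (use cls_arr[OF t] sg_simps[OF gh(2)] Stab_Dom[OF t] gh in simp_all)
  ultimately show "cls (s0, s1, f) \<in> trivials St T F"
    by simp
next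
  assume "cls (s0, s1, f) \<in> trivials St T F"
  then obtain \<alpha> \<beta> where ab: "\<alpha> \<in> Arr St" "\<beta> \<in> Arr St" "Cod St \<alpha> = Dom St \<beta>" "Cod St \<alpha> \<in> T \<inter> F"
    "cls (s0, s1, f) = Comp St \<beta> \<alpha>"
    by (rule St.factoring_E) blast
  obtain a0 a1 a where a: "(a0, a1, a) \<in> triples E D Z" "\<alpha> = cls (a0, a1, a)"
    using ab(1) by (rule Stab_arrE)
  obtain b0 b1 b where b: "(b0, b1, b) \<in> triples E D Z" "\<beta> = cls (b0, b1, b)"
    using ab(2) by (rule Stab_arrE)
  note A = tripleD[OF a(1)] and B = tripleD[OF b(1)]
  have cod: "Cod E a = Cod E b1" "Cod E b1 \<in> T \<inter> F"
    using ab(3,4) Stab_Dom[OF a(1)] Stab_Dom[OF b(1)] a(2) b(2) by simp_all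
  obtain w0 w1 h where w: "(w0, w1, h) \<in> triples E D Z"
    "Comp St (cls (b0, b1, b)) (cls (a0, a1, a)) = cls (w0, w1, h)"
    "pts E w1 = {z \<in> pts E a1. ap E a1 a z \<in> pts E b1}"
    "\<And>z. z \<in> pts E w1 \<Longrightarrow> ap E w1 h z = ap E b1 b (ap E a1 a z)"
    by (rule comp_cls[OF a(1) b(1) cod(1)]) blast
  \<comment> \<open>Values of the composite pass through the domain of \<open>b1\<close>, a
    distinguished subobject of the trivial object \<open>Cod E b1\<close>.\<close>
  have "ap E w1 h z \<in> Z" if "z \<in> pts E w1" for z
  proof -
    have z: "z \<in> pts E a1" "ap E a1 a z \<in> pts E b1"
      using that w(3) by auto
    have "b \<cdot> fac E b1 (ap E a1 a z) \<in> Z"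
      by (rule factoring_I) (use z B CC1[OF B(3) cod(2)] in simp_all)
    then show ?thesis
      using w(4)[OF that] by (simp add: ap_def)
  qed
  moreover have "eqv (s0, s1, f) (w0, w1, h)"
    using cls_eq[OF x w(1)] ab(5) a b w(2) by simp
  ultimately show "f \<in> Z"
    using eqv_Z[OF x] by blast
qed

text \<open>The comparison cover is the whole object as zero part together with \<open>zero\<close>:
  equality is asked only on \<open>zero\<close>, where parallel arrows coincide, and triviality
  holds everywhere.\<close>

lemma zero_cls_eq:
  assumes x: "(s0, s1, f) \<in> triples E D Z" and y: "(t0, t1, g) \<in> triples E D Z"
    and "Cod E s1 = Cod E t1" "Cod E f = Cod E g" "f \<in> Z" "g \<in> Z"
  shows "cls (s0, s1, f) = cls (t0, t1, g)"
proof -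
  note X = tripleD[OF x] and Y = tripleD[OF y]
  let ?A = "Cod E s1"
  let ?i = "from_initial E zero ?A"
  note I = zero_hom[OF X(8)]
  have in_all: "?i \<in> pts E s" if "s \<in> D" "Cod E s = ?A" for s
  proof -
    have d: "Dom E s \<in> Obj E"
      using that by simp
    have "s \<cdot> from_initial E zero (Dom E s) = ?i"
      using I(4)[of "s \<cdot> from_initial E zero (Dom E s)"] zero_hom[OF d] that by simp
    then show ?thesis
      using pts_I[of s "from_initial E zero (Dom E s)"] zero_hom[OF d] that by simp
  qed
  have apz: "ap E s h z \<in> Z" if "h \<in> Z" "s \<in> D" "Dom E h = Dom E s" "z \<in> pts E s" for h s z
    unfolding ap_def using that by (intro Z_comp_right) simp_all
  have "eqv (s0, s1, f) (t0, t1, g)"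
  proof (rule eqvI[of _ _ _ _ "Ident E ?A" ?i])
    show "covers ?A (Ident E ?A) ?i"
      using covers_zero[OF X(8)] by (rule covers_sym)
    show "pts E ?i \<subseteq> pts E s1" "pts E ?i \<subseteq> pts E t1"
      using in_all[of s1] in_all[of t1] pts_le_iff[of ?i] I(1) X Y assms(3) by simp_all
    show "ap E s1 f z = ap E t1 g z" if z: "z \<in> pts E ?i" for z
    proof -
      have "fac E s1 ?i \<in> Arr E" "fac E t1 ?i \<in> Arr E" "ap E s1 f ?i \<in> Arr E" "ap E t1 g ?i \<in> Arr E"
        "Dom E (ap E s1 f ?i) = zero" "Dom E (ap E t1 g ?i) = zero"
        "Cod E (ap E s1 f ?i) = Cod E f" "Cod E (ap E t1 g ?i) = Cod E f"
        using in_all[of s1] in_all[of t1] I X Y assms(3,4) by simp_all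
      then have "ap E s1 f ?i = ap E t1 g ?i"
        using zero_hom(4)[OF X(9)] by metis
      moreover have "ap E s1 f (?i \<cdot> fac E ?i z) = ap E s1 f ?i \<cdot> fac E ?i z"
        by (rule ap_comp) (use in_all[of s1] X(2-6) z I(1,2) in simp_all)
      moreover have "ap E t1 g (?i \<cdot> fac E ?i z) = ap E t1 g ?i \<cdot> fac E ?i z"
        by (rule ap_comp) (use in_all[of t1] Y(2-6) z I(1,2) assms(3) in simp_all)
      ultimately have "ap E s1 f (?i \<cdot> fac E ?i z) = ap E t1 g (?i \<cdot> fac E ?i z)"
        by (simp only:)
      then show ?thesis
        using z I(1) by simp
    qed
  qed (use assms X Y apz in simp_all)
  then show ?thesis
    using cls_eq[OF x y] by simp
qed

text \<open>Represents the zero arrow from \<open>A\<close> to \<open>B\<close>, with the initial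
  subobject as its domain and all of \<open>A\<close> as its zero part.\<close>

lemma zero_triple:
  assumes "A \<in> Obj E" "B \<in> Obj E"
  shows "(Ident E A, from_initial E zero A, from_initial E zero B) \<in> triples E D Z"
    "from_initial E zero B \<in> Z"
proof -
  note I = zero_hom[OF assms(1)] zero_hom[OF assms(2)]
  show "from_initial E zero B \<in> Z"
    using factoring_dom[of "from_initial E zero B" "T \<inter> F"] I zero_trivial by simp
  then have "ap E (from_initial E zero A) (from_initial E zero B) z \<in> Z"
    if "z \<in> pts E (from_initial E zero A)" for z
    unfolding ap_def using that I by (intro Z_comp_right) simp_all
  then show "(Ident E A, from_initial E zero A, from_initial E zero B) \<in> triples E D Z"
    unfolding triples_iff using I covers_sym[OF covers_zero[OF assms(1)]] by simp
qed

lemma trivial_zero_Stab: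
  assumes "N \<in> T \<inter> F" shows "zero_obj St N"
proof -
  have N: "N \<in> Obj E"
    using assms T_obj by auto
  have "\<exists>!\<alpha>. \<alpha> \<in> hom St A B" if "A \<in> Obj E" "B \<in> Obj E" "A = N \<or> B = N" for A B
  proof (rule ex_ex1I)
    show "\<exists>\<alpha>. \<alpha> \<in> hom St A B"
      using cls_arr[OF zero_triple(1)[OF that(1,2)]] Stab_Dom[OF zero_triple(1)[OF that(1,2)]]
        zero_hom that by auto
    fix \<alpha> \<beta> assume "\<alpha> \<in> hom St A B" "\<beta> \<in> hom St A B"
    then have h: "\<alpha> \<in> Arr St" "Dom St \<alpha> = A" "Cod St \<alpha> = B" "\<beta> \<in> Arr St" "Dom St \<beta> = A"
      "Cod St \<beta> = B"
      by auto
    \<comment> \<open>Either \<open>Cod E f\<close> is the trivial object, or \<open>Dom E f\<close>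
      is a distinguished subobject of it and so trivial by CC1.\<close>
    have Z: "f \<in> Z" if "(s0, s1, f) \<in> triples E D Z" "Cod E s1 = A" "Cod E f = B" for s0 s1 f
      using tripleD[OF that(1)] that(2,3) \<open>A = N \<or> B = N\<close> assms CC1[of s1]
        factoring_dom[of f "T \<inter> F"] factoring_cod[of f "T \<inter> F"] by auto
    obtain s0 s1 f where s: "(s0, s1, f) \<in> triples E D Z" "\<alpha> = cls (s0, s1, f)"
      using h(1) by (rule Stab_arrE)
    obtain t0 t1 g where t: "(t0, t1, g) \<in> triples E D Z" "\<beta> = cls (t0, t1, g)"
      using h(4) by (rule Stab_arrE)
    show "\<alpha> = \<beta>"
      unfolding s(2) t(2)
      by (rule zero_cls_eq[OF s(1) t(1)])
        (use s t h Stab_Dom[OF s(1)] Stab_Dom[OF t(1)] Z[OF s(1)] Z[OF t(1)] in simp_all)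
  qed
  then show ?thesis
    unfolding zero_obj_def initial_obj_def terminal_obj_def using N by simp
qed

text \<open>The unit of a torsion object is trivial, and cancelling it makes the identity of its
  torsion free quotient trivial, hence that quotient too. CC3 and CC1 pass this to the quotient of
  \<open>Dom E s\<close>, whose unit is then trivial.\<close>

lemma D_torsion:
  assumes s: "s \<in> D" and "Cod E s \<in> T"
  shows "Dom E s \<in> T"
proof -
  note P = phi_props[of s]
  obtain k where k: "canonical_seq E T F (Cod E s) k (\<eta> (Cod E s))"
    using eta_canonical s by (meson D_simps(2) obj_simps(2))
  note K = canonicalD[OF k]
  obtain k' where k': "canonical_seq E T F (Dom E s) k' (\<eta> (Dom E s))"
    using eta_canonical s by (meson D_simps(2) obj_simps(1))
  have "\<eta> (Cod E s) \<in> Z"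
    by (rule unit_trivial[OF k assms(2)])
  then have "Ident E (Cod E (\<eta> (Cod E s))) \<cdot> \<eta> (Cod E s) \<in> Z"
    using K by simp
  then have "Ident E (Cod E (\<eta> (Cod E s))) \<in> Z"
    by (rule Z_cancel_unit[OF k, rotated 2]) (use K in simp_all)
  then have "Cod E (\<eta> (Cod E s)) \<in> T \<inter> F"
    using trivial_if_ident_trivial K by simp
  then have "Cod E (\<eta> (Dom E s)) \<in> T \<inter> F"
    using CC1[OF CC3[OF s]] P s by simp
  then have "\<eta> (Dom E s) \<in> Z"
    using factoring_cod[of "\<eta> (Dom E s)" "T \<inter> F"] canonicalD[OF k'] by simp
  then show ?thesis
    by (rule torsion_if_unit_trivial[OF k'])
qed

text \<open>The counit of \<open>Dom E s\<close> becomes trivial after \<open>s\<close> by PT1, and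
  distinguished monomorphisms reflect triviality.\<close>

lemma D_torsion_free:
  assumes s: "s \<in> D" and "Cod E s \<in> F"
  shows "Dom E s \<in> F"
proof -
  obtain k where k: "canonical_seq E T F (Dom E s) k (\<eta> (Dom E s))"
    using eta_canonical s by (meson D_simps(2) obj_simps(1))
  note K = canonicalD[OF k]
  have "s \<cdot> k \<in> Z"
    by (rule PT1[of "Dom E k" "Cod E s"]) (use K s assms(2) in simp_all)
  then have "k \<in> Z"
    by (rule D_reflects_Z[OF s, rotated 2]) (use K in simp_all)
  then show ?thesis
    by (rule torsion_free_if_counit_trivial(1)[OF k])
qed

text \<open>A one-sided inverse in the stable category is a genuine one in \<open>E\<close> on a
  member of a cover. The other member is a trivial arrow, being the restriction to it of the
  identity.\<close>

lemma section_local: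
  assumes x: "(s0, s1, f) \<in> triples E D Z" and y: "(t0, t1, g) \<in> triples E D Z"
    and cod: "Cod E f = Cod E t1" "Cod E g = Cod E s1"
    and eq: "Comp St (cls (t0, t1, g)) (cls (s0, s1, f)) = Ident St (Cod E s1)"
  obtains u0 u1 where "covers (Cod E s1) u0 u1" "u0 \<in> Z"
    "\<And>z. z \<in> pts E u1 \<Longrightarrow> z \<in> pts E s1" "\<And>z. z \<in> pts E u1 \<Longrightarrow> ap E s1 f z \<in> pts E t1"
    "\<And>z. z \<in> pts E u1 \<Longrightarrow> ap E t1 g (ap E s1 f z) = z"
proof -
  note X = tripleD[OF x] and Y = tripleD[OF y]
  obtain w0 w1 h where w: "(w0, w1, h) \<in> triples E D Z"
    "Comp St (cls (t0, t1, g)) (cls (s0, s1, f)) = cls (w0, w1, h)"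
    "Cod E w1 = Cod E s1"
    "pts E w1 = {z \<in> pts E s1. ap E s1 f z \<in> pts E t1}"
    "\<And>z. z \<in> pts E w1 \<Longrightarrow> ap E w1 h z = ap E t1 g (ap E s1 f z)"
    by (rule comp_cls[OF x y cod(1)]) blast
  let ?I = "Ident E (Cod E s1)"
  have it: "(from_initial E zero (Cod E s1), ?I, ?I) \<in> triples E D Z"
    using sg_triple[of ?I] X by simp
  have "cls (w0, w1, h) = cls (from_initial E zero (Cod E s1), ?I, ?I)"
    using eq w(2) Stab_Ident[OF X(8)] X by (simp add: sg_def)
  then have "eqv (w0, w1, h) (from_initial E zero (Cod E s1), ?I, ?I)"
    using cls_eq[OF w(1) it] by simp
  then obtain u0 u1 where u: "eqv_on u0 u1 (w0, w1, h) (from_initial E zero (Cod E s1), ?I, ?I)"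
    by (rule eqvE)
  note u = eqv_onD(3,4,6,8)[OF u]
  note U = coversD[OF u(1)]
  have "u0 \<in> Z"
    using u(4)[of u0] U w(3) X by simp
  moreover have "ap E t1 g (ap E s1 f z) = z" if "z \<in> pts E u1" for z
    using u(2) u(3)[OF that] w(5)[of z] that U w(3) X pts_arr[OF that] pts_cod[OF that] by auto
  ultimately show thesis
    using that[of u0 u1] u(1,2) w(3,4) by auto
qed

text \<open>The unit of the codomain is shown to be trivial on the cover from
  \<open>section_local\<close>. On \<open>u0\<close> the elements are trivial; those of
  \<open>u1\<close> are values of \<open>f\<close>, whose domain is torsion by
  \<open>D_torsion\<close>, so PT1 applies.\<close>

lemma Stab_T_iso:
  assumes "is_iso St \<alpha>" "Dom St \<alpha> \<in> T"
  shows "Cod St \<alpha> \<in> T"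
proof -
  from assms(1) obtain \<beta> where ab: "\<alpha> \<in> Arr St" "\<beta> \<in> Arr St" "Dom St \<beta> = Cod St \<alpha>"
    "Cod St \<beta> = Dom St \<alpha>"
    "Comp St \<alpha> \<beta> = Ident St (Cod St \<alpha>)"
    by (rule St.isoE)
  obtain s0 s1 f where s: "(s0, s1, f) \<in> triples E D Z" "\<alpha> = cls (s0, s1, f)"
    using ab(1) by (rule Stab_arrE)
  obtain t0 t1 g where t: "(t0, t1, g) \<in> triples E D Z" "\<beta> = cls (t0, t1, g)"
    using ab(2) by (rule Stab_arrE)
  note X = tripleD[OF s(1)] and Y = tripleD[OF t(1)]
  have dc: "Cod E g = Cod E s1" "Cod E f = Cod E t1" "Cod E s1 \<in> T" "Cod St \<alpha> = Cod E t1"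
    using ab(3,4) assms(2) Stab_Dom[OF s(1)] Stab_Dom[OF t(1)] s(2) t(2) by simp_all
  let ?B = "Cod E t1"
  obtain u0 u1 where u: "covers ?B u0 u1" "u0 \<in> Z"
    "\<And>z. z \<in> pts E u1 \<Longrightarrow> z \<in> pts E t1" "\<And>z. z \<in> pts E u1 \<Longrightarrow> ap E t1 g z \<in> pts E s1"
    "\<And>z. z \<in> pts E u1 \<Longrightarrow> ap E s1 f (ap E t1 g z) = z"
    by (rule section_local[OF t(1) s(1) dc(1,2)]) (use ab(5) dc(4) s(2) t(2) in auto)
  note U = coversD[OF u(1)]
  obtain k where k: "canonical_seq E T F ?B k (\<eta> ?B)"
    using eta_canonical Y(8) by blast
  have "Dom E s1 \<in> T"
    using D_torsion[OF X(3) dc(3)] .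
  then have Zf: "\<eta> ?B \<cdot> f \<in> Z"
    by (rule PT1[of _ "Cod E (\<eta> ?B)"]) (use X Y(8) dc in simp_all)
  have "\<eta> ?B \<in> Z"
  proof (rule covers_local_Z[OF u(1), of "Ident E ?B"])
    fix z assume z: "z \<in> Arr E" "Cod E z = Dom E (Ident E ?B)"
    show "\<eta> ?B \<cdot> z \<in> Z" if "Ident E ?B \<cdot> z \<in> pts E u0"
    proof -
      have zu: "z \<in> pts E u0"
        using that z Y(8) by simp
      have "u0 \<cdot> fac E u0 z \<in> Z"
        using u(2) by (rule Z_comp_right) (use zu U in simp_all)
      then have "z \<in> Z"
        using zu U by simp
      then show ?thesis
        by (rule Z_comp_left) (use z Y(8) in simp_all)
    qed
    show "\<eta> ?B \<cdot> z \<in> Z" if "Ident E ?B \<cdot> z \<in> pts E u1"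
    proof -
      have zu: "z \<in> pts E u1"
        using that z Y(8) by simp
      have "(\<eta> ?B \<cdot> f) \<cdot> fac E s1 (ap E t1 g z) \<in> Z"
        using Zf by (rule Z_comp_right) (use u(4)[OF zu] X Y(8) dc in simp_all)
      moreover have "(\<eta> ?B \<cdot> f) \<cdot> fac E s1 (ap E t1 g z) = \<eta> ?B \<cdot> ap E s1 f (ap E t1 g z)"
        unfolding ap_def[of E s1 f] by (rule assoc) (use u(4)[OF zu] X Y(8) dc in simp_all)
      ultimately show ?thesis
        using u(5)[OF zu] by simp
    qed
  qed (use Y(8) in simp_all)
  then show ?thesis
    using torsion_if_unit_trivial[OF k] dc(4) by simp
qed

text \<open>Here the counit \<open>k\<close> of the codomain is shown to be trivial. On the part
  \<open>a\<close> of its domain that \<open>k\<close> sends into \<open>t1\<close>, composition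
  with \<open>g\<close> goes from a torsion object to a torsion free one; \<open>f\<close> preserves
  triviality and restores the element.\<close>

lemma Stab_F_iso:
  assumes "is_iso St \<alpha>" "Dom St \<alpha> \<in> F"
  shows "Cod St \<alpha> \<in> F"
proof -
  from assms(1) obtain \<beta> where ab: "\<alpha> \<in> Arr St" "\<beta> \<in> Arr St" "Dom St \<beta> = Cod St \<alpha>"
    "Cod St \<beta> = Dom St \<alpha>"
    "Comp St \<alpha> \<beta> = Ident St (Cod St \<alpha>)"
    by (rule St.isoE)
  obtain s0 s1 f where s: "(s0, s1, f) \<in> triples E D Z" "\<alpha> = cls (s0, s1, f)"
    using ab(1) by (rule Stab_arrE)
  obtain t0 t1 g where t: "(t0, t1, g) \<in> triples E D Z" "\<beta> = cls (t0, t1, g)"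
    using ab(2) by (rule Stab_arrE)
  note X = tripleD[OF s(1)] and Y = tripleD[OF t(1)]
  have dc: "Cod E g = Cod E s1" "Cod E f = Cod E t1" "Cod E s1 \<in> F" "Cod St \<alpha> = Cod E t1"
    using ab(3,4) assms(2) Stab_Dom[OF s(1)] Stab_Dom[OF t(1)] s(2) t(2) by simp_all
  let ?B = "Cod E t1"
  obtain u0 u1 where u: "covers ?B u0 u1" "u0 \<in> Z"
    "\<And>z. z \<in> pts E u1 \<Longrightarrow> z \<in> pts E t1" "\<And>z. z \<in> pts E u1 \<Longrightarrow> ap E t1 g z \<in> pts E s1"
    "\<And>z. z \<in> pts E u1 \<Longrightarrow> ap E s1 f (ap E t1 g z) = z"
    by (rule section_local[OF t(1) s(1) dc(1,2)]) (use ab(5) dc(4) s(2) t(2) in auto)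
  note U = coversD[OF u(1)]
  obtain k where k: "canonical_seq E T F ?B k (\<eta> ?B)"
    using eta_canonical Y(8) by blast
  note K = canonicalD[OF k]
  obtain a q where a: "a \<in> D" "is_pullback E k t1 a q"
    using CS3[of t1 k] K Y by auto
  note P = pullbackD[OF a(2)] pullback_pts[OF a(2) D_simps(1)[OF Y(3)]]
  have "Dom E a \<in> T"
    using D_torsion[OF a(1)] P K by simp
  then have gq: "g \<cdot> q \<in> Z"
    by (rule PT1[of _ "Cod E g"]) (use P(1-8) Y dc in simp_all)
  have "k \<in> Z"
  proof (rule covers_local_Z[OF u(1), of k])
    fix x assume x: "x \<in> Arr E" "Cod E x = Dom E k"
    show "k \<cdot> x \<in> Z" if zu: "k \<cdot> x \<in> pts E u0"
    proof -
      have "u0 \<cdot> fac E u0 (k \<cdot> x) \<in> Z"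
        using u(2) by (rule Z_comp_right) (use zu U in simp_all)
      then show "k \<cdot> x \<in> Z"
        using zu U by simp
    qed
    show "k \<cdot> x \<in> Z" if zu: "k \<cdot> x \<in> pts E u1"
    proof -
      have xa: "x \<in> pts E a"
        using P(11) x u(3)[OF zu] by simp
      have "(g \<cdot> q) \<cdot> fac E a x \<in> Z"
        using gq by (rule Z_comp_right) (use P(1-8) xa a Y in simp_all)
      moreover have "(g \<cdot> q) \<cdot> fac E a x = g \<cdot> (q \<cdot> fac E a x)"
        by (rule assoc) (use P(1-8) xa a Y in simp_all)
      ultimately have "ap E t1 g (k \<cdot> x) \<in> Z"
        using P(12)[OF xa] by (simp add: ap_def)
      then have "ap E s1 f (ap E t1 g (k \<cdot> x)) \<in> Z"
        using ap_Z[of s1 "ap E t1 g (k \<cdot> x)" f] X u(4)[OF zu] by simp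
      then show ?thesis
        using u(5)[OF zu] by simp
    qed
  qed (use K in simp_all)
  then show ?thesis
    using torsion_free_if_counit_trivial(1)[OF k] dc(4) by simp
qed

lemma Stab_PT1:
  assumes "A \<in> T" "B \<in> F" "\<alpha> \<in> hom St A B"
  shows "\<alpha> \<in> trivials St T F"
proof -
  obtain s0 s1 f where s: "(s0, s1, f) \<in> triples E D Z" "\<alpha> = cls (s0, s1, f)"
    using assms(3) by (auto elim: Stab_arrE)
  note X = tripleD[OF s(1)]
  have "Cod E s1 = A" "Cod E f = B"
    using Stab_Dom[OF s(1)] assms(3) s(2) by auto
  then have "f \<in> Z"
    using PT1[of "Dom E s1" B f] D_torsion[OF X(3)] X assms by simp
  then show ?thesis
    using trivial_cls[OF s(1)] s(2) by simp
qed

end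

section \<open>Torsion free quotients of distinguished subobjects\<close>

context compatible
begin

interpretation St: category St
  by (rule Stab_category)

text \<open>Axiom CC4 for the identity of \<open>\<phi> A\<close>.\<close>

lemma eta_dense:
  assumes "A \<in> Obj E" "r \<in> D" "Cod E r = Cod E (\<eta> A)" "\<eta> A \<in> pts E r"
  shows "Ident E (Cod E (\<eta> A)) \<in> pts E r"
proof -
  let ?I = "Ident E (Cod E (\<eta> A))"
  have "is_pullback E (\<eta> A) ?I (Ident E A) (fac E ?I (\<eta> A \<cdot> Ident E A))"
  proof (rule pullbackI)
    show "pts E (Ident E A) = {z \<in> Arr E. Cod E z = Dom E (\<eta> A) \<and> \<eta> A \<cdot> z \<in> pts E ?I}"
      using assms(1) by auto
  qed (use assms(1) mono_ident in simp_all)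
  moreover have "fac E ?I (\<eta> A \<cdot> Ident E A) = \<eta> A"
    using assms(1) by simp
  ultimately have "is_pullback E (\<eta> A) ?I (Ident E A) (\<eta> A)"
    by simp
  then have "distinguished_epi E D (\<eta> A)"
    by (rule CC4[OF assms(1), rotated]) (use CS1_ident assms(1) in simp)
  moreover have "fac E r (\<eta> A) \<in> hom E (Dom E (\<eta> A)) (Dom E r)" "r \<cdot> fac E r (\<eta> A) = \<eta> A"
    using assms by simp_all
  ultimately have "is_iso E r"
    unfolding distinguished_epi_def using assms by blast
  then obtain i where "i \<in> Arr E" "Cod E i = Dom E r" "r \<cdot> i = Ident E (Cod E r)"
    by (rule isoE) blast
  then show ?thesis
    using pts_I[of r i] assms by simp
qed

lemma phi_pts:
  assumes s: "s \<in> D" and z: "z \<in> pts E s"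
  shows "\<phi> s \<cdot> (\<eta> (Dom E s) \<cdot> fac E s z) = \<eta> (Cod E s) \<cdot> z" "\<eta> (Cod E s) \<cdot> z \<in> pts E (\<phi> s)"
    "fac E (\<phi> s) (\<eta> (Cod E s) \<cdot> z) = \<eta> (Dom E s) \<cdot> fac E s z"
proof -
  note P = phi_props[of s]
  have obj: "Dom E s \<in> Obj E" "Cod E s \<in> Obj E"
    using s by simp_all
  have "\<phi> s \<cdot> (\<eta> (Dom E s) \<cdot> fac E s z) = (\<phi> s \<cdot> \<eta> (Dom E s)) \<cdot> fac E s z"
    using P(1-3) s z obj by (simp add: assoc)
  also have "\<dots> = (\<eta> (Cod E s) \<cdot> s) \<cdot> fac E s z"
    using P(4) s by simp
  also have "\<dots> = \<eta> (Cod E s) \<cdot> z"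
    using s z obj by (simp add: assoc)
  finally show 1: "\<phi> s \<cdot> (\<eta> (Dom E s) \<cdot> fac E s z) = \<eta> (Cod E s) \<cdot> z" .
  have 2: "\<eta> (Dom E s) \<cdot> fac E s z \<in> Arr E" "Cod E (\<eta> (Dom E s) \<cdot> fac E s z) = Dom E (\<phi> s)"
    using P(1-3) s z obj by simp_all
  show "\<eta> (Cod E s) \<cdot> z \<in> pts E (\<phi> s)"
    unfolding 1[symmetric] by (rule pts_I) (use P(1) s 2 in simp_all)
  show "fac E (\<phi> s) (\<eta> (Cod E s) \<cdot> z) = \<eta> (Dom E s) \<cdot> fac E s z"
    by (rule fac_unique) (use CC3[OF s] 1 2 in simp_all)
qed

lemma phi_D:
  assumes "s \<in> D"
  shows "\<phi> s \<in> D" "Dom E (\<phi> s) = Cod E (\<eta> (Dom E s))" "Cod E (\<phi> s) = Cod E (\<eta> (Cod E s))"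
    "\<phi> s \<cdot> \<eta> (Dom E s) = \<eta> (Cod E s) \<cdot> s"
  using CC3[OF assms] phi_props[of s] assms by simp_all

text \<open>A distinguished subobject is the inverse image of its torsion free quotient: the comparison
  \<open>i\<close> with that inverse image is inverted by \<open>\<phi>\<close>, so that CC5 applies.\<close>

lemma pts_phi:
  assumes s: "s \<in> D"
  shows "pts E s = {z \<in> Arr E. Cod E z = Cod E s \<and> \<eta> (Cod E s) \<cdot> z \<in> pts E (\<phi> s)}"
proof -
  let ?A = "Cod E s"
  note P = phi_D[OF s]
  have obj: "Dom E s \<in> Obj E" "?A \<in> Obj E"
    using s by simp_all
  obtain p v where p: "p \<in> D" "is_pullback E (\<eta> ?A) (\<phi> s) p v"
    using CS3[OF P(1), of "\<eta> ?A"] P obj by auto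
  note B = pullbackD[OF p(2)] pullback_pts[OF p(2) D_simps(1)[OF P(1)]]
  have pc: "Cod E p = ?A" and vc: "Cod E v = Cod E (\<eta> (Dom E s))"
    using B(5,6) P obj by simp_all
  have sp: "s \<in> pts E p"
    using B(11) phi_pts(2)[OF s, of s] s obj by simp
  let ?i = "fac E p s"
  have i: "?i \<in> Arr E" "Dom E ?i = Dom E s" "Cod E ?i = Dom E p" "p \<cdot> ?i = s"
    using sp p by simp_all
  have iD: "?i \<in> D"
    by (rule D_cancel[of p]) (use i p s in simp_all)
  have objp: "Dom E p \<in> Obj E"
    using p by simp
  note Pp = phi_D[OF p(1)] and Pi = phi_D[OF iD]
  obtain kp where kp: "canonical_seq E T F (Dom E p) kp (\<eta> (Dom E p))"
    using eta_canonical[OF objp] by blast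
  \<comment> \<open>\<open>v'\<close> is the candidate inverse of \<open>\<phi> ?i\<close>: the
    projection \<open>v\<close> of the pullback has torsion free codomain and so descends along the
    unit of \<open>Dom E p\<close>.\<close>
  obtain v' where v': "v' \<in> Arr E" "Dom E v' = Cod E (\<eta> (Dom E p))" "Cod E v' = Cod E v"
    "v' \<cdot> \<eta> (Dom E p) = v"
  proof (rule unit_factor[OF kp, of v])
    show "Cod E v \<in> F"
      using vc obj by simp
  qed (use B(4,7) in simp_all)
  have "\<phi> s \<cdot> (v \<cdot> ?i) = (\<eta> ?A \<cdot> p) \<cdot> ?i"
    using B(1-9) i P by (simp add: assoc)
  also have "\<dots> = \<phi> s \<cdot> \<eta> (Dom E s)"
    using B(1-8) i P obj by (simp add: assoc)
  finally have "v \<cdot> ?i = \<eta> (Dom E s)"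
    by (rule monoD[OF D_simps(1)[OF P(1)]]) (use B(1-8) i P obj vc in simp_all)
  have "(v' \<cdot> \<phi> ?i) \<cdot> \<eta> (Dom E s) = v' \<cdot> (\<phi> ?i \<cdot> \<eta> (Dom E s))"
    by (rule assoc) (use v' Pi i obj in simp_all)
  also have "\<dots> = v' \<cdot> (\<eta> (Dom E p) \<cdot> ?i)"
    using Pi(4) i by simp
  also have "\<dots> = (v' \<cdot> \<eta> (Dom E p)) \<cdot> ?i"
    by (rule assoc[symmetric]) (use v' i objp in simp_all)
  also have "\<dots> = Ident E (Cod E (\<eta> (Dom E s))) \<cdot> \<eta> (Dom E s)"
    using v'(4) \<open>v \<cdot> ?i = \<eta> (Dom E s)\<close> obj by simp
  finally have a: "v' \<cdot> \<phi> ?i = Ident E (Cod E (\<eta> (Dom E s)))"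
    by (rule epiD[OF eta_simps(5)[OF obj(1)]]) (use v' Pi i vc obj in simp_all)
  have "\<phi> p \<cdot> \<phi> ?i = \<phi> s"
  proof (rule epiD[OF eta_simps(5)[OF obj(1)]])
    have "(\<phi> p \<cdot> \<phi> ?i) \<cdot> \<eta> (Dom E s) = \<phi> p \<cdot> (\<phi> ?i \<cdot> \<eta> (Dom E s))"
      by (rule assoc) (use Pp Pi i obj in simp_all)
    also have "\<dots> = \<phi> p \<cdot> (\<eta> (Dom E p) \<cdot> ?i)"
      using Pi(4) i by simp
    also have "\<dots> = (\<phi> p \<cdot> \<eta> (Dom E p)) \<cdot> ?i"
      by (rule assoc[symmetric]) (use Pp i objp in simp_all)
    also have "\<dots> = (\<eta> ?A \<cdot> p) \<cdot> ?i"
      using Pp(4) pc by simp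
    also have "\<dots> = \<phi> s \<cdot> \<eta> (Dom E s)"
      using i P p pc obj by (simp add: assoc)
    finally show "(\<phi> p \<cdot> \<phi> ?i) \<cdot> \<eta> (Dom E s) = \<phi> s \<cdot> \<eta> (Dom E s)" .
  qed (use Pp Pi P i pc obj in simp_all)
  have "(\<phi> p \<cdot> (\<phi> ?i \<cdot> v')) \<cdot> \<eta> (Dom E p) = (\<phi> p \<cdot> \<phi> ?i) \<cdot> (v' \<cdot> \<eta> (Dom E p))"
    using Pp Pi v'(1-3) vc i objp by (simp add: assoc del: v'(4))
  also have "\<dots> = \<phi> s \<cdot> v"
    using \<open>\<phi> p \<cdot> \<phi> ?i = \<phi> s\<close> v'(4) by simp
  also have "\<dots> = \<phi> p \<cdot> \<eta> (Dom E p)"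
    using B(9) Pp(4) pc by simp
  finally have "\<phi> p \<cdot> (\<phi> ?i \<cdot> v') = \<phi> p"
    by (rule epiD[OF eta_simps(5)[OF objp]]) (use Pp Pi v' vc i objp in simp_all)
  then have "\<phi> p \<cdot> (\<phi> ?i \<cdot> v') = \<phi> p \<cdot> Ident E (Dom E (\<phi> p))"
    using Pp by simp
  then have b: "\<phi> ?i \<cdot> v' = Ident E (Dom E (\<phi> p))"
    by (rule monoD[OF D_simps(1)[OF Pp(1)]]) (use Pp Pi v' vc i objp in simp_all)
  have "is_iso E (\<phi> ?i)"
    by (rule isoI[of _ v']) (use a b Pi Pp v' vc i in simp_all)
  then have "is_iso E ?i"
    by (rule CC5[OF iD])
  then obtain j where j: "j \<in> Arr E" "Dom E j = Cod E ?i" "Cod E j = Dom E ?i"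
    "?i \<cdot> j = Ident E (Cod E ?i)"
    by (rule isoE) blast
  have "p = (p \<cdot> ?i) \<cdot> j"
    using j i(1-3) p(1) by (simp add: assoc del: fac_simps(4))
  then have "p = s \<cdot> j"
    using i(4) by simp
  then have "p \<in> pts E s"
    using pts_I[of s j] s j i by simp
  then have "pts E s = pts E p"
    using sp pts_le_iff[of s p] pts_le_iff[of p s] s p by auto
  then show ?thesis
    using B(11) obj by simp
qed

text \<open>\<open>\<phi> s\<close> is the distinguished image of
  \<open>\<eta> (Cod E s) \<cdot> s\<close>: the inverse image of \<open>t\<close> along
  \<open>\<phi> s\<close> contains the unit of \<open>Dom E s\<close>, and by
  \<open>eta_dense\<close> it is then everything.\<close>

lemma phi_least:
  assumes s: "s \<in> D" and t: "t \<in> D" "Cod E t = Cod E (\<eta> (Cod E s))" "\<eta> (Cod E s) \<cdot> s \<in> pts E t"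
  shows "\<phi> s \<in> pts E t"
proof -
  note P = phi_D[OF s]
  have obj: "Dom E s \<in> Obj E" "Cod E s \<in> Obj E"
    using s by simp_all
  obtain r where r: "r \<in> D" "Cod E r = Dom E (\<phi> s)"
    "pts E r = {z \<in> Arr E. Cod E z = Dom E (\<phi> s) \<and> \<phi> s \<cdot> z \<in> pts E t}"
    by (rule inverse_image[OF t(1), of "\<phi> s"]) (use P t in simp_all)
  have "\<eta> (Dom E s) \<in> pts E r"
    using r(3) P t(3) obj by simp
  then have "Ident E (Cod E (\<eta> (Dom E s))) \<in> pts E r"
    using eta_dense[OF obj(1) r(1)] r(2) P by simp
  then show ?thesis
    using r(3) P obj by simp
qed

text \<open>An upper bound of \<open>\<phi> s\<close> and \<open>\<phi> t\<close> contains
  \<open>\<eta> A\<close>, as can be checked on the cover of \<open>A\<close>; density of the unit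
  does the rest.\<close>

lemma covers_phi:
  assumes "covers A s t"
  shows "covers (Cod E (\<eta> A)) (\<phi> s) (\<phi> t)"
proof (rule coversI)
  note A = coversD[OF assms]
  note S = phi_D[OF A(2)] and P = phi_D[OF A(3)]
  show "Cod E (\<eta> A) \<in> Obj E" "\<phi> s \<in> D" "\<phi> t \<in> D" "Cod E (\<phi> s) = Cod E (\<eta> A)"
    "Cod E (\<phi> t) = Cod E (\<eta> A)"
    using A S P by simp_all
  fix u assume u: "u \<in> D" "Cod E u = Cod E (\<eta> A)" "pts E (\<phi> s) \<subseteq> pts E u" "pts E (\<phi> t) \<subseteq> pts E u"
  have "\<eta> A \<in> pts E u"
  proof (rule covers_local[OF assms, of "Ident E A"])
    fix x assume x: "x \<in> Arr E" "Cod E x = Dom E (Ident E A)"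
    show "\<eta> A \<cdot> x \<in> pts E u" if "Ident E A \<cdot> x \<in> pts E s"
      using phi_pts(2)[OF A(2), of x] that x A u(3) by auto
    show "\<eta> A \<cdot> x \<in> pts E u" if "Ident E A \<cdot> x \<in> pts E t"
      using phi_pts(2)[OF A(3), of x] that x A u(4) by auto
  qed (use A u in simp_all)
  then show "Ident E (Cod E (\<eta> A)) \<in> pts E u"
    by (rule eta_dense[OF A(1) u(1,2)])
qed

text \<open>The pullback \<open>?e\<close> of \<open>\<eta> A\<close> along \<open>r\<close> is, up
  to isomorphism, the unit of \<open>Dom E s\<close>. Indeed \<open>?e\<close> factors through that
  unit by some \<open>e'\<close>, which is distinguished because \<open>r \<cdot> e'\<close> equals
  \<open>\<phi> s\<close>; as CC4 makes \<open>?e\<close> a distinguished epimorphism,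
  \<open>e'\<close> is invertible. Triviality can then be cancelled along the unit.\<close>

lemma trivial_over_phi:
  assumes A: "A \<in> Obj E" and r: "r \<in> D" "Cod E r = Cod E (\<eta> A)" and g: "g \<in> Arr E"
    "Dom E g = Dom E r"
    and s: "s \<in> D" "Cod E s = A" "pts E s = {z \<in> Arr E. Cod E z = A \<and> \<eta> A \<cdot> z \<in> pts E r}"
    and Z: "ap E r g (\<eta> A \<cdot> s) \<in> Z"
  shows "g \<in> Z"
proof -
  note P = phi_D[OF s(1)]
  have obj: "Dom E s \<in> Obj E"
    using s by simp
  let ?e = "fac E r (\<eta> A \<cdot> s)"
  have es: "\<eta> A \<cdot> s \<in> pts E r"
    using s pts_self[of s] by simp
  have e: "?e \<in> Arr E" "Dom E ?e = Dom E s" "Cod E ?e = Dom E r" "r \<cdot> ?e = \<eta> A \<cdot> s"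
    using es r s A by simp_all
  have "is_pullback E (\<eta> A) r s ?e"
    by (rule pullbackI) (use A r s in simp_all)
  then have de: "distinguished_epi E D ?e"
    by (rule CC4[OF A r(1)])
  have rF: "Dom E r \<in> F"
    using D_torsion_free[OF r(1)] r(2) A by simp
  obtain k where k: "canonical_seq E T F (Dom E s) k (\<eta> (Dom E s))"
    using eta_canonical[OF obj] by blast
  obtain e' where e': "e' \<in> Arr E" "Dom E e' = Cod E (\<eta> (Dom E s))" "Cod E e' = Cod E ?e"
    "e' \<cdot> \<eta> (Dom E s) = ?e"
    by (rule unit_factor[OF k, of ?e]) (use e rF in simp_all)
  have re: "r \<cdot> e' = \<phi> s"
  proof (rule epiD[OF eta_simps(5)[OF obj]])
    show "(r \<cdot> e') \<cdot> \<eta> (Dom E s) = \<phi> s \<cdot> \<eta> (Dom E s)"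
      using e e' r P s obj by (simp add: assoc)
  qed (use e e' r P s obj in simp_all)
  have "e' \<in> D"
    by (rule D_cancel[of r]) (use re P r e e' in simp_all)
  moreover have "\<eta> (Dom E s) \<in> hom E (Dom E ?e) (Dom E e')"
    using e e' obj by simp
  ultimately have "is_iso E e'"
    using de e'(3,4) unfolding distinguished_epi_def by blast
  then obtain j where j: "j \<in> Arr E" "Dom E j = Cod E e'" "Cod E j = Dom E e'"
    "e' \<cdot> j = Ident E (Cod E e')"
    by (rule isoE) blast
  have "(g \<cdot> e') \<cdot> \<eta> (Dom E s) = g \<cdot> ?e"
    using g e e' obj by (simp add: assoc)
  then have "(g \<cdot> e') \<cdot> \<eta> (Dom E s) \<in> Z"
    using Z by (simp add: ap_def)
  then have "g \<cdot> e' \<in> Z"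
    by (rule Z_cancel_unit[OF k, rotated 2]) (use g e e' in simp_all)
  then have "(g \<cdot> e') \<cdot> j \<in> Z"
    by (rule Z_comp_right) (use g e e' j in simp_all)
  moreover have "(g \<cdot> e') \<cdot> j = g \<cdot> (e' \<cdot> j)"
    by (rule assoc) (use g e e' j in simp_all)
  moreover have "g \<cdot> (e' \<cdot> j) = g"
    using j(4) g e(3) e'(3) by simp
  ultimately show ?thesis
    by simp
qed

text \<open>The part \<open>j\<close> of \<open>A\<close> lying over the meet of
  \<open>\<phi> u0\<close> and \<open>r1\<close> is contained in \<open>u0\<close>, by
  \<open>pts_phi\<close>. So the hypothesis gives triviality on \<open>j\<close>, and
  \<open>trivial_over_phi\<close> descends it to the meet.\<close>

lemma trivial_on_phi:
  assumes A: "A \<in> Obj E" and u: "u0 \<in> D" "Cod E u0 = A" and r: "r1 \<in> D" "Cod E r1 = Cod E (\<eta> A)"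
    and k: "k \<in> Arr E" "Dom E k = Dom E r1"
    and m: "\<And>z. z \<in> Arr E \<Longrightarrow> Cod E z = A \<Longrightarrow> \<eta> A \<cdot> z \<in> pts E r1 \<Longrightarrow> z \<in> pts E u0 \<Longrightarrow>
        ap E r1 k (\<eta> A \<cdot> z) \<in> Z"
    and z: "z \<in> pts E (\<phi> u0)" "z \<in> pts E r1"
  shows "ap E r1 k z \<in> Z"
proof -
  note P0 = phi_D[OF u(1)]
  obtain i where i: "i \<in> D" "Cod E i = Cod E (\<phi> u0)" "pts E i = pts E (\<phi> u0) \<inter> pts E r1"
    by (rule intersection[of "\<phi> u0" r1]) (use P0 r u in simp_all)
  have ic: "Cod E i = Cod E (\<eta> A)"
    using i P0 u by simp
  obtain j where j: "j \<in> D" "Cod E j = A" "pts E j = {z \<in> Arr E. Cod E z = A \<and> \<eta> A \<cdot> z \<in> pts E i}"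
    using inverse_image[OF i(1), of "\<eta> A"] A ic by (simp only: eta_simps) blast
  have ii: "i \<in> pts E r1"
    using pts_self[of i] i by auto
  have ej: "\<eta> A \<cdot> j \<in> pts E i" "\<eta> A \<cdot> j \<in> pts E r1" "\<eta> A \<cdot> j \<in> pts E (\<phi> u0)"
    using pts_self[of j] j i by auto
  then have "j \<in> pts E u0"
    using pts_phi[OF u(1)] j u by simp
  then have "ap E r1 k (\<eta> A \<cdot> j) \<in> Z"
    using m[of j] ej j by simp
  then have "ap E i (ap E r1 k i) (\<eta> A \<cdot> j) \<in> Z"
    using ap_restrict[of i r1 "\<eta> A \<cdot> j" k] i r k ii ej by simp
  then have "ap E r1 k i \<in> Z"
    by (rule trivial_over_phi[OF A i(1) ic _ _ j, rotated 2]) (use ii r k in simp_all)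
  then have "ap E r1 k i \<cdot> fac E i z \<in> Z"
    by (rule Z_comp_right) (use z i ii r k in simp_all)
  moreover have "ap E r1 k (i \<cdot> fac E i z) = ap E r1 k i \<cdot> fac E i z"
    by (rule ap_comp) (use z i ii r k in simp_all)
  ultimately show ?thesis
    using z i by simp
qed

section \<open>Canonical exact sequences in the stable category\<close>

text \<open>Composing with \<open>k\<close> leaves the domains of partial maps unchanged, so a cover
  comparing the composites with \<open>k\<close> also compares the originals: \<open>k\<close> is
  mono and \<open>Z_cancel_counit\<close> removes it from trivial arrows. Lifting along
  \<open>k\<close> is done on \<open>f\<close> alone, by \<open>trivial_cls\<close>.\<close>

lemma sg_kernel:
  assumes c: "canonical_seq E T F A k q"
  shows "is_kernel St (trivials St T F) (sg k) (sg q)"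
proof (rule St.kernelI)
  note K = canonicalD[OF c]
  show "sg q \<in> Arr St" "Cod St (sg k) = Dom St (sg q)"
    using K sg_simps by simp_all
  have t: "(from_initial E zero (Dom E (q \<cdot> k)), Ident E (Dom E (q \<cdot> k)), q \<cdot> k) \<in> triples E D Z"
    by (rule sg_triple) (use K in simp)
  show "Comp St (sg q) (sg k) \<in> trivials St T F"
    using sg_comp[of k q] trivial_cls[OF t] K by (simp add: sg_def)
  show "is_mono St (sg k)"
  proof (rule St.monoI)
    fix \<alpha> \<beta> assume *: "\<alpha> \<in> Arr St" "\<beta> \<in> Arr St" "Dom St \<alpha> = Dom St \<beta>" "Cod St \<alpha> = Dom St (sg k)"
      "Cod St \<beta> = Dom St (sg k)" "Comp St (sg k) \<alpha> = Comp St (sg k) \<beta>"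
    obtain s0 s1 f where s: "(s0, s1, f) \<in> triples E D Z" "\<alpha> = cls (s0, s1, f)"
      using *(1) by (rule Stab_arrE)
    obtain t0 t1 g where t: "(t0, t1, g) \<in> triples E D Z" "\<beta> = cls (t0, t1, g)"
      using *(2) by (rule Stab_arrE)
    note X = tripleD[OF s(1)] and Y = tripleD[OF t(1)]
    have dc: "Cod E s1 = Cod E t1" "Cod E f = Dom E k" "Cod E g = Dom E k"
      using *(3-5) Stab_Dom[OF s(1)] Stab_Dom[OF t(1)] s(2) t(2) K sg_simps(2)[of k] by simp_all
    have ks: "(s0, s1, k \<cdot> f) \<in> triples E D Z" "Comp St (sg k) \<alpha> = cls (s0, s1, k \<cdot> f)"
      using sg_comp_cls[OF s(1), of k] K dc s(2) by simp_all
    have kt: "(t0, t1, k \<cdot> g) \<in> triples E D Z" "Comp St (sg k) \<beta> = cls (t0, t1, k \<cdot> g)"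
      using sg_comp_cls[OF t(1), of k] K dc t(2) by simp_all
    have aps: "ap E s1 (k \<cdot> f) z = k \<cdot> ap E s1 f z" if "z \<in> pts E s1" for z
      using that X(3,5,6) K(2) dc(2) by (simp add: ap_def assoc)
    have apt: "ap E t1 (k \<cdot> g) z = k \<cdot> ap E t1 g z" if "z \<in> pts E t1" for z
      using that Y(3,5,6) K(2) dc(3) by (simp add: ap_def assoc)
    have "eqv (s0, s1, k \<cdot> f) (t0, t1, k \<cdot> g)"
      using cls_eq[OF ks(1) kt(1)] *(6) ks(2) kt(2) by simp
    then obtain u0 u1 where u: "eqv_on u0 u1 (s0, s1, k \<cdot> f) (t0, t1, k \<cdot> g)"
      by (rule eqvE)
    note u = eqv_onD(3-8)[OF u]
    have "eqv (s0, s1, f) (t0, t1, g)"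
    proof (rule eqvI[OF _ _ u(1,2,3)])
      show "ap E s1 f z = ap E t1 g z" if z: "z \<in> pts E u1" for z
      proof (rule monoD[OF K(9)])
        have z': "z \<in> pts E s1" "z \<in> pts E t1"
          using z u(2,3) by auto
        then show "k \<cdot> ap E s1 f z = k \<cdot> ap E t1 g z"
          using u(4)[OF z] aps apt by simp
        show "ap E s1 f z \<in> Arr E" "ap E t1 g z \<in> Arr E" "Dom E (ap E s1 f z) = Dom E (ap E t1 g z)"
          "Cod E (ap E s1 f z) = Dom E k" "Cod E (ap E t1 g z) = Dom E k"
          using z' X Y dc by simp_all
      qed
      show "ap E s1 f z \<in> Z" if "z \<in> pts E u0" "z \<in> pts E s1" for z
        using Z_cancel_counit[OF c, of "ap E s1 f z"] u(5)[OF that] aps[OF that(2)]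
          that X dc by simp
      show "ap E t1 g z \<in> Z" if "z \<in> pts E u0" "z \<in> pts E t1" for z
        using Z_cancel_counit[OF c, of "ap E t1 g z"] u(6)[OF that] apt[OF that(2)]
          that Y dc by simp
    qed (use dc in simp_all)
    then show "\<alpha> = \<beta>"
      using cls_eq[OF s(1) t(1)] s(2) t(2) by simp
  qed (use K sg_simps in simp)
  fix \<alpha> assume m: "\<alpha> \<in> Arr St" "Cod St \<alpha> = Dom St (sg q)" "Comp St (sg q) \<alpha> \<in> trivials St T F"
  obtain s0 s1 f where s: "(s0, s1, f) \<in> triples E D Z" "\<alpha> = cls (s0, s1, f)"
    using m(1) by (rule Stab_arrE)
  note X = tripleD[OF s(1)]
  have dc: "Cod E f = A"
    using m(2) Stab_Dom[OF s(1)] s(2) K sg_simps(2)[of q] by simp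
  have qs: "(s0, s1, q \<cdot> f) \<in> triples E D Z" "Comp St (sg q) \<alpha> = cls (s0, s1, q \<cdot> f)"
    using sg_comp_cls[OF s(1), of q] K dc s(2) by simp_all
  have "q \<cdot> f \<in> Z"
    using trivial_cls[OF qs(1)] qs(2) m(3) by simp
  then obtain n where n: "n \<in> Arr E" "Dom E n = Dom E f" "Cod E n = Dom E k" "k \<cdot> n = f"
    using kernel_lift[OF K(11) X(5)] dc K by auto
  have "ap E s1 n z \<in> Z" if "z \<in> pts E s0" "z \<in> pts E s1" for z
  proof -
    have "k \<cdot> ap E s1 n z = (k \<cdot> n) \<cdot> fac E s1 z"
      using that X(3,6) n(1-3) K(2) by (simp add: ap_def assoc)
    then have "k \<cdot> ap E s1 n z \<in> Z"
      using X(7)[OF that] n(4) by (simp add: ap_def)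
    then show ?thesis
      by (rule Z_cancel_counit[OF c, rotated 2]) (use that X n in simp_all)
  qed
  then have nt: "(s0, s1, n) \<in> triples E D Z"
    unfolding triples_iff using X n by simp
  then show "\<exists>\<nu>\<in>Arr St. Cod St \<nu> = Dom St (sg k) \<and> Comp St (sg k) \<nu> = \<alpha>"
    using sg_comp_cls(2)[OF nt, of k] n K Stab_Dom[OF nt] s(2) sg_simps(2)[of k] cls_arr[OF nt]
    by (intro bexI[of _ "cls (s0, s1, n)"]) simp_all
qed

text \<open>A cover of \<open>A\<close> comparing the two composites is pushed to
  \<open>\<phi> u0\<close>, \<open>\<phi> u1\<close>. On \<open>\<phi> u1\<close> the arrows agree
  because the unit of \<open>Dom E u1\<close> is epi; on \<open>\<phi> u0\<close> they are trivial
  by \<open>trivial_on_phi\<close>.\<close>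

lemma sg_eta_epi:
  assumes A: "A \<in> Obj E"
  shows "is_epi St (sg (\<eta> A))"
proof (rule St.epiI)
  show "sg (\<eta> A) \<in> Arr St"
    using A sg_simps by simp
  fix \<alpha> \<beta> assume *: "\<alpha> \<in> Arr St" "\<beta> \<in> Arr St" "Cod St \<alpha> = Cod St \<beta>" "Dom St \<alpha> = Cod St (sg (\<eta> A))"
    "Dom St \<beta> = Cod St (sg (\<eta> A))" "Comp St \<alpha> (sg (\<eta> A)) = Comp St \<beta> (sg (\<eta> A))"
  obtain s0 s1 f where s: "(s0, s1, f) \<in> triples E D Z" "\<alpha> = cls (s0, s1, f)"
    using *(1) by (rule Stab_arrE)
  obtain t0 t1 g where t: "(t0, t1, g) \<in> triples E D Z" "\<beta> = cls (t0, t1, g)"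
    using *(2) by (rule Stab_arrE)
  note X = tripleD[OF s(1)] and Y = tripleD[OF t(1)]
  have dc: "Cod E s1 = Cod E (\<eta> A)" "Cod E t1 = Cod E (\<eta> A)" "Cod E f = Cod E g"
    using *(3-5) Stab_Dom[OF s(1)] Stab_Dom[OF t(1)] s(2) t(2) A sg_simps(3)[of "\<eta> A"] by simp_all
  obtain v0 v1 l where v': "(v0, v1, l) \<in> triples E D Z"
    "Comp St (cls (s0, s1, f)) (sg (\<eta> A)) = cls (v0, v1, l)"
    "Cod E v1 = Dom E (\<eta> A)" "pts E v1 = {z \<in> Arr E. Cod E z = Dom E (\<eta> A) \<and> \<eta> A \<cdot> z \<in> pts E s1}"
    "\<And>z. z \<in> pts E v1 \<Longrightarrow> ap E v1 l z = ap E s1 f (\<eta> A \<cdot> z)"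
    by (rule cls_comp_sg[OF s(1), of "\<eta> A"]) (use A dc in auto)
  note v = v'[unfolded eta_simps(2)[OF A]]
  obtain w0 w1 h where w': "(w0, w1, h) \<in> triples E D Z"
    "Comp St (cls (t0, t1, g)) (sg (\<eta> A)) = cls (w0, w1, h)"
    "Cod E w1 = Dom E (\<eta> A)" "pts E w1 = {z \<in> Arr E. Cod E z = Dom E (\<eta> A) \<and> \<eta> A \<cdot> z \<in> pts E t1}"
    "\<And>z. z \<in> pts E w1 \<Longrightarrow> ap E w1 h z = ap E t1 g (\<eta> A \<cdot> z)"
    by (rule cls_comp_sg[OF t(1), of "\<eta> A"]) (use A dc in auto)
  note w = w'[unfolded eta_simps(2)[OF A]]
  have "eqv (v0, v1, l) (w0, w1, h)"
    using cls_eq[OF v(1) w(1)] *(6) v(2) w(2) s(2) t(2) by simp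
  then obtain u0 u1 where u: "eqv_on u0 u1 (v0, v1, l) (w0, w1, h)"
    by (rule eqvE)
  note u = eqv_onD(3-8)[OF u]
  have cu: "covers A u0 u1"
    using u(1) v(3) by simp
  note U = coversD[OF cu]
  note P0 = phi_D[OF U(2)] and P1 = phi_D[OF U(3)]
  have obj: "Dom E u1 \<in> Obj E"
    using U by simp
  have uv: "u1 \<in> pts E u1" "u1 \<in> pts E v1" "u1 \<in> pts E w1"
    using u(2,3) pts_self[of u1] U by auto
  have sub: "\<phi> u1 \<in> pts E s1" "\<phi> u1 \<in> pts E t1"
    using phi_least[OF U(3) X(3)] phi_least[OF U(3) Y(3)] uv v(4) w(4) U dc by auto
  have ap1: "ap E s1 f (\<phi> u1) = ap E t1 g (\<phi> u1)"
  proof (rule epiD[OF eta_simps(5)[OF obj]])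
    have "ap E s1 f (\<phi> u1) \<cdot> \<eta> (Dom E u1) = ap E s1 f (\<phi> u1 \<cdot> \<eta> (Dom E u1))"
      by (rule ap_comp[symmetric]) (use sub X P1 obj in simp_all)
    also have "\<dots> = ap E v1 l u1"
      using v(5)[OF uv(2)] P1(4) U by simp
    also have "\<dots> = ap E w1 h u1"
      by (rule u(4)[OF uv(1)])
    also have "\<dots> = ap E t1 g (\<phi> u1 \<cdot> \<eta> (Dom E u1))"
      using w(5)[OF uv(3)] P1(4) U by simp
    also have "\<dots> = ap E t1 g (\<phi> u1) \<cdot> \<eta> (Dom E u1)"
      by (rule ap_comp) (use sub Y P1 obj in simp_all)
    finally show "ap E s1 f (\<phi> u1) \<cdot> \<eta> (Dom E u1) = ap E t1 g (\<phi> u1) \<cdot> \<eta> (Dom E u1)" .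
  qed (use sub X Y P1 dc obj in simp_all)
  have "eqv (s0, s1, f) (t0, t1, g)"
  proof (rule eqvI[of _ _ _ _ "\<phi> u0" "\<phi> u1"])
    show "covers (Cod E s1) (\<phi> u0) (\<phi> u1)"
      using covers_phi[OF cu] dc by simp
    show "pts E (\<phi> u1) \<subseteq> pts E s1" "pts E (\<phi> u1) \<subseteq> pts E t1"
      using sub pts_le_iff P1 X Y by simp_all
    show "ap E s1 f z = ap E t1 g z" if z: "z \<in> pts E (\<phi> u1)" for z
    proof -
      have "ap E s1 f z = ap E (\<phi> u1) (ap E s1 f (\<phi> u1)) z"
        by (rule ap_restrict[symmetric]) (use z sub P1 X in simp_all)
      also have "\<dots> = ap E (\<phi> u1) (ap E t1 g (\<phi> u1)) z"
        using ap1 by simp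
      also have "\<dots> = ap E t1 g z"
        by (rule ap_restrict) (use z sub P1 Y in simp_all)
      finally show ?thesis .
    qed
    show "ap E s1 f z \<in> Z" if "z \<in> pts E (\<phi> u0)" "z \<in> pts E s1" for z
      by (rule trivial_on_phi[OF A U(2,4) X(3) dc(1) X(5,6) _ that]) (use u(5) v(4,5) in auto)
    show "ap E t1 g z \<in> Z" if "z \<in> pts E (\<phi> u0)" "z \<in> pts E t1" for z
      by (rule trivial_on_phi[OF A U(2,4) Y(3) dc(2) Y(5,6) _ that]) (use u(6) w(4,5) in auto)
  qed (use dc in simp_all)
  then show "\<alpha> = \<beta>"
    using cls_eq[OF s(1) t(1)] s(2) t(2) by simp
qed

text \<open>The counit \<open>k1\<close> of \<open>Dom E s1\<close>, followed by \<open>s1\<close>,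
  factors through \<open>k\<close>, so an arrow killed by \<open>k\<close> has
  \<open>f \<cdot> k1\<close> trivial and \<open>f\<close> descends to some \<open>g\<close> along
  the unit of \<open>Dom E s1\<close>. The factorization sought is
  \<open>(\<phi> s0, \<phi> s1, g)\<close>: by \<open>pts_phi\<close> its composite with the unit is
  defined exactly on \<open>s1\<close>.\<close>

lemma sg_eta_cokernel:
  assumes c: "canonical_seq E T F A k (\<eta> A)"
  shows "is_cokernel St (trivials St T F) (sg (\<eta> A)) (sg k)"
proof (rule St.cokernelI)
  note K = canonicalD[OF c]
  show "is_epi St (sg (\<eta> A))"
    by (rule sg_eta_epi[OF K(1)])
  show "sg k \<in> Arr St" "Dom St (sg (\<eta> A)) = Cod St (sg k)"
    "Comp St (sg (\<eta> A)) (sg k) \<in> trivials St T F"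
    using sg_kernel[OF c] St.kernelD by force+
  fix \<alpha> assume m: "\<alpha> \<in> Arr St" "Dom St \<alpha> = Cod St (sg k)" "Comp St \<alpha> (sg k) \<in> trivials St T F"
  obtain s0 s1 f where s: "(s0, s1, f) \<in> triples E D Z" "\<alpha> = cls (s0, s1, f)"
    using m(1) by (rule Stab_arrE)
  note X = tripleD[OF s(1)]
  have dc: "Cod E s1 = A"
    using m(2) Stab_Dom[OF s(1)] s(2) K sg_simps(3)[of k] by simp
  have cov: "covers A s0 s1"
    using X dc by simp
  obtain w0 w1 h where w: "(w0, w1, h) \<in> triples E D Z"
    "Comp St (cls (s0, s1, f)) (sg k) = cls (w0, w1, h)"
    "pts E w1 = {z \<in> Arr E. Cod E z = Dom E k \<and> k \<cdot> z \<in> pts E s1}"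
    "\<And>z. z \<in> pts E w1 \<Longrightarrow> ap E w1 h z = ap E s1 f (k \<cdot> z)"
    by (rule cls_comp_sg[OF s(1) K(2)]) (use K(4) dc in auto)
  have hZ: "h \<in> Z"
    using trivial_cls[OF w(1)] m(3) s(2) w(2) by simp
  note W = tripleD[OF w(1)]
  note P0 = phi_D[OF X(2)] and P1 = phi_D[OF X(3)]
  have obj: "Dom E s1 \<in> Obj E"
    using X by simp
  obtain k1 where k1: "canonical_seq E T F (Dom E s1) k1 (\<eta> (Dom E s1))"
    using eta_canonical[OF obj] by blast
  note K1 = canonicalD[OF k1]
  obtain j where j: "j \<in> Arr E" "Cod E j = Dom E k" "Dom E j = Dom E (s1 \<cdot> k1)" "k \<cdot> j = s1 \<cdot> k1"
    by (rule counit_factor[OF c, of "s1 \<cdot> k1"]) (use K1 X dc in simp_all)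
  have jw: "j \<in> pts E w1"
    using w(3) j pts_I[of s1 k1] K1 X by simp
  have "fac E s1 (s1 \<cdot> k1) = k1"
    by (rule fac_unique) (use K1 X in simp_all)
  then have "f \<cdot> k1 = ap E w1 h j"
    using w(4)[OF jw] j by (simp add: ap_def)
  moreover have "ap E w1 h j \<in> Z"
    unfolding ap_def using hZ by (rule Z_comp_right) (use jw W in simp_all)
  ultimately obtain g where g: "g \<in> Arr E" "Dom E g = Cod E (\<eta> (Dom E s1))" "Cod E g = Cod E f"
    "g \<cdot> \<eta> (Dom E s1) = f"
    using cokernel_lift[OF K1(12) X(5)] K1 X(6) by auto
  have apg: "ap E (\<phi> s1) g (\<eta> A \<cdot> z) = ap E s1 f z" if z: "z \<in> pts E s1" for z
  proof -
    have "ap E (\<phi> s1) g (\<eta> A \<cdot> z) = g \<cdot> (\<eta> (Dom E s1) \<cdot> fac E s1 z)"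
      using phi_pts(3)[OF X(3) z] dc by (simp add: ap_def)
    also have "\<dots> = (g \<cdot> \<eta> (Dom E s1)) \<cdot> fac E s1 z"
      by (rule assoc[symmetric]) (use g z X obj in simp_all)
    finally show ?thesis
      using g(4) by (simp add: ap_def)
  qed
  have "ap E (\<phi> s1) g z \<in> Z" if "z \<in> pts E (\<phi> s0)" "z \<in> pts E (\<phi> s1)" for z
  proof (rule trivial_on_phi[OF K(1) X(2) _ P1(1) _ _ _ _ that])
    show "ap E (\<phi> s1) g (\<eta> A \<cdot> x) \<in> Z"
      if "x \<in> Arr E" "Cod E x = A" "\<eta> A \<cdot> x \<in> pts E (\<phi> s1)" "x \<in> pts E s0" for x
      using pts_phi[OF X(3)] that dc apg X(7) by simp
  qed (use X P1 g dc in simp_all)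
  then have nt: "(\<phi> s0, \<phi> s1, g) \<in> triples E D Z"
    unfolding triples_iff using covers_phi[OF cov] P1 dc g by simp
  have "Comp St (cls (\<phi> s0, \<phi> s1, g)) (sg (\<eta> A)) = cls (s0, s1, f)"
  proof -
    obtain v0 v1 l where v: "(v0, v1, l) \<in> triples E D Z"
      "Comp St (cls (\<phi> s0, \<phi> s1, g)) (sg (\<eta> A)) = cls (v0, v1, l)"
      "pts E v1 = {z \<in> Arr E. Cod E z = Dom E (\<eta> A) \<and> \<eta> A \<cdot> z \<in> pts E (\<phi> s1)}"
      "\<And>z. z \<in> pts E v1 \<Longrightarrow> ap E v1 l z = ap E (\<phi> s1) g (\<eta> A \<cdot> z)"
      by (rule cls_comp_sg[OF nt K(3)]) (use P1 dc in auto)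
    have eq: "pts E v1 = pts E s1"
      using v(3) pts_phi[OF X(3)] dc K by simp
    have "cls (v0, v1, l) = cls (s0, s1, f)"
      by (rule cls_eqI[OF v(1) s(1) eq]) (use v(4) eq apg in simp)
    then show ?thesis
      using v(2) by simp
  qed
  then show "\<exists>\<nu>\<in>Arr St. Dom St \<nu> = Cod St (sg (\<eta> A)) \<and> Comp St \<nu> (sg (\<eta> A)) = \<alpha>"
    using Stab_Dom[OF nt] cls_arr[OF nt] P1 dc s(2) sg_simps(3)[of "\<eta> A"] K
    by (intro bexI[of _ "cls (\<phi> s0, \<phi> s1, g)"]) simp_all
qed

end

section \<open>The functor to the stable category\<close>

context compatible
begin

interpretation St: category St
  by (rule Stab_category)

lemma sg_iso:
  assumes "is_iso E f" shows "is_iso St (sg f)"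
proof -
  from assms obtain g where g: "f \<in> Arr E" "g \<in> Arr E" "Dom E g = Cod E f" "Cod E g = Dom E f"
    "g \<cdot> f = Ident E (Dom E f)" "f \<cdot> g = Ident E (Cod E f)"
    by (rule isoE)
  show ?thesis
    by (rule St.isoI[of _ "sg g"]) (use g sg_simps Stab_Ident sg_comp in simp_all)
qed

text \<open>The cokernel property was obtained for the chosen unit. Any other \<open>q\<close>
  differs from \<open>\<eta> A\<close> by an isomorphism, which \<open>\<sigma>\<close>
  preserves.\<close>

lemma sg_canonical:
  assumes c: "canonical_seq E T F A k q"
  shows "canonical_seq St T F A (sg k) (sg q)"
proof -
  note K = canonicalD[OF c]
  obtain k0 where "canonical_seq E T F A k0 (\<eta> A)"
    using eta_canonical[OF K(1)] by blast
  from canonical_mix[OF c this] have c': "canonical_seq E T F A k (\<eta> A)" .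
  obtain i where i: "is_iso E i" "Dom E i = Cod E (\<eta> A)" "q = i \<cdot> \<eta> A"
    by (rule canonical_unique[OF c' c])
  have ia: "i \<in> Arr E"
    using i by (simp add: is_iso_def)
  have "is_cokernel St (trivials St T F) (Comp St (sg i) (sg (\<eta> A))) (Comp St (sg k) (Ident St (Dom
    E k)))"
    by (rule St.cokernel_iso[OF sg_eta_cokernel[OF c'] St.iso_ident _ sg_iso[OF i(1)]])
      (use sg_simps K i ia in simp_all)
  moreover have "Comp St (sg i) (sg (\<eta> A)) = sg q"
    using sg_comp[of "\<eta> A" i] K(1) i ia by simp
  moreover have "Comp St (sg k) (Ident St (Dom E k)) = sg k"
    using sg_simps[OF K(2)] by simp
  ultimately have "is_cokernel St (trivials St T F) (sg q) (sg k)"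
    by simp
  then show ?thesis
    unfolding canonical_seq_def short_exact_def using sg_kernel[OF c] K sg_simps by simp
qed

lemma Stab_torsion_theory: "torsion_theory St T F"
proof
  show "T \<subseteq> Obj St" "F \<subseteq> Obj St"
    using T_obj F_obj by simp_all
  show "\<exists>k q. canonical_seq St T F A k q" if "A \<in> Obj St" for A
    using that PT2[of A] sg_canonical by (metis Stab_Obj)
qed (use Stab_T_iso Stab_F_iso Stab_PT1 trivial_zero_Stab in blast)+

abbreviation \<sigma> where "\<sigma> \<equiv> stab_functor E zero D T F"

lemma stab_functor_simps [simp]:
  "A \<in> Obj E \<Longrightarrow> FObj \<sigma> A = A"
  "f \<in> Arr E \<Longrightarrow> FArr \<sigma> f = sg f"
  by (simp_all add: stab_functor_def sg_def cls_def)

lemma stab_functor_functor: "is_functor E St \<sigma>"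
  unfolding is_functor_def
proof (intro conjI ballI impI)
  show "category E" by (rule category_axioms)
  show "category St" by (rule Stab_category)
  show "FObj \<sigma> \<in> Obj E \<rightarrow>\<^sub>E Obj St"
    by (auto simp: stab_functor_def)
  show "FArr \<sigma> \<in> Arr E \<rightarrow>\<^sub>E Arr St"
    using sg_simps(1) by (auto simp: stab_functor_def sg_def cls_def)
qed (use sg_simps Stab_Ident sg_comp in simp_all)

lemma stab_functor_torsion: "torsion_functor E T F St T F \<sigma>"
proof -
  have "canonical_seq St T F (FObj \<sigma> A) (FArr \<sigma> k) (FArr \<sigma> q)"
    if "canonical_seq E T F A k q" for A k q
    using sg_canonical[OF that] canonicalD[OF that] by simp
  moreover have "FObj \<sigma> ` T \<subseteq> T" "FObj \<sigma> ` F \<subseteq> F"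
    using T_obj F_obj by (auto simp: stab_functor_def)
  ultimately show ?thesis
    unfolding torsion_functor_def using pretorsion_theory_axioms Stab_torsion_theory
      stab_functor_functor
    by (simp add: torsion_theory_def)
qed

lemma D_comp_pts:
  assumes "i \<in> D" "s \<in> D" "Cod E s = Dom E i"
  shows "i \<cdot> s \<in> D" "pts E (i \<cdot> s) = {z \<in> pts E i. fac E i z \<in> pts E s}"
    "z \<in> pts E (i \<cdot> s) \<Longrightarrow> ap E (i \<cdot> s) f z = ap E s f (fac E i z)"
  using CS5[of s i] pts_comp_iff[of i s] assms by (simp_all add: ap_def)

text \<open>In a zero-pushout one leg \<open>j\<close> carries a trivial arrow and can be absorbed
  into the zero part; thus a cover of \<open>Dom E i\<close> spreads to one of
  \<open>A\<close>.\<close>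

lemma covers_extend:
  assumes "covers A i j" "covers (Dom E i) s0 s1"
  obtains w where "w \<in> D" "is_union E (i \<cdot> s0) j w" "covers A w (i \<cdot> s1)"
proof -
  note I = coversD[OF assms(1)] and S = coversD[OF assms(2)]
  note Q0 = D_comp_pts(1,2)[OF I(2) S(2,4)] and Q1 = D_comp_pts(1,2)[OF I(2) S(3,5)]
  obtain w where w: "w \<in> D" "is_union E (i \<cdot> s0) j w"
    using CS2[of "i \<cdot> s0" j] Q0 I S by auto
  have le: "pts E (i \<cdot> s0) \<subseteq> pts E w" "pts E j \<subseteq> pts E w"
    using w(2) by (simp_all add: is_union_pts)
  have wc: "Cod E w = A"
    using le(2) pts_self[of j] pts_cod[of j w] I by (simp add: subset_iff)
  have fac: "ap E i (Ident E (Dom E i)) z = fac E i z" if "z \<in> pts E i" for z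
    using that I by (simp add: ap_def)
  have "covers A w (i \<cdot> s1)"
  \<comment> \<open>The partial map in question is the identity of \<open>i\<close>, with
    \<open>j\<close> as its zero part.\<close>
  proof (rule covers_composite[OF covers_sym[OF assms(1)], of "Ident E (Dom E i)" s0 s1])
    show "z \<in> pts E w" if "z \<in> pts E i" "ap E i (Ident E (Dom E i)) z \<in> pts E s0" for z
      using that fac le(1) Q0(2) by auto
    show "z \<in> pts E (i \<cdot> s1)" if "z \<in> pts E i" "ap E i (Ident E (Dom E i)) z \<in> pts E s1" for z
      using that fac Q1(2) by auto
  qed (use I S w wc le Q1 assms(2) in simp_all)
  then show thesis
    using that w by blast
qed

text \<open>The case of a trivial arrow on \<open>j\<close>. The mediating arrow has the partial map
  of \<open>\<alpha>\<close>, now placed on \<open>i \<cdot> s1\<close>, with zero part the union of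
  \<open>i \<cdot> s0\<close> and \<open>j\<close>. Uniqueness follows by extending to
  \<open>A\<close> a cover of \<open>Dom E i\<close> that compares the restrictions along
  \<open>i\<close>.\<close>

lemma zero_pushout_extend:
  assumes cov: "covers A i j"
    and pq: "p \<in> Arr E" "q \<in> Arr E" "Cod E p = Dom E i" "Cod E q = Dom E j" "Dom E p = Dom E q"
    and lift: "\<And>x y. x \<in> Arr E \<Longrightarrow> y \<in> Arr E \<Longrightarrow> Dom E x = Dom E y \<Longrightarrow> Cod E x = Dom E i \<Longrightarrow>
      Cod E y = Dom E j \<Longrightarrow> i \<cdot> x = j \<cdot> y \<Longrightarrow> \<exists>h\<in>Arr E. Cod E h = Dom E p \<and> p \<cdot> h = x"
    and \<alpha>: "\<alpha> \<in> hom St (Dom E i) B" and \<beta>: "\<beta> \<in> hom St (Dom E j) B"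
    and eq: "Comp St \<alpha> (sg p) = Comp St \<beta> (sg q)" and zero: "\<beta> \<in> trivials St T F"
  shows "\<exists>!\<gamma>. \<gamma> \<in> hom St A B \<and> Comp St \<gamma> (sg i) = \<alpha> \<and> Comp St \<gamma> (sg j) = \<beta>"
proof -
  note I = coversD[OF cov]
  obtain s0 s1 f where s: "(s0, s1, f) \<in> triples E D Z" "\<alpha> = cls (s0, s1, f)"
    using \<alpha> by (auto elim: Stab_arrE)
  obtain t0 t1 g where t: "(t0, t1, g) \<in> triples E D Z" "\<beta> = cls (t0, t1, g)"
    using \<beta> by (auto elim: Stab_arrE)
  note X = tripleD[OF s(1)] and Y = tripleD[OF t(1)]
  have dc: "Cod E s1 = Dom E i" "Cod E f = B" "Cod E t1 = Dom E j" "Cod E g = B"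
    using \<alpha> \<beta> Stab_Dom[OF s(1)] Stab_Dom[OF t(1)] s(2) t(2) by auto
  have gZ: "g \<in> Z"
    using zero trivial_cls[OF t(1)] t(2) by simp
  obtain a0 a1 a where a: "(a0, a1, a) \<in> triples E D Z"
    "Comp St (cls (s0, s1, f)) (sg p) = cls (a0, a1, a)"
    "pts E a1 = {z \<in> Arr E. Cod E z = Dom E p \<and> p \<cdot> z \<in> pts E s1}"
    "\<And>z. z \<in> pts E a1 \<Longrightarrow> ap E a1 a z = ap E s1 f (p \<cdot> z)"
    by (rule cls_comp_sg[OF s(1) pq(1)]) (use pq dc in auto)
  have "Comp St \<beta> (sg q) \<in> trivials St T F"
    by (rule St.factoring_comp_right[OF zero]) (use sg_simps[OF pq(2)] pq \<beta> in simp_all)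
  then have aZ: "a \<in> Z"
    using eq s(2) a(2) trivial_cls[OF a(1)] by simp
  have cs: "covers (Dom E i) s0 s1"
    using X(1) dc by simp
  obtain w where w: "w \<in> D" "is_union E (i \<cdot> s0) j w" "covers A w (i \<cdot> s1)"
    by (rule covers_extend[OF cov cs])
  have s0c: "Cod E s0 = Dom E i"
    using X dc by simp
  note Q0 = D_comp_pts[OF I(2) X(2) s0c] and Q1 = D_comp_pts[OF I(2) X(3) dc(1)]
  have f_dom: "Dom E f = Dom E (i \<cdot> s1)" "Cod E (i \<cdot> s1) = A"
    using X I dc by simp_all
  \<comment> \<open>A common element of \<open>j\<close> and \<open>i \<cdot> s1\<close> comes from
    \<open>p\<close>, and along \<open>p\<close> the arrow \<open>\<alpha>\<close> coincides with
    the restriction of the trivial \<open>\<beta>\<close> along \<open>q\<close>.\<close>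
  have trivj: "ap E (i \<cdot> s1) f z \<in> Z" if z: "z \<in> pts E j" "z \<in> pts E (i \<cdot> s1)" for z
  proof -
    have zi: "z \<in> pts E i" "fac E i z \<in> pts E s1"
      using z(2) Q1(2) by auto
    obtain h where h: "h \<in> Arr E" "Cod E h = Dom E p" "p \<cdot> h = fac E i z"
      using lift[of "fac E i z" "fac E j z"] zi z I by auto
    have ha: "h \<in> pts E a1"
      using a(3) h zi by simp
    have "ap E a1 a h \<in> Z"
      unfolding ap_def using aZ by (rule Z_comp_right) (use ha tripleD[OF a(1)] in simp_all)
    then show ?thesis
      using a(4)[OF ha] h Q1(3)[OF z(2)] by simp
  qed
  have "ap E (i \<cdot> s1) f z \<in> Z" if z: "z \<in> pts E w" "z \<in> pts E (i \<cdot> s1)" for z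
  proof (rule union_ap_Z[OF Q0(1) I(3) w(2) Q1(1) X(5) f_dom(1) z(2,1)])
    fix x assume zx: "z \<cdot> x \<in> pts E (i \<cdot> s1)"
    show "ap E (i \<cdot> s1) f (z \<cdot> x) \<in> Z" if "z \<cdot> x \<in> pts E (i \<cdot> s0)"
      using that zx Q0(2) Q1(2) Q1(3)[OF zx] X(7) by simp
    show "ap E (i \<cdot> s1) f (z \<cdot> x) \<in> Z" if "z \<cdot> x \<in> pts E j"
      using trivj that zx .
  qed
  then have wt: "(w, i \<cdot> s1, f) \<in> triples E D Z"
    unfolding triples_iff using w(3) f_dom X(5) by simp
  have \<gamma>i: "Comp St (cls (w, i \<cdot> s1, f)) (sg i) = \<alpha>"
  proof -
    obtain v0 v1 l where v: "(v0, v1, l) \<in> triples E D Z"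
      "Comp St (cls (w, i \<cdot> s1, f)) (sg i) = cls (v0, v1, l)"
      "pts E v1 = {z \<in> Arr E. Cod E z = Dom E i \<and> i \<cdot> z \<in> pts E (i \<cdot> s1)}"
      "\<And>z. z \<in> pts E v1 \<Longrightarrow> ap E v1 l z = ap E (i \<cdot> s1) f (i \<cdot> z)"
      by (rule cls_comp_sg[OF wt, of i]) (use I f_dom in auto)
    have eq: "pts E v1 = pts E s1"
      using v(3) pts_cancel[of i s1] I X dc by simp
    have "cls (v0, v1, l) = cls (s0, s1, f)"
    proof (rule cls_eqI[OF v(1) s(1) eq])
      fix z assume z: "z \<in> pts E v1"
      have "fac E i (i \<cdot> z) = z"
        by (rule fac_unique) (use z v(3) I in simp_all)
      then show "ap E v1 l z = ap E s1 f z"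
        using v(3,4) z Q1(3)[of "i \<cdot> z" f] by simp
    qed
    then show ?thesis
      using v(2) s(2) by simp
  qed
  have \<gamma>j: "Comp St (cls (w, i \<cdot> s1, f)) (sg j) = \<beta>"
  proof -
    obtain v0 v1 l where v: "(v0, v1, l) \<in> triples E D Z"
      "Comp St (cls (w, i \<cdot> s1, f)) (sg j) = cls (v0, v1, l)"
      "Cod E v1 = Dom E j" "Cod E l = Cod E f"
      "pts E v1 = {z \<in> Arr E. Cod E z = Dom E j \<and> j \<cdot> z \<in> pts E (i \<cdot> s1)}"
      "\<And>z. z \<in> pts E v1 \<Longrightarrow> ap E v1 l z = ap E (i \<cdot> s1) f (j \<cdot> z)"
      by (rule cls_comp_sg[OF wt, of j]) (use I f_dom in auto)
    note V = tripleD[OF v(1)]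
    have vv: "v1 \<in> pts E v1"
      using V by simp
    have "ap E v1 l v1 \<in> Z"
      using v(5) v(6)[OF vv] vv trivj[of "j \<cdot> v1"] pts_I[of j v1] I by auto
    then have "l \<in> Z"
      using V by simp
    then have "cls (v0, v1, l) = cls (t0, t1, g)"
      by (intro zero_cls_eq[OF v(1) t(1)]) (use v dc gZ in simp_all)
    then show ?thesis
      using v(2) t(2) by simp
  qed
  have uniq: "\<gamma> = \<gamma>'"
    if g1: "\<gamma> \<in> hom St A B" "Comp St \<gamma> (sg i) = \<alpha>" "Comp St \<gamma> (sg j) = \<beta>"
      and g2: "\<gamma>' \<in> hom St A B" "Comp St \<gamma>' (sg i) = \<alpha>" "Comp St \<gamma>' (sg j) = \<beta>" for \<gamma> \<gamma>'
  proof -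
    obtain h0 h1 h where h: "(h0, h1, h) \<in> triples E D Z" "\<gamma> = cls (h0, h1, h)"
      using g1 by (auto elim: Stab_arrE)
    obtain k0 k1 k where k: "(k0, k1, k) \<in> triples E D Z" "\<gamma>' = cls (k0, k1, k)"
      using g2 by (auto elim: Stab_arrE)
    note HT = tripleD[OF h(1)] and KT = tripleD[OF k(1)]
    have hc: "Cod E h1 = A" "Cod E h = B" "Cod E k1 = A" "Cod E k = B"
      using g1 g2 Stab_Dom[OF h(1)] Stab_Dom[OF k(1)] h(2) k(2) by auto
    obtain v0 v1 l where v: "(v0, v1, l) \<in> triples E D Z"
      "Comp St (cls (h0, h1, h)) (sg i) = cls (v0, v1, l)"
      "Cod E v1 = Dom E i" "pts E v1 = {z \<in> Arr E. Cod E z = Dom E i \<and> i \<cdot> z \<in> pts E h1}"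
      "\<And>z. z \<in> pts E v1 \<Longrightarrow> ap E v1 l z = ap E h1 h (i \<cdot> z)"
      by (rule cls_comp_sg[OF h(1), of i]) (use I hc in auto)
    obtain r0 r1 m where r: "(r0, r1, m) \<in> triples E D Z"
      "Comp St (cls (k0, k1, k)) (sg i) = cls (r0, r1, m)"
      "pts E r1 = {z \<in> Arr E. Cod E z = Dom E i \<and> i \<cdot> z \<in> pts E k1}"
      "\<And>z. z \<in> pts E r1 \<Longrightarrow> ap E r1 m z = ap E k1 k (i \<cdot> z)"
      by (rule cls_comp_sg[OF k(1), of i]) (use I hc in auto)
    have "eqv (v0, v1, l) (r0, r1, m)"
      using cls_eq[OF v(1) r(1)] g1 g2 h(2) k(2) v(2) r(2) by simp
    then obtain u0 u1 where u: "eqv_on u0 u1 (v0, v1, l) (r0, r1, m)"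
      by (rule eqvE)
    note u = eqv_onD(3-8)[OF u]
    have cu: "covers (Dom E i) u0 u1"
      using u(1) v(3) by simp
    note U = coversD[OF cu]
    note R0 = D_comp_pts[OF I(2) U(2,4)] and R1 = D_comp_pts[OF I(2) U(3,5)]
    \<comment> \<open>Every solution has trivial values on \<open>j\<close>, because its composite
      with \<open>sg j\<close> is the trivial arrow \<open>\<beta>\<close>.\<close>
    have onj: "ap E c1 c z \<in> Z"
      if c: "(c0, c1, c) \<in> triples E D Z" "Cod E c1 = A" "Comp St (cls (c0, c1, c)) (sg j) = \<beta>"
        and z: "z \<in> pts E j" "z \<in> pts E c1" for c0 c1 c z
    proof -
      obtain d0 d1 d where d: "(d0, d1, d) \<in> triples E D Z"
        "Comp St (cls (c0, c1, c)) (sg j) = cls (d0, d1, d)"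
        "pts E d1 = {z \<in> Arr E. Cod E z = Dom E j \<and> j \<cdot> z \<in> pts E c1}"
        "\<And>z. z \<in> pts E d1 \<Longrightarrow> ap E d1 d z = ap E c1 c (j \<cdot> z)"
        by (rule cls_comp_sg[OF c(1), of j]) (use I c in auto)
      have dZ: "d \<in> Z"
        using trivial_cls[OF d(1)] d(2) c(3) zero by simp
      have zd: "fac E j z \<in> pts E d1"
        using d(3) z I by simp
      have "ap E d1 d (fac E j z) \<in> Z"
        unfolding ap_def using dZ by (rule Z_comp_right) (use zd tripleD[OF d(1)] in simp_all)
      then show ?thesis
        using d(4)[OF zd] z I by simp
    qed
    obtain b where b: "b \<in> D" "is_union E (i \<cdot> u0) j b" "covers A b (i \<cdot> u1)"
      by (rule covers_extend[OF cov cu])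
    have "eqv (h0, h1, h) (k0, k1, k)"
    proof (rule eqvI[of _ _ _ _ b "i \<cdot> u1"])
      show "covers (Cod E h1) b (i \<cdot> u1)"
        using b hc by simp
      have pt: "fac E i z \<in> pts E u1" "fac E i z \<in> pts E v1" "fac E i z \<in> pts E r1"
        "i \<cdot> fac E i z = z"
        if "z \<in> pts E (i \<cdot> u1)" for z
        using that R1(2) u(2,3) I by auto
      show "pts E (i \<cdot> u1) \<subseteq> pts E h1"
        using pt v(4) by force
      show "pts E (i \<cdot> u1) \<subseteq> pts E k1"
        using pt r(3) by force
      show "ap E h1 h z = ap E k1 k z" if "z \<in> pts E (i \<cdot> u1)" for z
        using pt[OF that] v(5)[of "fac E i z"] r(4)[of "fac E i z"] u(4)[of "fac E i z"] by simp
      show "ap E h1 h z \<in> Z" if z: "z \<in> pts E b" "z \<in> pts E h1" for z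
      proof (rule union_ap_Z[OF R0(1) I(3) b(2) HT(3,5,6) z(2,1)])
        fix x assume zx: "z \<cdot> x \<in> pts E h1"
        show "ap E h1 h (z \<cdot> x) \<in> Z" if "z \<cdot> x \<in> pts E (i \<cdot> u0)"
        proof -
          have zi: "z \<cdot> x \<in> pts E i" "fac E i (z \<cdot> x) \<in> pts E u0"
            using that R0(2) by auto
          then have "fac E i (z \<cdot> x) \<in> pts E v1"
            using v(4) zx I by simp
          then show ?thesis
            using u(5)[OF zi(2)] v(5)[of "fac E i (z \<cdot> x)"] zi I by simp
        qed
        show "ap E h1 h (z \<cdot> x) \<in> Z" if "z \<cdot> x \<in> pts E j"
          by (rule onj[OF h(1) hc(1) _ that zx]) (use g1 h in simp)
      qed
      show "ap E k1 k z \<in> Z" if z: "z \<in> pts E b" "z \<in> pts E k1" for z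
      proof (rule union_ap_Z[OF R0(1) I(3) b(2) KT(3,5,6) z(2,1)])
        fix x assume zx: "z \<cdot> x \<in> pts E k1"
        show "ap E k1 k (z \<cdot> x) \<in> Z" if "z \<cdot> x \<in> pts E (i \<cdot> u0)"
        proof -
          have zi: "z \<cdot> x \<in> pts E i" "fac E i (z \<cdot> x) \<in> pts E u0"
            using that R0(2) by auto
          then have "fac E i (z \<cdot> x) \<in> pts E r1"
            using r(3) zx I by simp
          then show ?thesis
            using u(6)[OF zi(2)] r(4)[of "fac E i (z \<cdot> x)"] zi I by simp
        qed
        show "ap E k1 k (z \<cdot> x) \<in> Z" if "z \<cdot> x \<in> pts E j"
          by (rule onj[OF k(1) hc(3) _ that zx]) (use g2 k in simp)
      qed
    qed (use hc in simp_all)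
    then show ?thesis
      using cls_eq[OF h(1) k(1)] h(2) k(2) by simp
  qed
  show ?thesis
  proof (rule ex_ex1I)
    have "cls (w, i \<cdot> s1, f) \<in> hom St A B"
      using cls_arr[OF wt] Stab_Dom[OF wt] f_dom dc by simp
    then show "\<exists>\<gamma>. \<gamma> \<in> hom St A B \<and> Comp St \<gamma> (sg i) = \<alpha> \<and> Comp St \<gamma> (sg j) = \<beta>"
      using \<gamma>i \<gamma>j by blast
  qed (use uniq in blast)
qed

text \<open>\<open>union_local\<close> at the generic element \<open>u\<close> turns a union into a
  cover of its own domain: the inverse images of \<open>s\<close> and \<open>t\<close> along
  \<open>u\<close> are \<open>i\<close> and \<open>j\<close>.\<close>

lemma union_factors:
  assumes s: "s \<in> D" and t: "t \<in> D" and u: "is_union E s t u"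
    and i: "i \<in> hom E (Dom E s) (Dom E u)" "u \<cdot> i = s" and j: "j \<in> hom E (Dom E t) (Dom E u)"
      "u \<cdot> j = t"
  shows "covers (Dom E u) i j"
proof -
  have mu: "is_mono E u"
    using u by (simp add: is_union_pts)
  have uu: "u \<in> pts E u"
    using mu by simp
  obtain a b where ab: "a \<in> D" "b \<in> D" "is_union E a b (Ident E (Dom E u))"
    "pts E a = {x \<in> Arr E. Cod E x = Dom E u \<and> u \<cdot> x \<in> pts E s}"
    "pts E b = {x \<in> Arr E. Cod E x = Dom E u \<and> u \<cdot> x \<in> pts E t}"
    by (rule union_local[OF s t u uu])
  have "i \<in> D"
    by (rule D_cancel[OF mu]) (use s i in simp_all)
  moreover have "j \<in> D"
    by (rule D_cancel[OF mu]) (use t j in simp_all)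
  moreover have "pts E i = pts E a" "pts E j = pts E b"
    using pts_cancel[OF mu, of i] pts_cancel[OF mu, of j] ab i j by simp_all
  ultimately have "i \<in> D" "j \<in> D" "is_union E i j (Ident E (Dom E u))"
    using is_union_same[OF ab(3), of i j "Ident E (Dom E u)"] mono_ident mu by simp_all
  then show ?thesis
    unfolding covers_def using i j mu by simp
qed

lemma stab_functor_zero_pushouts: "zero_pushouts_of_unions E D St \<sigma>"
  unfolding zero_pushouts_of_unions_def
proof (intro ballI allI impI, elim conjE)
  fix s t p q u i j
  assume s: "s \<in> D" and t: "t \<in> D" and pb: "is_pullback E s t p q" and u: "is_union E s t u"
    and i: "i \<in> hom E (Dom E s) (Dom E u)" "u \<cdot> i = s" and j: "j \<in> hom E (Dom E t) (Dom E u)"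
      "u \<cdot> j = t"
  have cov: "covers (Dom E u) i j"
    by (rule union_factors[OF s t u i j])
  note I = coversD[OF cov]
  note P = pullbackD[OF pb]
  have mu: "is_mono E u"
    using u by (simp add: is_union_pts)
  have d: "Dom E i = Dom E s" "Dom E j = Dom E t"
    using i j by simp_all
  have "u \<cdot> (i \<cdot> p) = (u \<cdot> i) \<cdot> p"
    by (rule assoc[symmetric]) (use P(1-8) I d mu in simp_all)
  also have "\<dots> = (u \<cdot> j) \<cdot> q"
    using P(9) i j by simp
  also have "\<dots> = u \<cdot> (j \<cdot> q)"
    by (rule assoc) (use P(1-8) I d mu in simp_all)
  finally have ij: "i \<cdot> p = j \<cdot> q"
    by (rule monoD[OF mu]) (use P(1-8) I d in simp_all)
  have lift: "\<exists>h\<in>Arr E. Cod E h = Dom E p \<and> p \<cdot> h = x \<and> q \<cdot> h = y"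
    if xy: "x \<in> Arr E" "y \<in> Arr E" "Dom E x = Dom E y" "Cod E x = Dom E i" "Cod E y = Dom E j"
      "i \<cdot> x = j \<cdot> y" for x y
  proof -
    have "(u \<cdot> i) \<cdot> x = u \<cdot> (i \<cdot> x)"
      by (rule assoc) (use xy(1-5) I mu in simp_all)
    also have "\<dots> = u \<cdot> (j \<cdot> y)"
      using xy(6) by simp
    also have "\<dots> = (u \<cdot> j) \<cdot> y"
      by (rule assoc[symmetric]) (use xy(1-5) I mu in simp_all)
    finally have "s \<cdot> x = t \<cdot> y"
      using i j by simp
    then obtain h where "h \<in> Arr E" "Cod E h = Dom E p" "p \<cdot> h = x" "q \<cdot> h = y"
      by (rule pullback_lift[OF pb xy(1-3), rotated 2]) (use xy d in simp_all)
    then show ?thesis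
      by blast
  qed
  have main: "\<exists>!\<gamma>. \<gamma> \<in> hom St (Dom E u) B \<and> Comp St \<gamma> (sg i) = \<alpha> \<and> Comp St \<gamma> (sg j) = \<beta>"
    if h: "\<alpha> \<in> hom St (Dom E i) B" "\<beta> \<in> hom St (Dom E j) B" "Comp St \<alpha> (sg p) = Comp St \<beta> (sg q)"
      "\<alpha> \<in> trivials St T F \<or> \<beta> \<in> trivials St T F" for \<alpha> \<beta> B
    using h(4)
  proof
    assume z: "\<beta> \<in> trivials St T F"
    show ?thesis
      by (rule zero_pushout_extend[OF cov _ _ _ _ _ _ h(1-3) z]) (use P(1-8) d lift in auto)
  next
    assume z: "\<alpha> \<in> trivials St T F"
    \<comment> \<open>\<open>zero_pushout_extend\<close> treats a trivial arrow on the second leg;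
      this is the mirror case with the legs exchanged.\<close>
    have "\<exists>!\<gamma>. \<gamma> \<in> hom St (Dom E u) B \<and> Comp St \<gamma> (sg j) = \<beta> \<and> Comp St \<gamma> (sg i) = \<alpha>"
    proof (rule zero_pushout_extend[OF covers_sym[OF cov] _ _ _ _ _ _ h(2,1) h(3)[symmetric] z])
      show "\<exists>h\<in>Arr E. Cod E h = Dom E q \<and> q \<cdot> h = x"
        if "x \<in> Arr E" "y \<in> Arr E" "Dom E x = Dom E y" "Cod E x = Dom E j" "Cod E y = Dom E i"
          "j \<cdot> x = i \<cdot> y" for x y
        using lift[of y x] that P(7) by auto
    qed (use P(1-8) d in simp_all)
    then show ?thesis
      by (simp add: conj_commute)
  qed
  have arr: "FArr \<sigma> p = sg p" "FArr \<sigma> q = sg q" "FArr \<sigma> i = sg i" "FArr \<sigma> j = sg j"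
    using P i j by simp_all
  have S: "sg p \<in> Arr St" "sg q \<in> Arr St" "Dom St (sg p) = Dom E p" "Dom St (sg q) = Dom E p"
    "Cod St (sg p) = Dom E i" "Cod St (sg q) = Dom E j" "sg i \<in> hom St (Dom E i) (Dom E u)"
    "sg j \<in> hom St (Dom E j) (Dom E u)" "Cod St (sg i) = Dom E u"
    using sg_simps[OF P(3)] sg_simps[OF P(4)] sg_simps[of i] sg_simps[of j]
      P(5-7) I(2-5) d by simp_all
  have "Comp St (sg i) (sg p) = Comp St (sg j) (sg q)"
    using sg_comp[of p i] sg_comp[of q j] P(1-8) I d ij by simp
  then show "zero_pushout St (FArr \<sigma> p) (FArr \<sigma> q) (FArr \<sigma> i) (FArr \<sigma> j)"
    unfolding zero_pushout_def arr S torsion_theory.zero_arr_iff[OF Stab_torsion_theory]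
    by (intro conjI allI ballI impI S main refl) (assumption | (erule conjE, assumption))+
qed

lemma stab_functor_stable: "stable_functor_into E D T F St T F \<sigma>"
  unfolding stable_functor_into_def
  using Stab_torsion_theory stab_functor_torsion stab_functor_zero_pushouts by blast

end

section \<open>The universal property\<close>

context torsion_theory
begin

section \<open>Zero arrows of a torsion theory\<close>

lemma trivials_eq:
  assumes "f \<in> trivials C T F" "g \<in> trivials C T F" "Dom C f = Dom C g" "Cod C f = Cod C g"
  shows "f = g"
proof -
  from assms(1) obtain a b where f: "a \<in> Arr C" "b \<in> Arr C" "Cod C a = Dom C b" "Cod C a \<in> T \<inter> F"
    "f = b \<cdot> a"
    and f': "Dom C a = Dom C f" "Cod C b = Cod C f"
    by (rule factoring_E)
  from assms(2) obtain a' b' where g: "a' \<in> Arr C" "b' \<in> Arr C" "Cod C a' = Dom C b'"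
    "Cod C a' \<in> T \<inter> F" "g = b' \<cdot> a'"
    and g': "Dom C a' = Dom C g" "Cod C b' = Cod C g"
    by (rule factoring_E)
  have N: "zero_obj C (Dom C b)" "zero_obj C (Dom C b')"
    using trivial_zero f(3,4) g(3,4) by auto
  then obtain c where c: "c \<in> Arr C" "Dom C c = Dom C b" "Cod C c = Dom C b'"
    using f(2) g(2) unfolding zero_obj_def initial_obj_def by (meson in_hom_iff obj_simps(1))
  have dom: "Dom C a = Dom C a'" "Cod C b = Cod C b'"
    using assms(3,4) f' g' by simp_all
  have "c \<cdot> a \<in> hom C (Dom C a) (Dom C b')" "a' \<in> hom C (Dom C a) (Dom C b')" "Dom C a \<in> Obj C"
    using f(1-3) g(1-3) c dom by simp_all
  then have 1: "c \<cdot> a = a'"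
    using N(2) unfolding zero_obj_def terminal_obj_def by blast
  have "b' \<cdot> c \<in> hom C (Dom C b) (Cod C b)" "b \<in> hom C (Dom C b) (Cod C b)" "Cod C b \<in> Obj C"
    using f(1-3) g(1-3) c dom by simp_all
  then have 2: "b' \<cdot> c = b"
    using N(1) unfolding zero_obj_def initial_obj_def by blast
  have "f = (b' \<cdot> c) \<cdot> a"
    using 2 f(5) by simp
  also have "\<dots> = b' \<cdot> (c \<cdot> a)"
    by (rule assoc) (use f(1-3) g(1-3) c in simp_all)
  finally show ?thesis
    using 1 g(5) by simp
qed

lemma trivial_between:
  assumes "N \<in> T \<inter> F" "A \<in> Obj C" "B \<in> Obj C"
  obtains f where "f \<in> trivials C T F" "f \<in> Arr C" "Dom C f = A" "Cod C f = B"
proof -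
  have "zero_obj C N"
    using trivial_zero assms by blast
  then obtain a b where ab: "a \<in> hom C A N" "b \<in> hom C N B"
    using assms unfolding zero_obj_def initial_obj_def terminal_obj_def by blast
  show thesis
    by (rule that[of "b \<cdot> a"]) (use ab assms(1) factoring_I[of a b "T \<inter> F"] in auto)
qed

end

section \<open>Functors, isomorphisms and ideals\<close>

lemma functorD:
  assumes "is_functor C C' H"
  shows "category C" "category C'" "FObj H \<in> Obj C \<rightarrow>\<^sub>E Obj C'" "FArr H \<in> Arr C \<rightarrow>\<^sub>E Arr C'"
    "A \<in> Obj C \<Longrightarrow> FObj H A \<in> Obj C'"
    "f \<in> Arr C \<Longrightarrow> FArr H f \<in> Arr C'"
    "f \<in> Arr C \<Longrightarrow> Dom C' (FArr H f) = FObj H (Dom C f)"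
    "f \<in> Arr C \<Longrightarrow> Cod C' (FArr H f) = FObj H (Cod C f)"
    "A \<in> Obj C \<Longrightarrow> FArr H (Ident C A) = Ident C' (FObj H A)"
    "f \<in> Arr C \<Longrightarrow> g \<in> Arr C \<Longrightarrow> Dom C g = Cod C f \<Longrightarrow>
       FArr H (g \<cdot>\<^bsub>C\<^esub> f) = FArr H g \<cdot>\<^bsub>C'\<^esub> FArr H f"
  using assms unfolding is_functor_def by (auto simp: hom_def)

lemma functor_iso:
  assumes "is_functor C C' H" "is_iso C f"
  shows "is_iso C' (FArr H f)"
proof -
  note H = functorD[OF assms(1)]
  interpret C: category C by (rule H(1))
  interpret C': category C' by (rule H(2))
  from assms(2) obtain g where g: "f \<in> Arr C" "g \<in> Arr C" "Dom C g = Cod C f" "Cod C g = Dom C f"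
    "g \<cdot>\<^bsub>C\<^esub> f = Ident C (Dom C f)" "f \<cdot>\<^bsub>C\<^esub> g = Ident C (Cod C f)"
    by (rule C.isoE)
  show ?thesis
    by (rule C'.isoI[of _ "FArr H g"])
      (use g H(6-8) H(10)[of f g] H(10)[of g f] H(9)[of "Dom C f"] H(9)[of "Cod C f"] in simp_all)
qed

lemma functor_trivials:
  assumes "is_functor C C' H" "f \<in> factoring C N" "FObj H ` N \<subseteq> N'"
  shows "FArr H f \<in> factoring C' N'"
proof -
  note H = functorD[OF assms(1)]
  interpret C: category C by (rule H(1))
  interpret C': category C' by (rule H(2))
  from assms(2) obtain g h where gh: "g \<in> Arr C" "h \<in> Arr C" "Cod C g = Dom C h" "Cod C g \<in> N"
    "f = h \<cdot>\<^bsub>C\<^esub> g"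
    by (rule C.factoring_E) blast
  have "FArr H h \<cdot>\<^bsub>C'\<^esub> FArr H g \<in> factoring C' N'"
    by (rule C'.factoring_I) (use gh H(6-8) assms(3) in auto)
  then show ?thesis
    using H(10)[of g h] gh by simp
qed

section \<open>Functors with the properties characterizing the stable category\<close>

locale stable_functor = compatible E zero D T F + X: torsion_theory X TX FX
  for E :: "('o, 'm) cat" (structure) and zero :: 'o and D :: "'m set" and T F :: "'o set"
    and X :: "('p, 'q) cat" and TX FX :: "'p set" +
  fixes H :: "('o, 'm, 'p, 'q) fctr"
  assumes H_torsion: "torsion_functor E T F X TX FX H"
    and H_zero_pushouts: "zero_pushouts_of_unions E D X H"
begin

interpretation St: category St
  by (rule Stab_category)

lemma H_functor: "is_functor E X H"
  using H_torsion by (simp add: torsion_functor_def)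

lemmas H_simps = functorD(5-10)[OF H_functor]

lemma H_trivial: "f \<in> Z \<Longrightarrow> FArr H f \<in> X.Z"
  by (rule functor_trivials[OF H_functor]) (use H_torsion in \<open>auto simp: torsion_functor_def\<close>)

text \<open>The property of unions read for a cover, where the union is the identity of
  \<open>A\<close> and the legs are \<open>s\<close> and \<open>t\<close> themselves.\<close>

lemma H_pushout:
  assumes cov: "covers A s t"
    and m: "m \<in> Arr X" "Dom X m = FObj H (Dom E s)" "Cod X m = B"
    and n: "n \<in> Arr X" "Dom X n = FObj H (Dom E t)" "Cod X n = B" and zero: "m \<in> X.Z"
    and p: "is_pullback E s t p q" and eq: "Comp X m (FArr H p) = Comp X n (FArr H q)"
  shows "\<exists>!h. h \<in> hom X (FObj H A) B \<and> Comp X h (FArr H s) = m \<and> Comp X h (FArr H t) = n"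
proof -
  note S = coversD[OF cov]
  note P = pullbackD[OF p]
  have 1: "is_union E s t (Ident E A)" "s \<in> hom E (Dom E s) (Dom E (Ident E A))" "Ident E A \<cdot> s = s"
    "t \<in> hom E (Dom E t) (Dom E (Ident E A))" "Ident E A \<cdot> t = t"
    using S by simp_all
  have "zero_pushout X (FArr H p) (FArr H q) (FArr H s) (FArr H t)"
    using H_zero_pushouts S(2,3) p 1 unfolding zero_pushouts_of_unions_def by blast
  moreover have "Cod X (FArr H p) = FObj H (Dom E s)" "Cod X (FArr H q) = FObj H (Dom E t)"
    "Cod X (FArr H s) = FObj H A"
    using P(3-6) S H_simps by simp_all
  moreover have "m \<in> hom X (FObj H (Dom E s)) B" "n \<in> hom X (FObj H (Dom E t)) B"
    using m n by simp_all
  ultimately show ?thesis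
    using eq zero unfolding zero_pushout_def X.zero_arr_iff by simp
qed

text \<open>The restrictions to \<open>s\<close> are both trivial, hence equal, since parallel
  trivial arrows coincide in a torsion theory; the uniqueness clause of the zero-pushout then
  applies.\<close>

lemma H_zero_unique:
  assumes cov: "covers A s t"
    and h: "h \<in> Arr X" "Dom X h = FObj H A" and h': "h' \<in> Arr X" "Dom X h' = FObj H A"
      "Cod X h = Cod X h'"
    and s: "Comp X h (FArr H s) \<in> X.Z" "Comp X h' (FArr H s) \<in> X.Z"
    and t: "Comp X h (FArr H t) = Comp X h' (FArr H t)"
  shows "h = h'"
proof -
  note S = coversD[OF cov]
  obtain p q where p: "is_pullback E s t p q"
    using CS3[of t s] S by auto
  note P = pullbackD[OF p]
  have HS: "FArr H s \<in> Arr X" "FArr H t \<in> Arr X" "Dom X (FArr H s) = FObj H (Dom E s)"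
    "Dom X (FArr H t) = FObj H (Dom E t)" "Cod X (FArr H s) = FObj H A"
    "Cod X (FArr H t) = FObj H A"
    using H_simps S by simp_all
  have eq: "Comp X h (FArr H s) = Comp X h' (FArr H s)"
    by (rule X.trivials_eq[OF s]) (use HS h h' in simp_all)
  have "Comp X (Comp X h (FArr H s)) (FArr H p) = Comp X h (FArr H (s \<cdot> p))"
    using H_simps(6)[of p s] H_simps(2-4)[of p] P(1-8) HS h by (simp add: X.assoc)
  also have "\<dots> = Comp X (Comp X h (FArr H t)) (FArr H q)"
    using H_simps(6)[of q t] H_simps(2-4)[of q] P HS h by (simp add: X.assoc)
  finally have sq: "Comp X (Comp X h (FArr H s)) (FArr H p)
    = Comp X (Comp X h (FArr H t)) (FArr H q)" .
  have "\<exists>!k. k \<in> hom X (FObj H A) (Cod X h) \<and> Comp X k (FArr H s) = Comp X h (FArr H s) \<and>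
      Comp X k (FArr H t) = Comp X h (FArr H t)"
    by (rule H_pushout[OF cov _ _ _ _ _ _ s(1) p sq]) (use HS h in simp_all)
  moreover have "h \<in> hom X (FObj H A) (Cod X h)" "h' \<in> hom X (FObj H A) (Cod X h)"
    using h h' by simp_all
  ultimately show ?thesis
    using eq t by metis
qed

text \<open>The counterpart of CC2 in \<open>X\<close>, obtained by comparing \<open>h\<close> with
  the zero arrow through \<open>H_zero_unique\<close>.\<close>

lemma H_zero_on_cover:
  assumes cov: "covers A s t" and h: "h \<in> Arr X" "Dom X h = FObj H A"
    and s: "Comp X h (FArr H s) \<in> X.Z" and t: "Comp X h (FArr H t) \<in> X.Z"
  shows "h \<in> X.Z"
proof -
  note S = coversD[OF cov]
  have HS: "FArr H s \<in> Arr X" "FArr H t \<in> Arr X" "Cod X (FArr H s) = FObj H A"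
    "Cod X (FArr H t) = FObj H A"
    using H_simps S by simp_all
  have "FObj H zero \<in> TX \<inter> FX"
    using zero_trivial H_torsion by (auto simp: torsion_functor_def)
  then obtain n where n: "n \<in> X.Z" "n \<in> Arr X" "Dom X n = FObj H A" "Cod X n = Cod X h"
    by (rule X.trivial_between[of _ "FObj H A" "Cod X h"]) (use S H_simps h in auto)
  have ns: "Comp X n (FArr H s) \<in> X.Z" "Comp X n (FArr H t) \<in> X.Z"
    using X.Z_comp_right[OF n(1)] HS n by simp_all
  have "Comp X h (FArr H t) = Comp X n (FArr H t)"
    by (rule X.trivials_eq[OF t ns(2)]) (use HS h n in simp_all)
  then have "h = n"
    using H_zero_unique[OF cov h n(2,3) _ s ns(1)] n by simp
  then show ?thesis
    using n by simp
qed

text \<open>Inside its own domain \<open>u\<close> is a cover, by \<open>union_factors\<close>, so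
  the restriction of \<open>h\<close> along \<open>u\<close> falls under
  \<open>H_zero_on_cover\<close>.\<close>

lemma H_zero_on_union:
  assumes "s \<in> D" "t \<in> D" "is_union E s t u" and h: "h \<in> Arr X" "Dom X h = FObj H (Cod E u)"
    and s: "Comp X h (FArr H s) \<in> X.Z" and t: "Comp X h (FArr H t) \<in> X.Z"
  shows "Comp X h (FArr H u) \<in> X.Z"
proof -
  have mu: "is_mono E u" and su: "s \<in> pts E u" "t \<in> pts E u"
    using assms(1-3) pts_self[of s] pts_self[of t] by (auto simp: is_union_pts)
  have cov: "covers (Dom E u) (fac E u s) (fac E u t)"
    by (rule union_factors[OF assms(1-3)]) (use mu su in simp_all)
  note C = coversD[OF cov]
  have cod: "Cod E s = Cod E u" "Cod E t = Cod E u"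
    using su pts_cod by auto
  have HU: "FArr H u \<in> Arr X" "Dom X (FArr H u) = FObj H (Dom E u)"
    "Cod X (FArr H u) = FObj H (Cod E u)"
    using H_simps mu by simp_all
  have *: "Comp X (Comp X h (FArr H u)) (FArr H (fac E u x)) = Comp X h (FArr H x)"
    if "x \<in> pts E u" for x
  proof -
    have "Comp X (Comp X h (FArr H u)) (FArr H (fac E u x))
      = Comp X h (Comp X (FArr H u) (FArr H (fac E u x)))"
      by (rule X.assoc) (use HU h that mu H_simps in simp_all)
    also have "\<dots> = Comp X h (FArr H (u \<cdot> fac E u x))"
      using H_simps(6)[of "fac E u x" u] mu that by (simp del: fac_simps(4))
    finally show ?thesis
      using mu that by simp
  qed
  show ?thesis
    by (rule H_zero_on_cover[OF cov]) (use HU h * su s t in simp_all)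
qed

text \<open>The value required on a triple, kept as a relation: existence is a matter of
  zero-pushouts, and uniqueness has to hold across equivalent triples.\<close>

definition extends :: "'m triple \<Rightarrow> 'q \<Rightarrow> bool" where
  "extends = (\<lambda>(s0, s1, f) h. h \<in> hom X (FObj H (Cod E s1)) (FObj H (Cod E f)) \<and>
     Comp X h (FArr H s1) = FArr H f \<and> Comp X h (FArr H s0) \<in> X.Z)"

text \<open>The zero-pushout is applied to \<open>FArr H f\<close> and the zero arrow on
  \<open>s0\<close>. They agree on the meet because \<open>f\<close> is trivial there and parallel
  trivial arrows of \<open>X\<close> coincide.\<close>

lemma extends_exists:
  assumes x: "(s0, s1, f) \<in> triples E D Z"
  obtains h where "extends (s0, s1, f) h"
proof -
  note S = tripleD[OF x]
  obtain p q where p: "is_pullback E s0 s1 p q"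
    using CS3[of s1 s0] S by auto
  note P = pullbackD[OF p]
  have "FObj H zero \<in> TX \<inter> FX"
    using zero_trivial H_torsion by (auto simp: torsion_functor_def)
  then obtain n where n: "n \<in> X.Z" "n \<in> Arr X" "Dom X n = FObj H (Dom E s0)"
    "Cod X n = FObj H (Cod E f)"
    by (rule X.trivial_between[of _ "FObj H (Dom E s0)" "FObj H (Cod E f)"]) (use S H_simps in auto)
  have fq: "f \<cdot> q \<in> Z"
    using trivial_on_meet_iff[of s0 s1 f] S p unfolding trivial_on_meet_def by auto
  have HQ: "Comp X (FArr H f) (FArr H q) = FArr H (f \<cdot> q)"
    using H_simps(6)[of q f] P(1-8) S by simp
  have HP: "FArr H p \<in> Arr X" "Cod X (FArr H p) = FObj H (Dom E s0)"
    "Dom X (FArr H p) = FObj H (Dom E p)"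
    using H_simps P(1-8) by simp_all
  have FQ: "FArr H (f \<cdot> q) \<in> Arr X" "Cod X (FArr H (f \<cdot> q)) = FObj H (Cod E f)"
     "Dom X (FArr H (f \<cdot> q)) = FObj H (Dom E p)"
    using H_simps(2-4)[of "f \<cdot> q"] P(1-8) S by simp_all
  have "Comp X n (FArr H p) \<in> X.Z"
    using X.Z_comp_right[OF n(1)] HP n by simp
  then have eq: "Comp X n (FArr H p) = Comp X (FArr H f) (FArr H q)"
    unfolding HQ by (rule X.trivials_eq[OF _ H_trivial[OF fq]]) (use HP FQ n in simp_all)
  have "\<exists>!h. h \<in> hom X (FObj H (Cod E s1)) (FObj H (Cod E f)) \<and> Comp X h (FArr H s0) = n \<and>
      Comp X h (FArr H s1) = FArr H f"
    by (rule H_pushout[OF S(1) n(2-4) _ _ _ n(1) p eq]) (use S H_simps in simp_all)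
  then show thesis
    using that n(1) unfolding extends_def by auto
qed

lemma extends_eqv:
  assumes x: "(s0, s1, f) \<in> triples E D Z" and y: "(t0, t1, g) \<in> triples E D Z"
    and e: "eqv (s0, s1, f) (t0, t1, g)" and h: "extends (s0, s1, f) h" and h': "extends (t0, t1, g)
      h'"
  shows "h = h'"
proof -
  \<comment> \<open>Stated for one triple and any cover suited to it, so as to serve for both
    triples; \<open>H_zero_unique\<close> for this cover then identifies the two arrows.\<close>
  have main: "Comp X h (FArr H u1) = FArr H (ap E s1 f u1) \<and> Comp X h (FArr H u0) \<in> X.Z"
    if x: "(s0, s1, f) \<in> triples E D Z" and h: "extends (s0, s1, f) h"
      and cov: "covers (Cod E s1) u0 u1" and u1: "u1 \<in> pts E s1"
      and u0: "\<And>z. z \<in> pts E u0 \<Longrightarrow> z \<in> pts E s1 \<Longrightarrow> ap E s1 f z \<in> Z" for s0 s1 f u0 u1 h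
  proof -
    note S = tripleD[OF x] and U = coversD[OF cov]
    have hh: "h \<in> Arr X" "Dom X h = FObj H (Cod E s1)" "Comp X h (FArr H s1) = FArr H f"
      "Comp X h (FArr H s0) \<in> X.Z"
      using h by (auto simp: extends_def)
    have split: "Comp X h (FArr H z) = Comp X (Comp X h (FArr H s)) (FArr H (fac E s z))"
      if "s \<in> D" "Cod E s = Cod E s1" "z \<in> pts E s" for s z
    proof -
      have "FArr H z = Comp X (FArr H s) (FArr H (fac E s z))"
        using H_simps(6)[of "fac E s z" s] that by simp
      moreover have "Comp X (Comp X h (FArr H s)) (FArr H (fac E s z))
        = Comp X h (Comp X (FArr H s) (FArr H (fac E s z)))"
        by (rule X.assoc) (use hh that H_simps in simp_all)
      ultimately show ?thesis
        by simp
    qed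
    have on1: "Comp X h (FArr H z) = FArr H (ap E s1 f z)" if "z \<in> pts E s1" for z
      using split[OF S(3) refl that] hh(3) H_simps(6)[of "fac E s1 z" f] that S
        by (simp add: ap_def)
    \<comment> \<open>\<open>u0\<close> is the union of its intersections with \<open>s0\<close> and
      \<open>s1\<close>. On the first \<open>h\<close> is zero because it is so on
      \<open>s0\<close>; on the second it is the image under \<open>H\<close> of a trivial
      arrow.\<close>
    obtain a where a: "a \<in> D" "Cod E a = Cod E u0" "pts E a = pts E u0 \<inter> pts E s0"
      by (rule intersection[of u0 s0]) (use U S in simp_all)
    obtain b where b: "b \<in> D" "Cod E b = Cod E u0" "pts E b = pts E u0 \<inter> pts E s1"
      by (rule intersection[of u0 s1]) (use U S in simp_all)
    obtain w where w: "w \<in> D" "is_union E a b w"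
      using CS2[of a b] a b by auto
    have ab: "a \<in> pts E u0" "a \<in> pts E s0" "b \<in> pts E u0" "b \<in> pts E s1"
      using pts_self[of a] pts_self[of b] a b by auto
    have sub: "pts E a \<subseteq> pts E w" "pts E b \<subseteq> pts E w"
      using w(2) by (simp_all add: is_union_pts)
    have wc: "Cod E w = Cod E u0"
      using sub(1) pts_self[of a] pts_cod[of a w] a by (simp add: subset_iff)
    have "u0 \<in> pts E w"
    proof (rule covers_local[OF S(1), of u0])
      show "u0 \<cdot> x \<in> pts E w" if "x \<in> Arr E" "Cod E x = Dom E u0" "u0 \<cdot> x \<in> pts E s0" for x
        using sub(1) a(3) that pts_I[of u0 x] U by auto
      show "u0 \<cdot> x \<in> pts E w" if "x \<in> Arr E" "Cod E x = Dom E u0" "u0 \<cdot> x \<in> pts E s1" for x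
        using sub(2) b(3) that pts_I[of u0 x] U by auto
    qed (use U w wc in simp_all)
    then have "pts E u0 \<subseteq> pts E w"
      using pts_le_iff[of u0 w] U w by simp
    moreover have "pts E w \<subseteq> pts E u0"
      using w(2) a(3) b(3) U unfolding is_union_pts by auto
    ultimately have un: "is_union E a b u0"
      by (intro is_union_same[OF w(2)]) (use a b U in auto)
    have ha: "Comp X h (FArr H a) \<in> X.Z"
      unfolding split[OF S(2) S(4) ab(2)]
      by (rule X.Z_comp_right[OF hh(4)]) (use hh S ab H_simps a in simp_all)
    have hb: "Comp X h (FArr H b) \<in> X.Z"
      using on1[OF ab(4)] H_trivial[OF u0[OF ab(3,4)]] by simp
    have "Comp X h (FArr H u0) \<in> X.Z"
      by (rule H_zero_on_union[OF a(1) b(1) un hh(1) _ ha hb]) (use hh U in simp)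
    then show ?thesis
      using on1[OF u1] by simp
  qed
  obtain u0 u1 where u: "eqv_on u0 u1 (s0, s1, f) (t0, t1, g)"
    using e by (rule eqvE)
  note u = eqv_onD[OF u]
  note U = coversD[OF u(3)]
  have u1: "u1 \<in> pts E u1" "u1 \<in> pts E s1" "u1 \<in> pts E t1"
    using u(4,5) pts_self[of u1] U by auto
  have cov': "covers (Cod E t1) u0 u1"
    using u(1,3) by simp
  have m: "Comp X h (FArr H u1) = FArr H (ap E s1 f u1) \<and> Comp X h (FArr H u0) \<in> X.Z"
    by (rule main[OF x h u(3) u1(2)]) (rule u(7))
  have m': "Comp X h' (FArr H u1) = FArr H (ap E t1 g u1) \<and> Comp X h' (FArr H u0) \<in> X.Z"
    by (rule main[OF y h' cov' u1(3)]) (rule u(8))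
  have hh: "h \<in> Arr X" "Dom X h = FObj H (Cod E s1)" "Cod X h = FObj H (Cod E f)"
    using h by (simp_all add: extends_def)
  have hh': "h' \<in> Arr X" "Dom X h' = FObj H (Cod E s1)" "Cod X h' = FObj H (Cod E f)"
    using h' u(1,2) by (simp_all add: extends_def)
  have "Comp X h (FArr H u1) = Comp X h' (FArr H u1)"
    using m m' u(6)[OF u1(1)] by simp
  then show ?thesis
    using m m' hh hh' by (intro H_zero_unique[OF u(3) hh(1,2) hh'(1,2)]) simp_all
qed

text \<open>The description ranges over all triples of the class, so that it is well defined
  precisely by \<open>extends_eqv\<close>.\<close>

definition lift_arr :: "'m triple set set \<Rightarrow> 'q" where
  "lift_arr \<alpha> = (THE h. \<exists>x\<in>triples E D Z. \<alpha> = cls x \<and> extends x h)"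

lemma lift_arr_eq:
  assumes "(s0, s1, f) \<in> triples E D Z" "extends (s0, s1, f) h"
  shows "lift_arr (cls (s0, s1, f)) = h"
  unfolding lift_arr_def
proof (rule the_equality)
  show "\<exists>x\<in>triples E D Z. cls (s0, s1, f) = cls x \<and> extends x h"
    using assms by blast
  fix h' assume "\<exists>x\<in>triples E D Z. cls (s0, s1, f) = cls x \<and> extends x h'"
  then obtain x where x: "x \<in> triples E D Z" "cls (s0, s1, f) = cls x" "extends x h'"
    by blast
  obtain t0 t1 g where xs: "x = (t0, t1, g)" by (cases x)
  have "eqv (s0, s1, f) (t0, t1, g)"
    using x assms cls_eq xs by blast
  then show "h' = h"
    using extends_eqv[OF assms(1) _ _ assms(2)] x xs by blast
qed

lemma lift_arr_extends:
  assumes "(s0, s1, f) \<in> triples E D Z"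
  shows "extends (s0, s1, f) (lift_arr (cls (s0, s1, f)))"
  using extends_exists[OF assms] lift_arr_eq[OF assms] by metis

definition lift :: "('o, 'm triple set set, 'p, 'q) fctr" where
  "lift = \<lparr>FObj = FObj H, FArr = restrict lift_arr (Arr St)\<rparr>"

lemma lift_sg:
  assumes f: "f \<in> Arr E" shows "lift_arr (sg f) = FArr H f"
  unfolding sg_def
proof (rule lift_arr_eq[OF sg_triple[OF f]])
  note Z0 = zero_hom(1-3)[of "Dom E f"]
  have "FObj H zero \<in> TX \<inter> FX"
    using zero_trivial H_torsion by (auto simp: torsion_functor_def)
  then have "Comp X (FArr H f) (FArr H (from_initial E zero (Dom E f))) \<in> X.Z"
    using X.factoring_dom[of "Comp X (FArr H f) (FArr H (from_initial E zero (Dom E f)))" "TX \<inter> FX"]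
      H_simps f Z0 by simp
  then show "extends (from_initial E zero (Dom E f), Ident E (Dom E f), f) (FArr H f)"
    unfolding extends_def using f H_simps by simp
qed

text \<open>The composite in \<open>X\<close> is shown to extend the composite triple. Zero on
  \<open>w0\<close> is tested on \<open>s0\<close>, where the first factor vanishes, and on
  \<open>v\<close>, which the first factor carries into \<open>t0\<close>, where the second
  vanishes.\<close>

lemma lift_comp:
  assumes x: "(s0, s1, f) \<in> triples E D Z" and y: "(t0, t1, g) \<in> triples E D Z" and cod: "Cod E f
    = Cod E t1"
  shows "lift_arr (Comp St (cls (t0, t1, g)) (cls (s0, s1, f))) =
    Comp X (lift_arr (cls (t0, t1, g))) (lift_arr (cls (s0, s1, f)))"
proof -
  note S = tripleD[OF x] and T' = tripleD[OF y]
  let ?a = "lift_arr (cls (s0, s1, f))" and ?b = "lift_arr (cls (t0, t1, g))"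
  obtain w0 w1 h where w: "is_composite E (t0, t1, g) (s0, s1, f) (w0, w1, h)"
    using composite_exists[OF x y cod] by (metis prod_cases3)
  obtain v where v: "w0 \<in> D" "w1 \<in> D" "v \<in> D" "Cod E v = Cod E s1"
      "Cod E w0 = Cod E s1" "Cod E w1 = Cod E s1" "h \<in> Arr E" "Dom E h = Dom E w1"
      "Cod E h = Cod E g"
      "pts E v = {z \<in> pts E s1. ap E s1 f z \<in> pts E t0}" "is_union E s0 v w0"
      "pts E w1 = {z \<in> pts E s1. ap E s1 f z \<in> pts E t1}"
      "\<And>z. z \<in> pts E w1 \<Longrightarrow> ap E w1 h z = ap E t1 g (ap E s1 f z)"
    by (rule compositeE[OF x y w]) blast
  have a: "?a \<in> Arr X" "Dom X ?a = FObj H (Cod E s1)" "Cod X ?a = FObj H (Cod E f)"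
    "Comp X ?a (FArr H s1) = FArr H f" "Comp X ?a (FArr H s0) \<in> X.Z"
    using lift_arr_extends[OF x] by (auto simp: extends_def)
  have b: "?b \<in> Arr X" "Dom X ?b = FObj H (Cod E f)" "Cod X ?b = FObj H (Cod E g)"
    "Comp X ?b (FArr H t1) = FArr H g" "Comp X ?b (FArr H t0) \<in> X.Z"
    using lift_arr_extends[OF y] cod by (auto simp: extends_def)
  \<comment> \<open>The composite at an element of \<open>s1\<close>, factored through any
    distinguished \<open>t\<close> that contains its value; \<open>t\<close> is \<open>t1\<close>
    for the defined part and \<open>t0\<close> for the zero part.\<close>
  have az: "Comp X (Comp X ?b ?a) (FArr H z)
    = Comp X (Comp X ?b (FArr H t)) (FArr H (fac E t (ap E s1 f z)))"
    if z: "z \<in> pts E s1" and t: "t \<in> D" "Cod E t = Cod E f" "ap E s1 f z \<in> pts E t" for z t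
  proof -
    have "FArr H z = Comp X (FArr H s1) (FArr H (fac E s1 z))"
      using H_simps(6)[of "fac E s1 z" s1] z S by simp
    then have "Comp X (Comp X ?b ?a) (FArr H z)
      = Comp X ?b (Comp X (Comp X ?a (FArr H s1)) (FArr H (fac E s1 z)))"
      using a(1-3) b(1,2) H_simps z S by (simp add: X.assoc del: fac_simps(4))
    also have "Comp X (Comp X ?a (FArr H s1)) (FArr H (fac E s1 z)) = FArr H (ap E s1 f z)"
      using a(4) H_simps(6)[of "fac E s1 z" f] z S by (simp add: ap_def)
    also have "FArr H (ap E s1 f z) = Comp X (FArr H t) (FArr H (fac E t (ap E s1 f z)))"
      using H_simps(6)[of "fac E t (ap E s1 f z)" t] t by simp
    also have "Comp X ?b (Comp X (FArr H t) (FArr H (fac E t (ap E s1 f z)))) =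
        Comp X (Comp X ?b (FArr H t)) (FArr H (fac E t (ap E s1 f z)))"
      by (rule X.assoc[symmetric]) (use b(1,2) H_simps t in simp_all)
    finally show ?thesis .
  qed
  have w1: "w1 \<in> pts E w1" "w1 \<in> pts E s1" "ap E s1 f w1 \<in> pts E t1"
    using pts_self[of w1] v(2,12) by auto
  have "Comp X (Comp X ?b ?a) (FArr H w1) = Comp X (FArr H g) (FArr H (fac E t1 (ap E s1 f w1)))"
    using az[OF w1(2) T'(3) cod[symmetric] w1(3)] b(4) by simp
  also have "\<dots> = FArr H (ap E t1 g (ap E s1 f w1))"
    using H_simps(6)[of "fac E t1 (ap E s1 f w1)" g] T' w1(3) by (simp add: ap_def)
  also have "ap E t1 g (ap E s1 f w1) = h"
    using v(13)[OF w1(1)] v by simp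
  finally have 1: "Comp X (Comp X ?b ?a) (FArr H w1) = FArr H h" .
  have v1: "v \<in> pts E s1" "ap E s1 f v \<in> pts E t0"
    using pts_self[of v] v(3,10) by auto
  have t0c: "Cod E t0 = Cod E f"
    using T' cod by simp
  have "Comp X (Comp X ?b (FArr H t0)) (FArr H (fac E t0 (ap E s1 f v))) \<in> X.Z"
    by (rule X.Z_comp_right[OF b(5)]) (use b v1 T' t0c H_simps in simp_all)
  then have 2: "Comp X (Comp X ?b ?a) (FArr H v) \<in> X.Z"
    using az[OF v1(1) T'(2) t0c v1(2)] by simp
  have "Comp X ?b (Comp X ?a (FArr H s0)) \<in> X.Z"
    by (rule X.Z_comp_left[OF a(5)]) (use a b S H_simps in simp_all)
  moreover have "Comp X (Comp X ?b ?a) (FArr H s0) = Comp X ?b (Comp X ?a (FArr H s0))"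
    by (rule X.assoc) (use a b S H_simps in simp_all)
  ultimately have 3: "Comp X (Comp X ?b ?a) (FArr H s0) \<in> X.Z"
    by simp
  have "Comp X (Comp X ?b ?a) (FArr H w0) \<in> X.Z"
    by (rule H_zero_on_union[OF S(2) v(3,11) _ _ 3 2]) (use a b v in simp_all)
  then have "extends (w0, w1, h) (Comp X ?b ?a)"
    unfolding extends_def using 1 a b v by simp
  then show ?thesis
    using lift_arr_eq[OF composite_triple[OF x y w]] Stab_Comp[OF x y w] by simp
qed

lemma lift_functor: "is_functor St X lift"
  unfolding is_functor_def
proof (intro conjI ballI impI)
  show "category St" "category X"
    by (rule Stab_category, rule X.category_axioms)
  show "FObj lift \<in> Obj St \<rightarrow>\<^sub>E Obj X"
    using functorD(3)[OF H_functor] by (simp add: lift_def)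
  have arr: "lift_arr \<alpha> \<in> hom X (FObj H (Dom St \<alpha>)) (FObj H (Cod St \<alpha>))" if \<alpha>: "\<alpha> \<in> Arr St" for \<alpha>
  proof -
    obtain s0 s1 f where s: "(s0, s1, f) \<in> triples E D Z" "\<alpha> = cls (s0, s1, f)"
      using \<alpha> by (rule Stab_arrE)
    then show ?thesis
      using lift_arr_extends[OF s(1)] Stab_Dom[OF s(1)] by (simp add: extends_def)
  qed
  then show "FArr lift \<in> Arr St \<rightarrow>\<^sub>E Arr X"
    by (auto simp: lift_def)
  show "FArr lift \<alpha> \<in> hom X (FObj lift (Dom St \<alpha>)) (FObj lift (Cod St \<alpha>))" if "\<alpha> \<in> Arr St" for \<alpha>
    using arr[OF that] that by (simp add: lift_def)
  show "FArr lift (Ident St A) = Ident X (FObj lift A)" if "A \<in> Obj St" for A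
    using that Stab_Ident[of A] lift_sg[of "Ident E A"] H_simps(5)[of A] sg_simps(1)[of "Ident E A"]
    by (simp add: lift_def)
  fix \<alpha> \<beta> assume *: "\<alpha> \<in> Arr St" "\<beta> \<in> Arr St" "Dom St \<beta> = Cod St \<alpha>"
  obtain s0 s1 f where s: "(s0, s1, f) \<in> triples E D Z" "\<alpha> = cls (s0, s1, f)"
    using *(1) by (rule Stab_arrE)
  obtain t0 t1 g where t: "(t0, t1, g) \<in> triples E D Z" "\<beta> = cls (t0, t1, g)"
    using *(2) by (rule Stab_arrE)
  have "Cod E f = Cod E t1"
    using *(3) Stab_Dom[OF s(1)] Stab_Dom[OF t(1)] s(2) t(2) by simp
  moreover have "Comp St \<beta> \<alpha> \<in> Arr St"
    using * by simp
  ultimately show "FArr lift (Comp St \<beta> \<alpha>) = Comp X (FArr lift \<beta>) (FArr lift \<alpha>)"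
    using lift_comp[OF s(1) t(1)] *(1,2) s(2) t(2) by (simp add: lift_def)
qed

text \<open>Each canonical sequence of the stable category is isomorphic to the image of one from
  \<open>E\<close> with the same middle object. There \<open>lift\<close> agrees with
  \<open>H\<close>, and functors preserve isomorphisms.\<close>

lemma lift_torsion: "torsion_functor St T F X TX FX lift"
proof -
  interpret S: torsion_theory St T F
    by (rule Stab_torsion_theory)
  have "canonical_seq X TX FX (FObj lift A) (FArr lift k) (FArr lift q)" if c: "canonical_seq St T F
    A k q" for A k q
  proof -
    have A: "A \<in> Obj E"
      using S.canonicalD(1)[OF c] by simp
    obtain k0 q0 where c0: "canonical_seq E T F A k0 q0"
      using PT2[OF A] by blast
    note K = canonicalD[OF c0]
    obtain i j where ij: "is_iso St i" "is_iso St j" "Dom St i = Cod St (sg q0)"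
      "Cod St j = Dom St (sg k0)" "q = Comp St i (sg q0)" "k = Comp St (sg k0) j"
      by (rule S.canonical_unique[OF sg_canonical[OF c0] c]) blast
    have ija: "i \<in> Arr St" "j \<in> Arr St"
      using ij by (simp_all add: is_iso_def)
    note L = functorD[OF lift_functor]
    have lO: "FObj lift = FObj H"
      by (simp add: lift_def)
    have Lsg: "FArr lift (sg k0) = FArr H k0" "FArr lift (sg q0) = FArr H q0"
      using lift_sg[OF K(2)] lift_sg[OF K(3)] sg_simps(1)[OF K(2)] sg_simps(1)[OF K(3)]
        by (simp_all add: lift_def)
    have Lc: "FArr lift k = Comp X (FArr H k0) (FArr lift j)"
      "FArr lift q = Comp X (FArr lift i) (FArr H q0)"
      using L(10)[of j "sg k0"] L(10)[of "sg q0" i] ij ija sg_simps(1)[OF K(2)] sg_simps(1)[OF K(3)]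
        Lsg by simp_all
    have "canonical_seq X TX FX (FObj H A) (FArr H k0) (FArr H q0)"
      using H_torsion c0 unfolding torsion_functor_def by blast
    then have "canonical_seq X TX FX (FObj H A) (Comp X (FArr H k0) (FArr lift j)) (Comp X (FArr
      lift i) (FArr H q0))"
      by (rule X.canonical_iso[OF _ functor_iso[OF lift_functor ij(2)]
        _ functor_iso[OF lift_functor ij(1)]])
        (use ij(3,4) L(8)[OF ija(2)] L(7)[OF ija(1)] H_simps(3,4) K sg_simps in \<open>simp_all add: lO\<close>)
    then show ?thesis
      using Lc by (simp add: lift_def)
  qed
  moreover have "FObj lift ` T \<subseteq> TX" "FObj lift ` F \<subseteq> FX"
    using H_torsion by (simp_all add: torsion_functor_def lift_def)
  ultimately show ?thesis
    unfolding torsion_functor_def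
    using S.pretorsion_theory_axioms X.pretorsion_theory_axioms lift_functor by blast
qed

lemma lift_factors: "compose_functors E lift \<sigma> = H"
proof -
  have "FObj (compose_functors E lift \<sigma>) = FObj H"
  proof
    fix A show "FObj (compose_functors E lift \<sigma>) A = FObj H A"
      using PiE_arb[OF functorD(3)[OF H_functor], of A]
      by (cases "A \<in> Obj E") (simp_all add: compose_functors_def compose_def lift_def)
  qed
  moreover have "FArr (compose_functors E lift \<sigma>) = FArr H"
  proof
    fix f show "FArr (compose_functors E lift \<sigma>) f = FArr H f"
      using PiE_arb[OF functorD(4)[OF H_functor], of f] lift_sg[of f] sg_simps(1)[of f]
      by (cases "f \<in> Arr E") (simp_all add: compose_functors_def compose_def lift_def)
  qed
  ultimately show ?thesis
    by simp
qed

text \<open>The class \<open>\<alpha>\<close> of \<open>(s0, s1, f)\<close> composes with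
  \<open>sg s1\<close> to \<open>sg f\<close> and with \<open>sg s0\<close> to a trivial arrow. A
  torsion functor preserves both facts, so \<open>FArr G \<alpha>\<close> extends the triple and
  \<open>lift_arr_eq\<close> fixes it.\<close>

lemma lift_unique:
  assumes G: "torsion_functor St T F X TX FX G" and GH: "compose_functors E G \<sigma> = H"
  shows "G = lift"
proof -
  have Gf: "is_functor St X G"
    using G by (simp add: torsion_functor_def)
  note L = functorD[OF Gf]
  have GO: "FObj G A = FObj H A" if "A \<in> Obj E" for A
  proof -
    have "FObj (compose_functors E G \<sigma>) A = FObj G A"
      using that by (simp add: compose_functors_def compose_def)
    then show ?thesis
      by (simp only: GH)
  qed
  have GA: "FArr G (sg f) = FArr H f" if "f \<in> Arr E" for f
  proof -
    have "FArr (compose_functors E G \<sigma>) f = FArr G (sg f)"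
      using that by (simp add: compose_functors_def compose_def)
    then show ?thesis
      by (simp only: GH)
  qed
  have "FObj G = FObj lift"
  proof
    fix A show "FObj G A = FObj lift A"
      using GO[of A] PiE_arb[OF L(3), of A] PiE_arb[OF functorD(3)[OF H_functor], of A]
      by (cases "A \<in> Obj E") (simp_all add: lift_def)
  qed
  moreover have "FArr G \<alpha> = lift_arr \<alpha>" if a: "\<alpha> \<in> Arr St" for \<alpha>
  proof -
    obtain s0 s1 f where s: "(s0, s1, f) \<in> triples E D Z" "\<alpha> = cls (s0, s1, f)"
      using a by (rule Stab_arrE)
    note S = tripleD[OF s(1)]
    have s1: "Comp St \<alpha> (sg s1) = sg f"
    proof -
      obtain v0 v1 l where v: "(v0, v1, l) \<in> triples E D Z"
        "Comp St (cls (s0, s1, f)) (sg s1) = cls (v0, v1, l)"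
        "pts E v1 = {z \<in> Arr E. Cod E z = Dom E s1 \<and> s1 \<cdot> z \<in> pts E s1}"
        "\<And>z. z \<in> pts E v1 \<Longrightarrow> ap E v1 l z = ap E s1 f (s1 \<cdot> z)"
        by (rule cls_comp_sg[OF s(1), of s1]) (use S in auto)
      have eq: "pts E v1 = pts E (Ident E (Dom E f))"
        using v(3) pts_I[of s1] S by auto
      have "cls (v0, v1, l) = sg f"
        unfolding sg_def
      proof (rule cls_eqI[OF v(1) sg_triple[OF S(5)] eq])
        fix z assume z: "z \<in> pts E v1"
        have "fac E s1 (s1 \<cdot> z) = z"
          by (rule fac_unique) (use z v(3) S in simp_all)
        then show "ap E v1 l z = ap E (Ident E (Dom E f)) f z"
          using v(4)[OF z] z v(3) S by (simp add: ap_def)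
      qed
      then show ?thesis
        using v(2) s(2) by simp
    qed
    have s0: "Comp St \<alpha> (sg s0) \<in> trivials St T F"
    proof -
      obtain v0 v1 l where v: "(v0, v1, l) \<in> triples E D Z"
        "Comp St (cls (s0, s1, f)) (sg s0) = cls (v0, v1, l)"
        "pts E v1 = {z \<in> Arr E. Cod E z = Dom E s0 \<and> s0 \<cdot> z \<in> pts E s1}"
        "\<And>z. z \<in> pts E v1 \<Longrightarrow> ap E v1 l z = ap E s1 f (s0 \<cdot> z)"
        by (rule cls_comp_sg[OF s(1), of s0]) (use S in auto)
      note V = tripleD[OF v(1)]
      have vv: "v1 \<in> pts E v1"
        using V by simp
      then have "s0 \<cdot> v1 \<in> pts E s1" "s0 \<cdot> v1 \<in> pts E s0"
        using v(3) pts_I[of s0 v1] S by auto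
      then have "ap E v1 l v1 \<in> Z"
        using v(4)[OF vv] S(7) by simp
      then show ?thesis
        using trivial_cls[OF v(1)] V v(2) s(2) by simp
    qed
    have d: "Dom St \<alpha> = Cod E s1" "Cod St \<alpha> = Cod E f"
      using Stab_Dom[OF s(1)] s(2) by simp_all
    have "extends (s0, s1, f) (FArr G \<alpha>)"
      unfolding extends_def prod.case
    proof (intro conjI)
      show "FArr G \<alpha> \<in> hom X (FObj H (Cod E s1)) (FObj H (Cod E f))"
        using L(6-8)[OF a] d GO S by simp
      have "FArr G (Comp St \<alpha> (sg s1)) = Comp X (FArr G \<alpha>) (FArr G (sg s1))"
        by (rule L(10)) (use a d sg_simps S in simp_all)
      then show "Comp X (FArr G \<alpha>) (FArr H s1) = FArr H f"
        using s1 GA S by simp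
      have "FArr G (Comp St \<alpha> (sg s0)) = Comp X (FArr G \<alpha>) (FArr G (sg s0))"
        by (rule L(10)) (use a d sg_simps S in simp_all)
      moreover have "FArr G (Comp St \<alpha> (sg s0)) \<in> X.Z"
        by (rule functor_trivials[OF Gf s0]) (use G in \<open>auto simp: torsion_functor_def\<close>)
      ultimately show "Comp X (FArr G \<alpha>) (FArr H s0) \<in> X.Z"
        using GA S by simp
    qed
    then show ?thesis
      using lift_arr_eq[OF s(1)] s(2) by simp
  qed
  then have "FArr G \<alpha> = FArr lift \<alpha>" for \<alpha>
    using PiE_arb[OF L(4), of \<alpha>] by (cases "\<alpha> \<in> Arr St") (simp_all add: lift_def)
  then have "FArr G = FArr lift"
    by (rule ext)
  ultimately show ?thesis
    by simp
qed

end

theorem theorem6p4: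
  fixes E :: "('o, 'm) cat" and zero :: 'o and D :: "'m set" and T F :: "'o set"
  assumes "compatible E zero D T F"
  shows "stable_functor_into E D T F (Stab E zero D T F) T F (stab_functor E zero D T F) \<and>
    (\<forall>(X :: ('p, 'q) cat) TX FX H. stable_functor_into E D T F X TX FX H \<longrightarrow>
       (\<exists>!G. torsion_functor (Stab E zero D T F) T F X TX FX G \<and>
             compose_functors E G (stab_functor E zero D T F) = H))"
proof (intro conjI allI impI)
  show "stable_functor_into E D T F (Stab E zero D T F) T F (stab_functor E zero D T F)"
    by (rule compatible.stab_functor_stable[OF assms])
  fix X :: "('p, 'q) cat" and TX FX H
  assume H: "stable_functor_into E D T F X TX FX H"
  interpret stable_functor E zero D T F X TX FX H
    using assms H unfolding stable_functor_into_def
    by (intro stable_functor.intro stable_functor_axioms.intro) blast+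
  show "\<exists>!G. torsion_functor (Stab E zero D T F) T F X TX FX G \<and>
             compose_functors E G (stab_functor E zero D T F) = H"
    using lift_torsion lift_factors lift_unique by blast
qed

end
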